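(* Let $a<b$ be coprime positive integers, let $\chi$ be the permutation character of the action of $\mathfrak{S}_a\times\mathbb{Z}_{b-1}$ on $\mathsf{Park}^{NC}(a,b)$ (with $\mathfrak{S}_a$ permuting labels and a generator $g$ of $\mathbb{Z}_{b-1}$ acting by rotation), let $V=\mathbb{C}^a/\langle(1,\dots,1)\rangle$ be the reflection representation of $\mathfrak{S}_a$, and let $\zeta=e^{2\pi i/(b-1)}$. For $w\in\mathfrak{S}_a$ and $d\ge0$ let $\mathrm{mult}_w(\zeta^d)$ be the multiplicity of $\zeta^d$ as an eigenvalue of $w$ acting on $V$. Then for all $w\in\mathfrak{S}_a$ and $d\ge 0$, $$\chi(w,g^d)=b^{\mathrm{mult}_w(\zeta^d)}.$$
   Context: Let $a<b$ be coprime positive integers and $[b-1]=\{1,\dots,b-1\}$. An $a,b$-Dyck path is a lattice path from $(0,0)$ to $(b,a)$ using unit north and east steps that stays weakly above the line $y=\frac{a}{b}x$. A valley of such a path $D$ is a lattice point of $D$ immediately preceded by an east step and immediately followed by a north step. From each valley $P$ fire the laser $\ell(P)$: the segment of slope $\frac ab$ from $P$ going northeast until it first meets $D$ again. Label the east endpoints of the first $b-1$ east steps of $D$ from left to right by $1,\dots,b-1$, each label regarded as sitting slightly below its lattice point. The set partition $\pi(D)$ of $[b-1]$ declares $i\sim j$ iff labels $i,j$ are not separated by any valley laser. $\mathsf{NC}(a,b)=\{\pi(D): D\text{ an }a,b\text{-Dyck path}\}$. Rank: for a noncrossing partition $\pi$ of $[b-1]$, order its blocks by $B'\preceq B$ iff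 $[\min B',\max B']\subseteq[\min B,\max B]$; the integers $\mathrm{rank}^{\pi}_{a,b}(B)$ are the unique integers with $\sum_{B'\preceq B}\mathrm{rank}^{\pi}_{a,b}(B')=\lceil(\max B-\min B+1)\frac ab\rceil$ for all blocks $B$. An $a,b$-noncrossing parking function is a pair $(\pi,f)$ with $\pi\in\mathsf{NC}(a,b)$ and $f$ a labeling of the blocks of $\pi$ by subsets of $[a]$ such that $[a]=\biguplus_{B\in\pi}f(B)$ (disjoint union) and $|f(B)|=\mathrm{rank}^{\pi}_{a,b}(B)$ for every block $B$; $\mathsf{Park}^{NC}(a,b)$ is the set of these. $w\in\mathfrak S_a$ acts by $(\pi,f)\mapsto(\pi,w\circ f)$ (replace each label set $f(B)$ by $w(f(B))$), and $g$ acts by rotation $(\pi,f)\mapsto(\mathtt{rot}(\pi), B\mapsto f(\mathtt{rot}^{-1}B))$, where $\mathtt{rot}$ is $i\mapsto i+1$ ($i<b-1$), $b-1\mapsto 1$; these commute and give an action of $\mathfrak{S}_a\times\mathbb{Z}_{b-1}$ (rotation preserves ranks). $\chi(w,g^d)$ is the number of elements of $\mathsf{Park}^{NC}(a,b)$ fixed by $(w,g^d)$. *)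

theory Defs
  imports
    "HOL-Analysis.Line_Segment"
    "HOL-Combinatorics.Permutations"
    "HOL-Algebra.AbelCoset"
    "Jordan_Normal_Form.VS_Connect"
begin

datatype step = North | East

definition path_pt :: "step list \<Rightarrow> nat \<Rightarrow> nat \<times> nat" where
  "path_pt D k = (count_list (take k D) East, count_list (take k D) North)"

definition dyck_paths :: "nat \<Rightarrow> nat \<Rightarrow> step list set" where
  "dyck_paths a b =
     {D. path_pt D (length D) = (b, a) \<and>
         (\<forall>k\<le>length D. real (snd (path_pt D k)) \<ge> real a / real b * real (fst (path_pt D k)))}"

definition plane_pt :: "nat \<times> nat \<Rightarrow> real \<times> real" where
  "plane_pt P = (real (fst P), real (snd P))"

definition path_curve :: "step list \<Rightarrow> (real \<times> real) set" where
  "path_curve D =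
     (\<Union>k<length D. closed_segment (plane_pt (path_pt D k)) (plane_pt (path_pt D (Suc k))))"

definition valleys :: "step list \<Rightarrow> (nat \<times> nat) set" where
  "valleys D = {path_pt D k | k. 0 < k \<and> k < length D \<and> D ! (k - 1) = East \<and> D ! k = North}"

definition laser :: "nat \<Rightarrow> nat \<Rightarrow> step list \<Rightarrow> nat \<times> nat \<Rightarrow> (real \<times> real) set" where
  "laser a b D P =
     {plane_pt P + t *\<^sub>R (real b, real a) | t.
        0 \<le> t \<and> (\<forall>s. 0 < s \<and> s < t \<longrightarrow> plane_pt P + s *\<^sub>R (real b, real a) \<notin> path_curve D)}"

text \<open>The height at which the \<open>i\<close>-th east step is taken, so that its east endpoint
  is the lattice point \<open>(i, east_height D i)\<close>.\<close>

definition east_height :: "step list \<Rightarrow> nat \<Rightarrow> nat" where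
  "east_height D i =
     (THE y. \<exists>k<length D. D ! k = East \<and> path_pt D (Suc k) = (i, y))"

text \<open>A laser is a chord, with both endpoints on \<open>D\<close>, of the region below \<open>D\<close>. It cuts this
  region into the part lying vertically above the chord and the rest. The label \<open>i\<close> is the point
  \<open>(i, east_height D i - \<epsilon>)\<close> for all sufficiently small \<open>\<epsilon> > 0\<close>; in particular a label at a
  valley is not above the laser fired from that valley.\<close>

definition label_above :: "step list \<Rightarrow> (real \<times> real) set \<Rightarrow> nat \<Rightarrow> bool" where
  "label_above D L i \<longleftrightarrow>
     (\<forall>\<^sub>F \<epsilon> in at_right 0. \<exists>y. (real i, y) \<in> L \<and> y < real (east_height D i) - \<epsilon>)"

definition separates :: "step list \<Rightarrow> (real \<times> real) set \<Rightarrow> nat \<Rightarrow> nat \<Rightarrow> bool" where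
  "separates D L i j \<longleftrightarrow> label_above D L i \<noteq> label_above D L j"

definition dyck_partition :: "nat \<Rightarrow> nat \<Rightarrow> step list \<Rightarrow> nat set set" where
  "dyck_partition a b D =
     {1..b - 1} // {(i, j). i \<in> {1..b - 1} \<and> j \<in> {1..b - 1} \<and>
                            (\<forall>P\<in>valleys D. \<not> separates D (laser a b D P) i j)}"

definition NC :: "nat \<Rightarrow> nat \<Rightarrow> nat set set set" where
  "NC a b = dyck_partition a b ` dyck_paths a b"

definition block_le :: "nat set \<Rightarrow> nat set \<Rightarrow> bool" (infix \<open>\<preceq>\<close> 50) where
  "B' \<preceq> B \<longleftrightarrow> {Min B'..Max B'} \<subseteq> {Min B..Max B}"

definition is_block_rank :: "nat \<Rightarrow> nat \<Rightarrow> nat set set \<Rightarrow> (nat set \<Rightarrow> int) \<Rightarrow> bool" where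
  "is_block_rank a b \<pi> r \<longleftrightarrow>
     (\<forall>B\<in>\<pi>. (\<Sum>B' | B' \<in> \<pi> \<and> B' \<preceq> B. r B') =
              \<lceil>real (Max B - Min B + 1) * (real a / real b)\<rceil>) \<and>
     (\<forall>B. B \<notin> \<pi> \<longrightarrow> r B = 0)"

definition block_rank :: "nat \<Rightarrow> nat \<Rightarrow> nat set set \<Rightarrow> nat set \<Rightarrow> int" where
  "block_rank a b \<pi> = (THE r. is_block_rank a b \<pi> r)"

lemma ex1_is_block_rank:
  assumes "finite \<pi>" and "disjoint \<pi>" and "\<And>B. B \<in> \<pi> \<Longrightarrow> finite B \<and> B \<noteq> {}"
  shows "\<exists>!r. is_block_rank a b \<pi> r"
  using assms
proof (induction \<pi> rule: finite_ranking_induct[where f = "\<lambda>B. Max B - Min B"])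
  case empty
  show ?case
    by (rule ex1I[of _ "\<lambda>_. 0"]) (auto simp: is_block_rank_def)
next
  case (insert B\<^sub>0 \<pi>)
  show ?case
  proof (cases "B\<^sub>0 \<in> \<pi>")
    case True
    then show ?thesis using insert by (simp add: insert_absorb)
  next
    case False
    define c where "c B = \<lceil>real (Max B - Min B + 1) * (real a / real b)\<rceil>" for B :: "nat set"
    have ne: "\<not> B\<^sub>0 \<preceq> B" if "B \<in> \<pi>" for B
    proof
      assume "B\<^sub>0 \<preceq> B"
      have f: "finite B" "B \<noteq> {}" "finite B\<^sub>0" "B\<^sub>0 \<noteq> {}" using insert.prems that by auto
      then have "Min B\<^sub>0 \<le> Max B\<^sub>0" "Min B \<le> Max B" by simp_all
      with \<open>B\<^sub>0 \<preceq> B\<close> have "Min B \<le> Min B\<^sub>0" "Max B\<^sub>0 \<le> Max B"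
        by (auto simp: block_le_def)
      moreover have "Max B - Min B \<le> Max B\<^sub>0 - Min B\<^sub>0" using insert.hyps that by auto
      ultimately have "Min B = Min B\<^sub>0" using \<open>Min B\<^sub>0 \<le> Max B\<^sub>0\<close> by linarith
      then have "B \<inter> B\<^sub>0 \<noteq> {}" using f Min_in by (metis disjoint_iff)
      then show False using insert.prems(1) that False
        by (metis disjointD insert_iff)
    qed
    have old: "{B'. B' \<in> insert B\<^sub>0 \<pi> \<and> B' \<preceq> B} = {B'. B' \<in> \<pi> \<and> B' \<preceq> B}" if "B \<in> \<pi>" for B
      using ne[OF that] by auto
    have new: "{B'. B' \<in> insert B\<^sub>0 \<pi> \<and> B' \<preceq> B\<^sub>0} = insert B\<^sub>0 {B'. B' \<in> \<pi> \<and> B' \<preceq> B\<^sub>0}"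
      by (auto simp: block_le_def)
    have "disjoint \<pi>" using insert.prems(1) by (auto simp: disjoint_def pairwise_def)
    then have ex1: "\<exists>!r. is_block_rank a b \<pi> r" using insert by auto
    then obtain r where r: "is_block_rank a b \<pi> r" by blast
    define r' where "r' = r(B\<^sub>0 := c B\<^sub>0 - (\<Sum>B' | B' \<in> \<pi> \<and> B' \<preceq> B\<^sub>0. r B'))"
    have upd: "(\<Sum>B' | B' \<in> \<pi> \<and> B' \<preceq> B. (s(B\<^sub>0 := x)) B') = (\<Sum>B' | B' \<in> \<pi> \<and> B' \<preceq> B. s B')"
      for B x and s :: "nat set \<Rightarrow> int"
      by (rule sum.cong) (use False in auto)
    show ?thesis
    proof (rule ex1I)
      show "is_block_rank a b (insert B\<^sub>0 \<pi>) r'"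
        unfolding is_block_rank_def
      proof (intro conjI ballI allI impI)
        fix B assume "B \<in> insert B\<^sub>0 \<pi>"
        then consider "B = B\<^sub>0" | "B \<in> \<pi>" by auto
        then show "(\<Sum>B' | B' \<in> insert B\<^sub>0 \<pi> \<and> B' \<preceq> B. r' B') =
              \<lceil>real (Max B - Min B + 1) * (real a / real b)\<rceil>"
        proof cases
          case 1
          have "(\<Sum>B' | B' \<in> insert B\<^sub>0 \<pi> \<and> B' \<preceq> B\<^sub>0. r' B') =
                r' B\<^sub>0 + (\<Sum>B' | B' \<in> \<pi> \<and> B' \<preceq> B\<^sub>0. r' B')"
            unfolding new using False insert.hyps by (subst sum.insert) auto
          also have "\<dots> = c B\<^sub>0" unfolding r'_def upd by simp
          finally show ?thesis unfolding 1 c_def .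
        next
          case 2
          then show ?thesis using r unfolding old[OF 2] r'_def upd is_block_rank_def by blast
        qed
      next
        fix B assume "B \<notin> insert B\<^sub>0 \<pi>"
        then show "r' B = 0" using r by (auto simp: r'_def is_block_rank_def)
      qed
    next
      fix s assume s: "is_block_rank a b (insert B\<^sub>0 \<pi>) s"
      have "is_block_rank a b \<pi> (s(B\<^sub>0 := 0))"
        unfolding is_block_rank_def
      proof (intro conjI ballI allI impI)
        fix B assume B: "B \<in> \<pi>"
        have "(\<Sum>B' | B' \<in> insert B\<^sub>0 \<pi> \<and> B' \<preceq> B. s B') =
              \<lceil>real (Max B - Min B + 1) * (real a / real b)\<rceil>"
          using s B unfolding is_block_rank_def by (metis insertI2)
        then show "(\<Sum>B' | B' \<in> \<pi> \<and> B' \<preceq> B. (s(B\<^sub>0 := 0)) B') =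
              \<lceil>real (Max B - Min B + 1) * (real a / real b)\<rceil>"
          unfolding old[OF B] upd .
      next
        fix B assume "B \<notin> \<pi>"
        then show "(s(B\<^sub>0 := 0)) B = 0" using s by (auto simp: is_block_rank_def)
      qed
      with ex1 r have eq: "r = s(B\<^sub>0 := 0)" by metis
      have "c B\<^sub>0 = (\<Sum>B' | B' \<in> insert B\<^sub>0 \<pi> \<and> B' \<preceq> B\<^sub>0. s B')"
        using s by (simp add: is_block_rank_def c_def)
      also have "\<dots> = s B\<^sub>0 + (\<Sum>B' | B' \<in> \<pi> \<and> B' \<preceq> B\<^sub>0. s B')"
        unfolding new using False insert.hyps by (subst sum.insert) auto
      finally have "s B\<^sub>0 = r' B\<^sub>0" unfolding r'_def eq by (simp add: upd[simplified])
      then show "s = r'" using eq by (auto simp: r'_def fun_eq_iff)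
    qed
  qed
qed

text \<open>Labelings are extensional (\<open>undefined\<close> off \<open>\<pi>\<close>), so that distinct pairs are distinct
  parking functions; the actions below restrict accordingly.\<close>

definition Park_NC :: "nat \<Rightarrow> nat \<Rightarrow> (nat set set \<times> (nat set \<Rightarrow> nat set)) set" where
  "Park_NC a b =
     {(\<pi>, f). \<pi> \<in> NC a b \<and> f \<in> \<pi> \<rightarrow>\<^sub>E Pow {1..a} \<and>
        disjoint_family_on f \<pi> \<and> (\<Union>B\<in>\<pi>. f B) = {1..a} \<and>
        (\<forall>B\<in>\<pi>. int (card (f B)) = block_rank a b \<pi> B)}"

definition perm_act ::
  "(nat \<Rightarrow> nat) \<Rightarrow> nat set set \<times> (nat set \<Rightarrow> nat set) \<Rightarrow> nat set set \<times> (nat set \<Rightarrow> nat set)" where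
  "perm_act w p = (fst p, \<lambda>B\<in>fst p. w ` snd p B)"

definition rot :: "nat \<Rightarrow> nat \<Rightarrow> nat" where
  "rot b i = (if i \<in> {1..<b - 1} then i + 1 else if i = b - 1 then 1 else i)"

definition rot_act ::
  "nat \<Rightarrow> nat set set \<times> (nat set \<Rightarrow> nat set) \<Rightarrow> nat set set \<times> (nat set \<Rightarrow> nat set)" where
  "rot_act b p =
     (let \<pi>' = (\<lambda>B. rot b ` B) ` fst p in (\<pi>', \<lambda>B\<in>\<pi>'. snd p (rot b -` B)))"

definition park_char :: "nat \<Rightarrow> nat \<Rightarrow> (nat \<Rightarrow> nat) \<Rightarrow> nat \<Rightarrow> nat" where
  "park_char a b w d = card {p \<in> Park_NC a b. perm_act w ((rot_act b ^^ d) p) = p}"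

definition quotient_module ::
  "('c, 'v, 'm) module_scheme \<Rightarrow> 'v set \<Rightarrow> ('c, 'v set) module" where
  "quotient_module M W =
     \<lparr>carrier = a_rcosets\<^bsub>M\<^esub> W, mult = undefined, one = undefined, zero = W, add = set_add M,
      smult = (\<lambda>c X. \<Union>x\<in>X. W +>\<^bsub>M\<^esub> (c \<odot>\<^bsub>M\<^esub> x))\<rparr>"

definition diagonal_line :: "nat \<Rightarrow> complex vec set" where
  "diagonal_line a = {c \<cdot>\<^sub>v vec a (\<lambda>_. 1) | c. True}"

definition refl_rep :: "nat \<Rightarrow> (complex, complex vec set) module" where
  "refl_rep a = quotient_module (module_vec TYPE(complex) a) (diagonal_line a)"

text \<open>Vectors are indexed from \<open>0\<close>, so \<open>unit_vec a i\<close> is the basis vector belonging to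
  \<open>i + 1 \<in> {1..a}\<close>, and the matrix maps the basis vector of \<open>j\<close> to that of \<open>w j\<close>.\<close>

definition perm_mat :: "nat \<Rightarrow> (nat \<Rightarrow> nat) \<Rightarrow> complex mat" where
  "perm_mat a w = mat a a (\<lambda>(i, j). if w (j + 1) = i + 1 then 1 else 0)"

definition refl_act :: "nat \<Rightarrow> (nat \<Rightarrow> nat) \<Rightarrow> complex vec set \<Rightarrow> complex vec set" where
  "refl_act a w X = (\<lambda>v. perm_mat a w *\<^sub>v v) ` X"

definition refl_eigenspace :: "nat \<Rightarrow> (nat \<Rightarrow> nat) \<Rightarrow> complex \<Rightarrow> complex vec set set" where
  "refl_eigenspace a w z =
     {X \<in> carrier (refl_rep a). refl_act a w X = z \<odot>\<^bsub>refl_rep a\<^esub> X}"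

text \<open>As \<open>w\<close> has finite order it is diagonalisable on the reflection representation, so the
  multiplicity of an eigenvalue is the dimension of its eigenspace (\<open>0\<close> if it is not an
  eigenvalue).\<close>

definition refl_mult :: "nat \<Rightarrow> (nat \<Rightarrow> nat) \<Rightarrow> complex \<Rightarrow> nat" where
  "refl_mult a w z =
     vectorspace.dim class_ring ((refl_rep a)\<lparr>carrier := refl_eigenspace a w z\<rparr>)"

lemma refl_rep_coset:
  assumes "x \<in> carrier_vec a"
  shows "diagonal_line a +>\<^bsub>module_vec TYPE(complex) a\<^esub> x = {x + c \<cdot>\<^sub>v vec a (\<lambda>_. 1) | c. True}"
  using assms
  by (force simp: a_r_coset_def r_coset_def diagonal_line_def module_vec_def
      intro: comm_add_vec[of _ a])

lemma refl_rep_carrier: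
  "carrier (refl_rep a) = {{x + c \<cdot>\<^sub>v vec a (\<lambda>_. 1) | c. True} | x. x \<in> carrier_vec a}"
proof -
  have "carrier (refl_rep a) =
      {diagonal_line a +>\<^bsub>module_vec TYPE(complex) a\<^esub> x | x. x \<in> carrier_vec a}"
    by (auto simp: refl_rep_def quotient_module_def A_RCOSETS_def RCOSETS_def a_r_coset_def
        module_vec_def)
  also have "\<dots> = {{x + c \<cdot>\<^sub>v vec a (\<lambda>_. 1) | c. True} | x. x \<in> carrier_vec a}"
    by (rule Collect_cong) (metis refl_rep_coset)
  finally show ?thesis .
qed

lemma refl_rep_add:
  assumes "x \<in> carrier_vec a" "y \<in> carrier_vec a"
  shows "{x + c \<cdot>\<^sub>v vec a (\<lambda>_. 1) | c. True} \<oplus>\<^bsub>refl_rep a\<^esub> {y + c \<cdot>\<^sub>v vec a (\<lambda>_. 1) | c. True} =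
    {(x + y) + c \<cdot>\<^sub>v vec a (\<lambda>_. 1) | c. True}" (is "?X \<oplus>\<^bsub>_\<^esub> ?Y = ?Z")
proof -
  have "?X \<oplus>\<^bsub>refl_rep a\<^esub> ?Y = {u + v | u v. u \<in> ?X \<and> v \<in> ?Y}"
    by (auto simp: refl_rep_def quotient_module_def set_add_def set_mult_def module_vec_def)
  also have "\<dots> = ?Z"
  proof (intro Set.set_eqI iffI)
    fix z assume "z \<in> {u + v | u v. u \<in> ?X \<and> v \<in> ?Y}"
    then obtain c c' where "z = (x + c \<cdot>\<^sub>v vec a (\<lambda>_. 1)) + (y + c' \<cdot>\<^sub>v vec a (\<lambda>_. 1))" by blast
    also have "\<dots> = (x + y) + (c + c') \<cdot>\<^sub>v vec a (\<lambda>_. 1)"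
      using assms by (intro eq_vecI) auto
    finally show "z \<in> ?Z" by blast
  next
    fix z assume "z \<in> ?Z"
    then obtain c where "z = (x + y) + c \<cdot>\<^sub>v vec a (\<lambda>_. 1)" by blast
    also have "\<dots> = (x + c \<cdot>\<^sub>v vec a (\<lambda>_. 1)) + (y + 0 \<cdot>\<^sub>v vec a (\<lambda>_. 1))"
      using assms by (intro eq_vecI) auto
    finally show "z \<in> {u + v | u v. u \<in> ?X \<and> v \<in> ?Y}" by blast
  qed
  finally show ?thesis .
qed

lemma refl_rep_smult:
  assumes "x \<in> carrier_vec a"
  shows "z \<odot>\<^bsub>refl_rep a\<^esub> {x + c \<cdot>\<^sub>v vec a (\<lambda>_. 1) | c. True} =
    {z \<cdot>\<^sub>v x + c \<cdot>\<^sub>v vec a (\<lambda>_. 1) | c. True}" (is "_ \<odot>\<^bsub>_\<^esub> ?X = ?Z")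
proof -
  have "?X \<subseteq> carrier_vec a" using assms by auto
  have "z \<odot>\<^bsub>refl_rep a\<^esub> ?X =
      (\<Union>u\<in>?X. diagonal_line a +>\<^bsub>module_vec TYPE(complex) a\<^esub> (z \<cdot>\<^sub>v u))"
    by (simp add: refl_rep_def quotient_module_def module_vec_def)
  also have "\<dots> = (\<Union>u\<in>?X. {z \<cdot>\<^sub>v u + c \<cdot>\<^sub>v vec a (\<lambda>_. 1) | c. True})"
    using \<open>?X \<subseteq> carrier_vec a\<close> by (intro SUP_cong refl refl_rep_coset) auto
  also have "\<dots> = ?Z"
  proof (intro Set.set_eqI iffI)
    fix y assume "y \<in> (\<Union>u\<in>?X. {z \<cdot>\<^sub>v u + c \<cdot>\<^sub>v vec a (\<lambda>_. 1) | c. True})"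
    then obtain c c' where "y = z \<cdot>\<^sub>v (x + c \<cdot>\<^sub>v vec a (\<lambda>_. 1)) + c' \<cdot>\<^sub>v vec a (\<lambda>_. 1)" by blast
    also have "\<dots> = z \<cdot>\<^sub>v x + (z * c + c') \<cdot>\<^sub>v vec a (\<lambda>_. 1)"
      using assms by (intro eq_vecI) (auto simp: algebra_simps)
    finally show "y \<in> ?Z" by blast
  next
    fix y assume "y \<in> ?Z"
    then obtain c where "y = z \<cdot>\<^sub>v x + c \<cdot>\<^sub>v vec a (\<lambda>_. 1)" by blast
    also have "\<dots> = z \<cdot>\<^sub>v (x + 0 \<cdot>\<^sub>v vec a (\<lambda>_. 1)) + c \<cdot>\<^sub>v vec a (\<lambda>_. 1)"
      using assms by (intro eq_vecI) auto
    finally show "y \<in> (\<Union>u\<in>?X. {z \<cdot>\<^sub>v u + c \<cdot>\<^sub>v vec a (\<lambda>_. 1) | c. True})" by blast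
  qed
  finally show ?thesis .
qed

lemma refl_rep_zero: "\<zero>\<^bsub>refl_rep a\<^esub> = {0\<^sub>v a + c \<cdot>\<^sub>v vec a (\<lambda>_. 1) | c. True}"
  by (force simp: refl_rep_def quotient_module_def diagonal_line_def)

lemma vectorspace_refl_rep: "vectorspace class_ring (refl_rep a)"
proof -
  define cl :: "complex vec \<Rightarrow> complex vec set"
    where "cl x = {x + c \<cdot>\<^sub>v vec a (\<lambda>_. 1) | c. True}" for x
  have ops: "\<And>x y. x \<in> carrier_vec a \<Longrightarrow> y \<in> carrier_vec a \<Longrightarrow> cl x \<oplus>\<^bsub>refl_rep a\<^esub> cl y = cl (x + y)"
    "\<And>x z. x \<in> carrier_vec a \<Longrightarrow> z \<odot>\<^bsub>refl_rep a\<^esub> cl x = cl (z \<cdot>\<^sub>v x)"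
    "\<zero>\<^bsub>refl_rep a\<^esub> = cl (0\<^sub>v a)"
    unfolding cl_def using refl_rep_add refl_rep_smult refl_rep_zero by blast+
  have car: "carrier (refl_rep a) = cl ` carrier_vec a"
    using refl_rep_carrier[of a] by (auto simp: cl_def)
  have "abelian_group (refl_rep a)"
  proof (rule abelian_groupI)
    fix X assume "X \<in> carrier (refl_rep a)"
    then obtain x where x: "x \<in> carrier_vec a" "X = cl x" unfolding car by blast
    then have "cl (- x) \<oplus>\<^bsub>refl_rep a\<^esub> X = \<zero>\<^bsub>refl_rep a\<^esub>" by (simp add: ops)
    then show "\<exists>Y\<in>carrier (refl_rep a). Y \<oplus>\<^bsub>refl_rep a\<^esub> X = \<zero>\<^bsub>refl_rep a\<^esub>"
      unfolding car using x by (metis imageI uminus_carrier_vec)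
  next
    fix X Y assume "X \<in> carrier (refl_rep a)" "Y \<in> carrier (refl_rep a)"
    then show "X \<oplus>\<^bsub>refl_rep a\<^esub> Y = Y \<oplus>\<^bsub>refl_rep a\<^esub> X"
      unfolding car by (auto simp: ops comm_add_vec[of _ a])
  qed (auto simp: car ops assoc_add_vec[of _ a])
  moreover have "field (class_ring :: complex ring)" by (rule class_field.field_axioms)
  moreover have "cring (class_ring :: complex ring)" by (rule class_cring.cring_axioms)
  ultimately show ?thesis
    unfolding vectorspace_def
    by (auto intro!: module.intro module_axioms.intro
        simp: car ops smult_add_distrib_vec[of _ a] add_smult_distrib_vec smult_smult_assoc)
qed

lemma refl_act_coset:
  assumes "w permutes {1..a}" and "x \<in> carrier_vec a"
  shows "refl_act a w {x + c \<cdot>\<^sub>v vec a (\<lambda>_. 1) | c. True} =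
    {perm_mat a w *\<^sub>v x + c \<cdot>\<^sub>v vec a (\<lambda>_. 1) | c. True}"
proof -
  have one: "perm_mat a w *\<^sub>v vec a (\<lambda>_. 1) = vec a (\<lambda>_. 1)"
  proof (rule eq_vecI)
    fix i assume "i < dim_vec (vec a (\<lambda>_. 1 :: complex))"
    then have i: "i < a" by simp
    define j where "j = inv_into UNIV w (i + 1) - 1"
    have "inv_into UNIV w (i + 1) \<in> {1..a}"
      using i permutes_in_image[OF permutes_inv[OF assms(1)]] by simp
    then have "j < a" "j + 1 = inv_into UNIV w (i + 1)" by (auto simp: j_def)
    moreover have "w k = i + 1 \<longleftrightarrow> k = inv_into UNIV w (i + 1)" for k
      using permutes_inv_eq[OF assms(1)] by metis
    ultimately have "{k. k < a \<and> w (k + 1) = i + 1} = {j}" by auto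
    moreover have "(perm_mat a w *\<^sub>v vec a (\<lambda>_. 1)) $ i = (\<Sum>k<a. if w (k + 1) = i + 1 then 1 else 0)"
      using i by (simp add: perm_mat_def scalar_prod_def row_def lessThan_atLeast0)
    moreover have "\<dots> = of_nat (card {k. k < a \<and> w (k + 1) = i + 1})"
      by (simp add: sum.If_cases Int_def lessThan_def)
    ultimately show "(perm_mat a w *\<^sub>v vec a (\<lambda>_. 1)) $ i = vec a (\<lambda>_. 1) $ i"
      using i by simp
  qed (simp add: perm_mat_def)
  have P: "perm_mat a w \<in> carrier_mat a a" by (simp add: perm_mat_def)
  have "perm_mat a w *\<^sub>v (x + c \<cdot>\<^sub>v vec a (\<lambda>_. 1)) = perm_mat a w *\<^sub>v x + c \<cdot>\<^sub>v vec a (\<lambda>_. 1)" for c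
    using P assms(2) by (simp add: mult_add_distrib_mat_vec[OF P] mult_mat_vec[OF P] one)
  then show ?thesis unfolding refl_act_def by (auto simp: image_iff) metis
qed

end

theory Submission
  imports Defs "HOL-Analysis.Complex_Transcendental" "HOL-Combinatorics.Orbits"
begin

text \<open>
  Let \<open>h i\<close> be the number of north steps of a Dyck path before its \<open>i\<close>-th east step. The laser fired
  from the valley over \<open>j\<close> passes below label \<open>i > j\<close> iff the excess \<open>b * h m - a * m\<close> is larger on
  \<open>{j<..i}\<close> than at \<open>j\<close>, so the partition can be read off from the excess. The rank of a block is the
  length of the vertical run just before the minimum of the block; a labelled noncrossing partition is
  therefore a rational parking function \<open>x\<close>, sending each \<open>k \<in> [a]\<close> to the minimum of the block
  labelled by \<open>k\<close>.

  If rotation acts trivially, the cycle lemma modulo \<open>b\<close> gives \<open>b\<close> translates for each parking function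
  commuting with \<open>w\<close>, and together they exhaust the \<open>w\<close>-invariant functions \<open>[a] \<rightarrow> \<int>/b\<close>.

  If rotation by \<open>d\<close> is nontrivial on \<open>\<int>/(b-1)\<close>, at most one block of a fixed parking function is
  invariant under the rotation. Sending the labels of this central block to \<open>0\<close>, and every other label
  to a point of the cycle \<open>{1..b-1}\<close> read off from the excess extended periodically to all integers, is
  compatible with rotation because the periodic excess does not refer to the cut between \<open>b-1\<close> and
  \<open>1\<close>. It identifies the fixed parking functions with the maps \<open>y: [a] \<rightarrow> {0} \<union> \<int>/(b-1)\<close> satisfying
  \<open>y \<circ> w = y + d\<close>, where \<open>0 + d = 0\<close>. Such a map, like an eigenvector of \<open>w\<close> for \<open>\<zeta>\<^sup>d\<close>, is determined by
  an arbitrary value on each cycle of \<open>w\<close> whose length is divisible by the order of \<open>\<zeta>\<^sup>d\<close>.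
\<close>

subsection \<open>Heights, excesses and lasers\<close>

lemma dvd_diff_imp_eq_int:
  fixes i j n :: int
  assumes "n dvd i - j" "\<bar>i - j\<bar> < n"
  shows "i = j"
  using assms dvd_imp_le_int[of "i - j" n] by fastforce

locale rational_slope =
  fixes a b N :: nat
  assumes a_pos: "0 < a" and a_less_b: "a < b" and coprime_ab: "coprime a b" and b_eq: "b = Suc N"
begin

lemma N_pos: "0 < N"
  using a_pos a_less_b b_eq by linarith

lemma b_pos: "0 < b"
  by (simp add: b_eq)

lemma N_less_b: "N < b"
  by (simp add: b_eq)

lemma b_minus_1: "b - 1 = N"
  by (simp add: b_eq)

lemma int_b: "int b = int N + 1"
  using b_eq by simp

definition excess :: "(nat \<Rightarrow> nat) \<Rightarrow> nat \<Rightarrow> int" where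
  "excess h m = int b * int (h m) - int a * int m"

lemma excess_Suc: "excess h (Suc m) = excess h m + int b * (int (h (Suc m)) - int (h m)) - int a"
  by (simp add: excess_def algebra_simps)

lemma b_dvd_a_mult_iff: "int b dvd int a * i \<longleftrightarrow> int b dvd i"
  using coprime_ab by (simp add: coprime_dvd_mult_right_iff coprime_commute)

lemma excess_eq_imp_eq:
  assumes "p \<le> N" "m \<le> N" "excess h p = excess h m"
  shows "p = m"
proof -
  have "int a * (int m - int p) = int b * (int (h m) - int (h p))"
    using assms(3) by (simp add: excess_def algebra_simps)
  then have "int b dvd int m - int p" by (metis b_dvd_a_mult_iff dvd_triv_left)
  moreover have "\<bar>int m - int p\<bar> < int b" using assms(1,2) int_b by linarith
  ultimately have "int m = int p" by (rule dvd_diff_imp_eq_int)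
  then show ?thesis by simp
qed

text \<open>The laser from the valley over \<open>p\<close> passes below the label \<open>k\<close> iff the excess stays above that of
  \<open>p\<close> on all of \<open>{p<..k}\<close>. For fixed \<open>k\<close> these \<open>p\<close> form the chain of iterated parents of \<open>k\<close>, so a block
  of the partition consists of the labels with a common parent \<open>p\<close>, and its least element is \<open>Suc p\<close>.
  The value \<open>0\<close> serves as a virtual root.\<close>

definition lasered :: "(nat \<Rightarrow> nat) \<Rightarrow> nat \<Rightarrow> nat \<Rightarrow> bool" where
  "lasered h p k \<longleftrightarrow> p < k \<and> (\<forall>m\<in>{p<..k}. excess h p < excess h m)"

definition parent :: "(nat \<Rightarrow> nat) \<Rightarrow> nat \<Rightarrow> nat" where
  "parent h m = Max {p. p < m \<and> excess h p < excess h m}"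

definition leader :: "(nat \<Rightarrow> nat) \<Rightarrow> nat \<Rightarrow> nat" where
  "leader h m = Suc (parent h m)"

definition leaders :: "(nat \<Rightarrow> nat) \<Rightarrow> nat set" where
  "leaders h = leader h ` {1..N}"

definition block :: "(nat \<Rightarrow> nat) \<Rightarrow> nat \<Rightarrow> nat set" where
  "block h v = {j \<in> {1..N}. leader h j = v}"

definition blocks :: "(nat \<Rightarrow> nat) \<Rightarrow> nat set set" where
  "blocks h = block h ` leaders h"

lemma finite_block: "finite (block h v)"
  by (simp add: block_def)

lemma finite_leaders: "finite (leaders h)"
  by (simp add: leaders_def)

end

text \<open>The number \<open>h m\<close> is the height of the \<open>m\<close>-th east step of a path; \<open>h 0 = 0\<close> and the values
  beyond \<open>b\<close> are conventional.\<close>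

locale path_heights = rational_slope +
  fixes h :: "nat \<Rightarrow> nat"
  assumes h_0 [simp]: "h 0 = 0"
    and h_mono: "i \<le> j \<Longrightarrow> h i \<le> h j"
    and h_le: "h m \<le> a"
    and excess_nonneg: "m \<le> b \<Longrightarrow> 0 \<le> excess h m"
begin

lemma excess_0 [simp]: "excess h 0 = 0"
  by (simp add: excess_def)

lemma excess_pos:
  assumes "0 < m" "m \<le> N"
  shows "0 < excess h m"
proof -
  have "0 \<le> excess h m" using assms N_less_b by (intro excess_nonneg) linarith
  moreover have "excess h m \<noteq> 0" using excess_eq_imp_eq[of 0 m h] assms by auto
  ultimately show ?thesis by simp
qed

lemma h_N:
  assumes "N \<le> m"
  shows "h m = a"
proof -
  have "\<not> h N < a"
  proof
    assume "h N < a"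
    then have "int b * (int (h N) + 1) \<le> int b * int a" by (intro mult_left_mono) auto
    then have "excess h N \<le> int a - int b" using int_b by (simp add: excess_def algebra_simps)
    then show False using excess_nonneg[of N] a_less_b b_eq by simp
  qed
  then show ?thesis using h_le[of m] h_mono[OF assms] by linarith
qed

lemma excess_N: "excess h N = int a"
  using int_b by (simp add: excess_def h_N algebra_simps)

lemma h_b: "h b = a"
  using N_less_b by (simp add: h_N)

lemma excess_b: "excess h b = 0"
  by (simp add: excess_def h_b)

lemma excess_Suc_ge: "excess h m - int a \<le> excess h (Suc m)"
  using h_mono[of m "Suc m"] by (simp add: excess_Suc)

lemma excess_Suc_less_iff: "excess h m < excess h (Suc m) \<longleftrightarrow> h m < h (Suc m)"
proof
  assume "h m < h (Suc m)"
  then have "int b * 1 \<le> int b * (int (h (Suc m)) - int (h m))" by (intro mult_left_mono) auto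
  then show "excess h m < excess h (Suc m)" using a_less_b unfolding excess_Suc by linarith
next
  assume "excess h m < excess h (Suc m)"
  then show "h m < h (Suc m)"
    using h_mono[of m "Suc m"] by (cases "h m = h (Suc m)") (auto simp: excess_Suc)
qed

lemma
  assumes "0 < m" "m \<le> N"
  shows parent_less: "parent h m < m"
    and excess_parent: "excess h (parent h m) < excess h m"
    and excess_after_parent: "\<And>p. parent h m < p \<Longrightarrow> p < m \<Longrightarrow> excess h m < excess h p"
proof -
  let ?S = "{p. p < m \<and> excess h p < excess h m}"
  have "finite ?S" by auto
  moreover have "0 \<in> ?S" using assms excess_pos by auto
  ultimately have "parent h m \<in> ?S" unfolding parent_def using Max_in by blast
  then show "parent h m < m" "excess h (parent h m) < excess h m" by auto
  fix p assume p: "parent h m < p" "p < m"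
  have "\<not> excess h p < excess h m"
  proof
    assume "excess h p < excess h m"
    then have "p \<in> ?S" using p by simp
    from Max_ge[OF \<open>finite ?S\<close> this] show False using p(1) unfolding parent_def by linarith
  qed
  then show "excess h m < excess h p"
    using excess_eq_imp_eq[of p m h] p assms by linarith
qed

lemma parent_eqI:
  assumes "p < m" "m \<le> N" "excess h p < excess h m"
    and "\<And>q. p < q \<Longrightarrow> q < m \<Longrightarrow> excess h m < excess h q"
  shows "parent h m = p"
proof -
  have m: "0 < m" "m \<le> N" using assms(1,2) by auto
  have "\<not> p < parent h m"
    using assms(4)[of "parent h m"] parent_less[OF m] excess_parent[OF m] by linarith
  moreover have "\<not> parent h m < p" using excess_after_parent[OF m, of p] assms(1,3) by linarith
  ultimately show ?thesis by simp
qed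

lemma lasered_iff:
  assumes m: "0 < m" "m \<le> N"
  shows "lasered h p m \<longleftrightarrow> p = parent h m \<or> lasered h p (parent h m)"
proof
  assume laser: "lasered h p m"
  then have "p < m" "excess h p < excess h m" by (auto simp: lasered_def)
  then have "p \<le> parent h m" using excess_after_parent[OF m, of p] by linarith
  then show "p = parent h m \<or> lasered h p (parent h m)"
    using laser parent_less[OF m] by (auto simp: lasered_def)
next
  assume "p = parent h m \<or> lasered h p (parent h m)"
  then have p: "p \<le> parent h m" "excess h p \<le> excess h (parent h m)"
    and up_to_parent: "\<And>q. p < q \<Longrightarrow> q \<le> parent h m \<Longrightarrow> excess h p < excess h q"
    by (auto simp: lasered_def intro: less_imp_le)
  have "excess h p < excess h q" if "p < q" "q \<le> m" for q
  proof (cases "q \<le> parent h m")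
    case False
    then have "excess h m \<le> excess h q"
      using excess_after_parent[OF m, of q] that by (cases "q = m") auto
    then show ?thesis using excess_parent[OF m] p by linarith
  qed (use up_to_parent that in auto)
  then show "lasered h p m"
    using parent_less[OF m] p by (auto simp: lasered_def)
qed

lemma same_lasers_iff_same_parent:
  assumes "i \<in> {1..N}" "j \<in> {1..N}"
  shows "(\<forall>p>0. lasered h p i \<longleftrightarrow> lasered h p j) \<longleftrightarrow> parent h i = parent h j"
proof
  have ij: "0 < i" "i \<le> N" "0 < j" "j \<le> N" using assms by auto
  assume "\<forall>p>0. lasered h p i \<longleftrightarrow> lasered h p j"
  moreover have "lasered h 0 i" "lasered h 0 j"
    using ij excess_pos by (auto simp: lasered_def)
  ultimately have "lasered h p i \<longleftrightarrow> lasered h p j" for p by (cases "p = 0") auto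
  then have "lasered h (parent h i) j" "lasered h (parent h j) i"
    using lasered_iff ij by blast+
  then have "parent h i = parent h j \<or> lasered h (parent h i) (parent h j)"
    "parent h j = parent h i \<or> lasered h (parent h j) (parent h i)"
    using lasered_iff[OF ij(1,2)] lasered_iff[OF ij(3,4)] by blast+
  then have "parent h i \<le> parent h j" "parent h j \<le> parent h i"
    unfolding lasered_def by linarith+
  then show "parent h i = parent h j" by simp
next
  assume "parent h i = parent h j"
  moreover have "lasered h p i \<longleftrightarrow> p = parent h i \<or> lasered h p (parent h i)"
    "lasered h p j \<longleftrightarrow> p = parent h j \<or> lasered h p (parent h j)" for p
    using assms by (auto intro!: lasered_iff)
  ultimately show "\<forall>p>0. lasered h p i \<longleftrightarrow> lasered h p j" by presburger
qed

subsection \<open>Blocks\<close>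

lemma leader_le:
  assumes "m \<in> {1..N}"
  shows "leader h m \<le> m"
  using parent_less[of m] assms by (simp add: leader_def)

lemma leader_in_range:
  assumes "m \<in> {1..N}"
  shows "leader h m \<in> {1..N}"
  using leader_le[OF assms] assms by (simp add: leader_def)

lemma leader_eq_self_iff:
  assumes "m \<in> {1..N}"
  shows "leader h m = m \<longleftrightarrow> h (m - 1) < h m"
proof -
  obtain p where p: "m = Suc p" using assms by (cases m) auto
  have "parent h (Suc p) = p \<longleftrightarrow> excess h p < excess h (Suc p)"
    using excess_parent[of "Suc p"] parent_eqI[of p "Suc p"] assms p by auto
  then show ?thesis by (simp add: leader_def p excess_Suc_less_iff)
qed

lemma leader_leader:
  assumes "m \<in> {1..N}"
  shows "leader h (leader h m) = leader h m"
proof -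
  have m: "0 < m" "m \<le> N" using assms by auto
  have "excess h (parent h m) < excess h (Suc (parent h m))"
    using parent_less[OF m] excess_parent[OF m] excess_after_parent[OF m, of "Suc (parent h m)"]
    by (cases "Suc (parent h m) = m") auto
  then have "h (leader h m - 1) < h (leader h m)"
    by (simp add: leader_def excess_Suc_less_iff)
  then show ?thesis using leader_eq_self_iff[OF leader_in_range[OF assms]] by blast
qed

lemma leader_noncrossing:
  assumes "1 \<le> i" "i < j" "j < k" "k < l" "l \<le> N"
    and "leader h i = leader h k" "leader h j = leader h l"
  shows "leader h i = leader h j"
proof -
  have ranges: "0 < i" "i \<le> N" "0 < j" "j \<le> N" "0 < k" "k \<le> N" "0 < l" "l \<le> N"
    using assms by auto
  have parents: "parent h i = parent h k" "parent h j = parent h l"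
    using assms by (auto simp: leader_def)
  have parent_before: "parent h k < i" "parent h l < j"
    using parent_less[OF ranges(1,2)] parent_less[OF ranges(3,4)] parents by auto
  have "excess h k < excess h j"
    using excess_after_parent[OF ranges(5,6), of j] parent_before assms by auto
  have "excess h l < excess h k"
    using excess_after_parent[OF ranges(7,8), of k] parent_before assms by auto
  have "parent h l \<le> parent h k"
    using excess_after_parent[OF ranges(5,6), of "parent h l"] excess_parent[OF ranges(7,8)]
      \<open>excess h l < excess h k\<close> parent_before assms by linarith
  moreover have "parent h k \<le> parent h j"
    using excess_after_parent[OF ranges(3,4), of "parent h k"] excess_parent[OF ranges(5,6)]
      \<open>excess h k < excess h j\<close> parent_before assms by linarith
  ultimately show ?thesis using parents by (simp add: leader_def)
qed

lemma leaders_iff: "v \<in> leaders h \<longleftrightarrow> v \<in> {1..N} \<and> h (v - 1) < h v"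
proof
  assume "v \<in> leaders h"
  then obtain m where m: "m \<in> {1..N}" "v = leader h m" by (auto simp: leaders_def)
  then have "v \<in> {1..N}" "leader h v = v" using leader_leader leader_in_range by auto
  then show "v \<in> {1..N} \<and> h (v - 1) < h v" using leader_eq_self_iff by blast
next
  assume "v \<in> {1..N} \<and> h (v - 1) < h v"
  then show "v \<in> leaders h" using leader_eq_self_iff[of v] by (metis imageI leaders_def)
qed

lemma leader_in_block: "v \<in> leaders h \<Longrightarrow> v \<in> block h v"
  using leader_leader leader_in_range by (auto simp: block_def leaders_def)

lemma Min_block:
  assumes "v \<in> leaders h"
  shows "Min (block h v) = v"
proof (rule Min_eqI[OF finite_block _ leader_in_block[OF assms]])
  fix m assume "m \<in> block h v"
  then show "v \<le> m" using leader_le[of m] by (auto simp: block_def)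
qed

lemma inj_on_block: "inj_on (block h) (leaders h)"
  using Min_block by (rule inj_on_inverseI)

end

subsection \<open>Dyck paths and their partitions\<close>

lemma path_pt_0 [simp]: "path_pt D 0 = (0, 0)"
  by (simp add: path_pt_def)

lemma path_pt_Suc:
  assumes "k < length D"
  shows "path_pt D (Suc k) =
    (if D ! k = East then (Suc (fst (path_pt D k)), snd (path_pt D k))
     else (fst (path_pt D k), Suc (snd (path_pt D k))))"
  using assms by (cases "D ! k") (auto simp: path_pt_def take_Suc_conv_app_nth)

lemma path_pt_mono:
  assumes "j \<le> k" "k \<le> length D"
  shows "fst (path_pt D j) \<le> fst (path_pt D k) \<and> snd (path_pt D j) \<le> snd (path_pt D k)"
  using assms
proof (induction k)
  case (Suc k)
  show ?case
  proof (cases "j = Suc k")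
    case False
    then show ?thesis using Suc path_pt_Suc[of k D] by auto
  qed simp
qed simp

lemma obtain_east_step_index:
  assumes "0 < i" "i \<le> fst (path_pt D (length D))"
  obtains k where "k < length D" "D ! k = East" "fst (path_pt D k) = i - 1"
proof -
  define k where "k = (LEAST k. i \<le> fst (path_pt D k))"
  have k: "i \<le> fst (path_pt D k)" unfolding k_def by (rule LeastI[of _ "length D"]) (rule assms)
  have "k \<le> length D" unfolding k_def by (rule Least_le) (rule assms)
  have "k \<noteq> 0" using k assms(1) by (intro notI) simp
  then obtain j where j: "k = Suc j" by (cases k) auto
  have "\<not> i \<le> fst (path_pt D j)"
    using not_less_Least[of j "\<lambda>k. i \<le> fst (path_pt D k)"] j by (simp add: k_def)
  then have "D ! j = East \<and> fst (path_pt D j) = i - 1"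
    using k path_pt_Suc[of j D] \<open>k \<le> length D\<close> j by (cases "D ! j = East") auto
  then show thesis using that[of j] \<open>k \<le> length D\<close> j by simp
qed

lemma east_step_unique:
  assumes "j < length D" "D ! j = East" "k < length D" "D ! k = East"
    and "fst (path_pt D j) = fst (path_pt D k)"
  shows "j = k"
proof -
  have "\<not> j < k"
    if "j < length D" "D ! j = East" "k < length D" "fst (path_pt D j) = fst (path_pt D k)" for j k
    using path_pt_mono[of "Suc j" k D] path_pt_Suc[of j D] that by auto
  then show ?thesis using assms by (metis linorder_neqE_nat)
qed

lemma east_height_eq:
  assumes "k < length D" "D ! k = East"
  shows "east_height D (Suc (fst (path_pt D k))) = snd (path_pt D k)"
  unfolding east_height_def
proof (rule the_equality)
  show "\<exists>j<length D. D ! j = East \<and> path_pt D (Suc j) = (Suc (fst (path_pt D k)), snd (path_pt D k))"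
    using assms path_pt_Suc[of k D] by (intro exI[of _ k]) simp
  fix y assume "\<exists>j<length D. D ! j = East \<and> path_pt D (Suc j) = (Suc (fst (path_pt D k)), y)"
  then obtain j where
    j: "j < length D" "D ! j = East" "path_pt D (Suc j) = (Suc (fst (path_pt D k)), y)" by blast
  then have "fst (path_pt D j) = fst (path_pt D k)" "snd (path_pt D j) = y"
    using path_pt_Suc[of j D] by auto
  then show "y = snd (path_pt D k)" using east_step_unique[OF j(1,2) assms] by simp
qed

lemma obtain_east_step:
  assumes "0 < m" "m \<le> fst (path_pt D (length D))"
  obtains k where "k < length D" "D ! k = East" "path_pt D k = (m - 1, east_height D m)"
proof -
  obtain k where k: "k < length D" "D ! k = East" "fst (path_pt D k) = m - 1"
    using obtain_east_step_index[OF assms] .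
  then have "snd (path_pt D k) = east_height D m"
    using east_height_eq[OF k(1,2)] assms(1) by simp
  then show thesis using that[OF k(1,2)] k(3) by (metis prod.collapse)
qed

lemma east_height_le:
  assumes k: "k \<le> length D" and pos: "0 < fst (path_pt D k)"
  shows "east_height D (fst (path_pt D k)) \<le> snd (path_pt D k)"
proof -
  define m where "m = fst (path_pt D k)"
  obtain j where j: "j < length D" "D ! j = East" "path_pt D j = (m - 1, east_height D m)"
    using obtain_east_step[of m D] pos path_pt_mono[of k "length D" D] k by (auto simp: m_def)
  have "j < k"
  proof (rule ccontr)
    assume "\<not> j < k"
    then have "fst (path_pt D k) \<le> fst (path_pt D j)" using path_pt_mono[of k j D] j(1) by simp
    then show False using j(3) pos by (simp add: m_def)
  qed
  then show ?thesis using path_pt_mono[of j k D] k j(3) by (simp add: m_def)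
qed

lemma less_east_height:
  assumes k: "k < length D" "D ! k = North" and m: "fst (path_pt D k) < fst (path_pt D (length D))"
  shows "snd (path_pt D k) < east_height D (Suc (fst (path_pt D k)))"
proof -
  let ?m = "fst (path_pt D k)"
  obtain j where j: "j < length D" "D ! j = East" "path_pt D j = (?m, east_height D (Suc ?m))"
    using obtain_east_step[of "Suc ?m" D] m by auto
  have "\<not> j < k"
    using path_pt_mono[of "Suc j" k D] path_pt_Suc[of j D] j k by auto
  moreover have "j \<noteq> k" using j k by auto
  ultimately show ?thesis
    using path_pt_mono[of "Suc k" j D] path_pt_Suc[of k D] j k by simp
qed

locale dyck_path = rational_slope +
  fixes D :: "step list"
  assumes dyck: "D \<in> dyck_paths a b"
begin

lemma path_pt_length: "path_pt D (length D) = (b, a)"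
  and above_diagonal:
    "k \<le> length D \<Longrightarrow> real a / real b * real (fst (path_pt D k)) \<le> real (snd (path_pt D k))"
  using dyck by (auto simp: dyck_paths_def)

definition profile :: "nat \<Rightarrow> nat" where
  "profile m = (if m = 0 then 0 else if m \<le> b then east_height D m else a)"

lemma path_pt_le: "k \<le> length D \<Longrightarrow> fst (path_pt D k) \<le> b \<and> snd (path_pt D k) \<le> a"
  using path_pt_mono[of k "length D" D] path_pt_length by simp

lemma profile_at_east_step:
  assumes "k < length D" "D ! k = East"
  shows "profile (Suc (fst (path_pt D k))) = snd (path_pt D k)" "Suc (fst (path_pt D k)) \<le> b"
proof -
  show "Suc (fst (path_pt D k)) \<le> b"
    using path_pt_le[of "Suc k"] path_pt_Suc[of k D] assms by simp
  then show "profile (Suc (fst (path_pt D k))) = snd (path_pt D k)"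
    using east_height_eq[OF assms] by (simp add: profile_def)
qed

lemma obtain_profile_step:
  assumes "0 < m" "m \<le> b"
  obtains k where "k < length D" "D ! k = East" "path_pt D k = (m - 1, profile m)"
    "path_pt D (Suc k) = (m, profile m)"
  using obtain_east_step[of m D thesis] assms path_pt_length by (simp add: profile_def path_pt_Suc)

lemma profile_le_height: "k \<le> length D \<Longrightarrow> profile (fst (path_pt D k)) \<le> snd (path_pt D k)"
  using east_height_le[of k D] path_pt_le[of k] by (simp add: profile_def)

lemma profile_le: "profile m \<le> a"
proof (cases "0 < m \<and> m \<le> b")
  case True
  then obtain k where "k < length D" "path_pt D k = (m - 1, profile m)"
    using obtain_profile_step by blast
  then show ?thesis using path_pt_le[of k] by simp
qed (auto simp: profile_def)

lemma mono_profile: "mono profile"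
proof -
  have "profile m \<le> profile (Suc m)" for m
  proof (cases "m < b")
    case True
    then obtain k where "k < length D" "path_pt D k = (m, profile (Suc m))"
      using obtain_profile_step[of "Suc m"] by auto
    then show ?thesis using profile_le_height[of k] by simp
  next
    case False
    then show ?thesis using profile_le[of m] by (simp add: profile_def)
  qed
  then show ?thesis by (simp add: mono_iff_le_Suc)
qed

lemma excess_profile_nonneg:
  assumes "m \<le> b"
  shows "0 \<le> excess profile m"
proof (cases "m = 0")
  case False
  then obtain k where "k < length D" "path_pt D (Suc k) = (m, profile m)"
    using obtain_profile_step[of m] assms by auto
  then have "real a / real b * real m \<le> real (profile m)" using above_diagonal[of "Suc k"] by simp
  moreover have "0 < real b" using b_pos by simp
  ultimately have "real a * real m \<le> real b * real (profile m)" by (simp add: field_simps)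
  then have "int (a * m) \<le> int (b * profile m)" by (simp flip: of_nat_mult)
  then show ?thesis by (simp add: excess_def)
qed (simp add: excess_def profile_def)

sublocale path_heights a b N profile
proof unfold_locales
  show "profile i \<le> profile j" if "i \<le> j" for i j using mono_profile that by (rule monoD)
qed (use profile_le excess_profile_nonneg in \<open>simp_all add: profile_def\<close>)

lemma valleys_eq: "valleys D = {(p, profile p) | p. p \<in> {1..N} \<and> profile p < profile (Suc p)}"
proof (intro subset_antisym subsetI)
  fix P assume "P \<in> valleys D"
  then obtain j where P: "P = path_pt D (Suc j)" "Suc j < length D"
    and corner: "D ! j = East" "D ! Suc j = North"
    unfolding valleys_def by (auto simp: gr0_conv_Suc)
  define p where "p = Suc (fst (path_pt D j))"
  have P_eq: "P = (p, profile p)" and "p \<le> b"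
    using path_pt_Suc[of j D] profile_at_east_step[of j] P corner by (auto simp: p_def)
  have "p \<noteq> b"
  proof
    assume "p = b"
    then have "snd (path_pt D (Suc j)) = a" using P_eq P(1) h_b by simp
    then show False using path_pt_le[of "Suc (Suc j)"] path_pt_Suc[of "Suc j" D] P corner by simp
  qed
  then have "p < b" using \<open>p \<le> b\<close> by simp
  then have "profile p < profile (Suc p)"
    using less_east_height[OF P(2) corner(2)] P_eq P(1) path_pt_length by (simp add: profile_def)
  moreover have "p \<in> {1..N}" using \<open>p < b\<close> b_eq by (simp add: p_def)
  ultimately show "P \<in> {(p, profile p) | p. p \<in> {1..N} \<and> profile p < profile (Suc p)}"
    using P_eq by blast
next
  fix P assume "P \<in> {(p, profile p) | p. p \<in> {1..N} \<and> profile p < profile (Suc p)}"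
  then obtain p where p: "P = (p, profile p)" "p \<in> {1..N}" "profile p < profile (Suc p)" by blast
  have "0 < p" "p < b" using p(2) b_eq by auto
  then obtain j where j: "j < length D" "D ! j = East" "path_pt D (Suc j) = (p, profile p)"
    using obtain_profile_step[of p] by auto
  have "Suc j \<noteq> length D" using j path_pt_length \<open>p < b\<close> by auto
  then have "Suc j < length D" using j by simp
  have "D ! Suc j \<noteq> East"
    using profile_at_east_step(1)[OF \<open>Suc j < length D\<close>] j(3) p(3) by auto
  then have "D ! Suc j = North" by (cases "D ! Suc j") auto
  then show "P \<in> valleys D"
    unfolding valleys_def using p(1) j \<open>Suc j < length D\<close> by (intro CollectI exI[of _ "Suc j"]) simp
qed

lemma in_path_curveD:
  assumes "(u, v) \<in> path_curve D"
  shows "(\<exists>m. real m \<le> u \<and> u \<le> real (Suc m) \<and> v = real (profile (Suc m))) \<or>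
    (\<exists>m. u = real m \<and> real (profile m) \<le> v)"
proof -
  obtain k t where k: "k < length D" and t: "0 \<le> t" "t \<le> 1"
    and uv: "(u, v) = (1 - t) *\<^sub>R plane_pt (path_pt D k) + t *\<^sub>R plane_pt (path_pt D (Suc k))"
    using assms by (auto simp: path_curve_def in_segment)
  define m where "m = fst (path_pt D k)"
  define y where "y = snd (path_pt D k)"
  show ?thesis
  proof (cases "D ! k = East")
    case True
    have "u = real m + t" "v = real y"
      using uv path_pt_Suc[OF k] True by (auto simp: plane_pt_def m_def y_def algebra_simps)
    then have "real m \<le> u \<and> u \<le> real (Suc m) \<and> v = real (profile (Suc m))"
      using profile_at_east_step(1)[OF k True] t by (simp add: m_def y_def)
    then show ?thesis by blast
  next
    case False
    have "u = real m" "v = real y + t"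
      using uv path_pt_Suc[OF k] False by (auto simp: plane_pt_def m_def y_def algebra_simps)
    then have "u = real m \<and> real (profile m) \<le> v"
      using profile_le_height[of k] k t by (simp add: m_def y_def)
    then show ?thesis by blast
  qed
qed

lemma in_path_curveI:
  assumes "Suc m \<le> b" "real m \<le> u" "u \<le> real (Suc m)"
  shows "(u, real (profile (Suc m))) \<in> path_curve D"
proof -
  obtain k where k: "k < length D" "path_pt D k = (m, profile (Suc m))"
    "path_pt D (Suc k) = (Suc m, profile (Suc m))"
    using obtain_profile_step[of "Suc m"] assms(1) by auto
  then have "(u, real (profile (Suc m))) \<in>
      closed_segment (plane_pt (path_pt D k)) (plane_pt (path_pt D (Suc k)))"
    unfolding in_segment plane_pt_def
    using assms(2,3) by (intro exI[of _ "u - real m"]) (auto simp: algebra_simps)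
  then show ?thesis using k(1) by (auto simp: path_curve_def)
qed

definition ray_height :: "nat \<Rightarrow> real \<Rightarrow> real" where
  "ray_height p u = real (profile p) + (u - real p) / real b * real a"

lemma ray_height_start [simp]: "ray_height p (real p) = real (profile p)"
  by (simp add: ray_height_def)

lemma ray_height_less_iff: "ray_height p u < ray_height p v \<longleftrightarrow> u < v"
  using a_pos b_pos by (simp add: ray_height_def divide_less_cancel mult_less_cancel_right)

lemma ray_height_le_iff: "ray_height p u \<le> ray_height p v \<longleftrightarrow> u \<le> v"
  using ray_height_less_iff[of p v u] by (simp add: not_less[symmetric])

lemma ray_point:
  "plane_pt (p, profile p) + s *\<^sub>R (real b, real a) =
    (real p + s * real b, ray_height p (real p + s * real b))"
  using b_pos by (simp add: plane_pt_def ray_height_def)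

lemma excess_less_iff_ray_height:
  "excess profile p < excess profile m \<longleftrightarrow> ray_height p (real m) < real (profile m)"
proof -
  have b: "0 < real b" using b_pos by simp
  have "real b * ray_height p (real m) = real b * real (profile p) + (real m - real p) * real a"
    using b by (simp add: ray_height_def field_simps)
  then have "ray_height p (real m) < real (profile m) \<longleftrightarrow>
      real b * real (profile p) + (real m - real p) * real a < real b * real (profile m)"
    using mult_less_cancel_left_pos[OF b, of "ray_height p (real m)" "real (profile m)"] by simp
  also have "\<dots> \<longleftrightarrow> real_of_int (excess profile p) < real_of_int (excess profile m)"
    by (auto simp: excess_def algebra_simps)
  finally show ?thesis by simp
qed

lemma in_laser_iff:
  "(real i, y) \<in> laser a b D (p, profile p) \<longleftrightarrow>
    p \<le> i \<and> y = ray_height p (real i) \<and>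
    (\<forall>u. real p < u \<and> u < real i \<longrightarrow> (u, ray_height p u) \<notin> path_curve D)"
proof
  have b: "0 < real b" using b_pos by simp
  assume "(real i, y) \<in> laser a b D (p, profile p)"
  then obtain t where t: "(real i, y) = plane_pt (p, profile p) + t *\<^sub>R (real b, real a)" "0 \<le> t"
    and clear: "\<And>s. 0 < s \<Longrightarrow> s < t \<Longrightarrow> plane_pt (p, profile p) + s *\<^sub>R (real b, real a) \<notin> path_curve D"
    unfolding laser_def by blast
  have end_pt: "real i = real p + t * real b" "y = ray_height p (real i)"
    using t(1) unfolding ray_point by auto
  have "(u, ray_height p u) \<notin> path_curve D" if "real p < u" "u < real i" for u
  proof -
    have "u = real p + ((u - real p) / real b) * real b" using b by simp
    moreover have "(u - real p) / real b < t"
      using that end_pt b by (simp add: pos_divide_less_eq)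
    ultimately show ?thesis using clear[of "(u - real p) / real b"] that b unfolding ray_point by simp
  qed
  moreover have "real p \<le> real i" using end_pt t(2) b by simp
  ultimately show "p \<le> i \<and> y = ray_height p (real i) \<and>
      (\<forall>u. real p < u \<and> u < real i \<longrightarrow> (u, ray_height p u) \<notin> path_curve D)"
    using end_pt by simp
next
  have b: "0 < real b" using b_pos by simp
  assume reach: "p \<le> i \<and> y = ray_height p (real i) \<and>
    (\<forall>u. real p < u \<and> u < real i \<longrightarrow> (u, ray_height p u) \<notin> path_curve D)"
  define t where "t = (real i - real p) / real b"
  have t: "t * real b = real i - real p" "0 \<le> t" using reach b by (auto simp: t_def)
  have "plane_pt (p, profile p) + s *\<^sub>R (real b, real a) \<notin> path_curve D" if "0 < s" "s < t" for s
  proof -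
    have "s * real b < t * real b" using that b by simp
    then show ?thesis unfolding ray_point using reach that b t by auto
  qed
  moreover have "(real i, y) = plane_pt (p, profile p) + t *\<^sub>R (real b, real a)"
    unfolding ray_point using reach t by simp
  ultimately show "(real i, y) \<in> laser a b D (p, profile p)" unfolding laser_def using t by blast
qed

lemma ray_meets_east_step:
  assumes "Suc n \<le> b"
    and "ray_height p (real n) < real (profile (Suc n))"
    and "real (profile (Suc n)) \<le> ray_height p (real (Suc n))"
  obtains u where "real n < u" "u \<le> real (Suc n)" "(u, ray_height p u) \<in> path_curve D"
proof -
  define u where "u = real p + (real (profile (Suc n)) - real (profile p)) / real a * real b"
  have u: "ray_height p u = real (profile (Suc n))"
    using a_pos b_pos by (simp add: ray_height_def u_def)
  have "real n < u" "u \<le> real (Suc n)"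
    using assms(2,3) unfolding u[symmetric] ray_height_less_iff ray_height_le_iff .
  moreover from this have "(u, ray_height p u) \<in> path_curve D"
    unfolding u by (intro in_path_curveI[OF assms(1)]) auto
  ultimately show thesis by (rule that)
qed

lemma lasered_if_ray_clear:
  assumes valley: "profile p < profile (Suc p)" and i: "p < i" "i \<le> N"
    and below: "ray_height p (real i) < real (profile i)"
    and clear: "\<And>u. real p < u \<Longrightarrow> u < real i \<Longrightarrow> (u, ray_height p u) \<notin> path_curve D"
  shows "lasered profile p i"
proof -
  have "ray_height p (real m) < real (profile m)" if "p < m" "m \<le> i" for m
    using that
  proof (induction m rule: less_induct)
    case (less m)
    obtain n where m: "m = Suc n" using less.prems by (cases m) auto
    have below_step: "ray_height p (real n) < real (profile m)"
    proof (cases "n = p")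
      case False
      then have "ray_height p (real n) < real (profile n)" using less m by simp
      moreover have "real (profile n) \<le> real (profile m)" using h_mono[of n m] m by simp
      ultimately show ?thesis by simp
    qed (use valley m in simp)
    show ?case
    proof (cases "m = i")
      case False
      show ?thesis
      proof (rule ccontr)
        assume "\<not> ?thesis"
        moreover have "Suc n \<le> b" using less.prems i b_eq m by simp
        ultimately obtain u where "real n < u" "u \<le> real m" "(u, ray_height p u) \<in> path_curve D"
          using ray_meets_east_step[of n p] below_step m by (auto simp: not_less)
        then show False using clear[of u] less.prems False m by simp
      qed
    qed (use below in simp)
  qed
  then show ?thesis using i by (auto simp: lasered_def excess_less_iff_ray_height)
qed

lemma ray_clear_if_lasered:
  assumes laser: "lasered profile p i" and u: "real p < u" "u < real i"
  shows "(u, ray_height p u) \<notin> path_curve D"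
proof
  have below: "ray_height p (real m) < real (profile m)" if "p < m" "m \<le> i" for m
    using laser that by (auto simp: lasered_def excess_less_iff_ray_height)
  assume "(u, ray_height p u) \<in> path_curve D"
  then consider (east) m where "real m \<le> u" "u \<le> real (Suc m)" "ray_height p u = real (profile (Suc m))"
    | (north) m where "u = real m" "real (profile m) \<le> ray_height p u"
    using in_path_curveD by blast
  then show False
  proof cases
    case east
    then have "real p < real (Suc m)" "real m < real i" using u by linarith+
    then have "ray_height p (real (Suc m)) < real (profile (Suc m))" by (intro below) auto
    then show False using east(2,3) ray_height_le_iff[of p u "real (Suc m)"] by linarith
  next
    case north
    then show False using below[of m] u by simp
  qed
qed

lemma label_above_iff_lasered:
  assumes valley: "profile p < profile (Suc p)" and i: "i \<in> {1..N}"
  shows "label_above D (laser a b D (p, profile p)) i \<longleftrightarrow> lasered profile p i" (is "?above \<longleftrightarrow> _")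
proof -
  let ?L = "laser a b D (p, profile p)"
  have "0 < i" "i \<le> b" using i b_eq by auto
  then have height: "east_height D i = profile i" by (simp add: profile_def)
  show ?thesis
  proof
    assume ?above
    then have "\<forall>\<^sub>F \<epsilon> in at_right 0. (\<exists>y. (real i, y) \<in> ?L \<and> y < real (profile i) - \<epsilon>) \<and> 0 < \<epsilon>"
      unfolding label_above_def height by (intro eventually_conj eventually_at_right_less)
    then obtain \<epsilon> y where "(real i, y) \<in> ?L" "y < real (profile i) - \<epsilon>" "0 < \<epsilon>"
      using eventually_happens'[OF trivial_limit_at_right_real] by blast
    then have "p \<le> i" and below: "ray_height p (real i) < real (profile i)"
      and "\<And>u. real p < u \<Longrightarrow> u < real i \<Longrightarrow> (u, ray_height p u) \<notin> path_curve D"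
      unfolding in_laser_iff by auto
    moreover have "p \<noteq> i" using below by auto
    ultimately show "lasered profile p i" using i by (intro lasered_if_ray_clear[OF valley]) auto
  next
    assume laser: "lasered profile p i"
    then have "(real i, ray_height p (real i)) \<in> ?L"
      using ray_clear_if_lasered by (auto simp: in_laser_iff lasered_def)
    moreover have "ray_height p (real i) < real (profile i)"
      using laser by (simp add: lasered_def excess_less_iff_ray_height)
    ultimately show ?above
      unfolding label_above_def height
      by (intro eventually_at_rightI[of 0 "real (profile i) - ray_height p (real i)"]) auto
  qed
qed

lemma not_separated_iff_same_leader:
  assumes i: "i \<in> {1..N}" and j: "j \<in> {1..N}"
  shows "(\<forall>P\<in>valleys D. \<not> separates D (laser a b D P) i j) \<longleftrightarrow> leader profile i = leader profile j"
proof -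
  have valley: "p \<in> {1..N} \<and> profile p < profile (Suc p)"
    if "0 < p" "lasered profile p m" "m \<in> {1..N}" for p m
  proof -
    have "p < m" "excess profile p < excess profile (Suc p)" using that by (auto simp: lasered_def)
    then show ?thesis using that excess_Suc_less_iff by simp
  qed
  have "(\<forall>P\<in>valleys D. \<not> separates D (laser a b D P) i j) \<longleftrightarrow>
      (\<forall>p. p \<in> {1..N} \<and> profile p < profile (Suc p) \<longrightarrow> (lasered profile p i \<longleftrightarrow> lasered profile p j))"
    unfolding valleys_eq separates_def using label_above_iff_lasered i j by blast
  also have "\<dots> \<longleftrightarrow> (\<forall>p>0. lasered profile p i \<longleftrightarrow> lasered profile p j)"
    using valley[OF _ _ i] valley[OF _ _ j] by (metis atLeastAtMost_iff less_eq_Suc_le One_nat_def)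
  also have "\<dots> \<longleftrightarrow> leader profile i = leader profile j"
    using same_lasers_iff_same_parent[OF i j] by (simp add: leader_def)
  finally show ?thesis .
qed

lemma dyck_partition_eq_blocks: "dyck_partition a b D = blocks profile"
proof -
  let ?R = "{(i, j). i \<in> {1..N} \<and> j \<in> {1..N} \<and> (\<forall>P\<in>valleys D. \<not> separates D (laser a b D P) i j)}"
  have "?R `` {i} = block profile (leader profile i)" if "i \<in> {1..N}" for i
    unfolding block_def using not_separated_iff_same_leader[OF that] that
    by (intro Set.set_eqI) (simp only: Image_singleton_iff mem_Collect_eq prod.case, metis)
  then show ?thesis
    unfolding dyck_partition_def b_minus_1 quotient_def blocks_def leaders_def
    by (auto simp: image_iff)
qed

end

definition staircase :: "(nat \<Rightarrow> nat) \<Rightarrow> nat \<Rightarrow> step list" where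
  "staircase h n = concat (map (\<lambda>m. replicate (h (Suc m) - h m) North @ [East]) [0..<n])"

lemma staircase_Suc:
  "staircase h (Suc n) = staircase h n @ replicate (h (Suc n) - h n) North @ [East]"
  by (simp add: staircase_def)

lemma staircase_prefix: "i \<le> n \<Longrightarrow> \<exists>E. staircase h n = staircase h i @ E"
  by (induction n) (auto simp: staircase_Suc le_Suc_eq)

lemma count_staircase:
  assumes "h 0 = 0" "mono h"
  shows "count_list (staircase h n) East = n" "count_list (staircase h n) North = h n"
proof (induction n)
  case (Suc n)
  have replicate: "count_list (replicate r x) y = (if x = y then r else 0)" for r and x y :: step
    by (induction r) auto
  have "h n \<le> h (Suc n)" using assms(2) by (simp add: monoD)
  then show "count_list (staircase h (Suc n)) East = Suc n"
    "count_list (staircase h (Suc n)) North = h (Suc n)"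
    using Suc.IH by (simp_all add: staircase_Suc replicate)
qed (use assms(1) in \<open>simp_all add: staircase_def\<close>)

lemma east_height_staircase:
  assumes h: "h 0 = 0" "mono h" and i: "0 < i" "i \<le> n"
  shows "east_height (staircase h n) i = h i"
proof -
  obtain E where E: "staircase h n = staircase h i @ E" using staircase_prefix[OF i(2)] by blast
  define k where "k = length (staircase h i) - 1"
  obtain j where j: "i = Suc j" using i(1) by (cases i) auto
  have k: "k < length (staircase h n)" "staircase h n ! k = East"
    by (simp_all add: k_def E j staircase_Suc nth_append)
  have "take (Suc k) (staircase h n) = staircase h i"
    by (simp add: k_def E j staircase_Suc)
  then have "path_pt (staircase h n) (Suc k) = (i, h i)"
    by (simp add: path_pt_def count_staircase[OF h])
  then show ?thesis using east_height_eq[OF k] path_pt_Suc[OF k(1)] k(2) by simp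
qed

context path_heights
begin

lemma staircase_dyck: "staircase h b \<in> dyck_paths a b"
proof -
  let ?D = "staircase h b"
  have h: "h 0 = 0" "mono h" using h_0 h_mono by (auto intro: monoI)
  have end_pt: "path_pt ?D (length ?D) = (b, a)"
    by (simp add: h_b path_pt_def count_staircase[OF h])
  have "real a / real b * real (fst (path_pt ?D k)) \<le> real (snd (path_pt ?D k))"
    if k: "k \<le> length ?D" for k
  proof -
    let ?m = "fst (path_pt ?D k)"
    have m: "?m \<le> b" using path_pt_mono[OF k order_refl] end_pt by simp
    have "h ?m \<le> snd (path_pt ?D k)"
      using east_height_le[OF k] east_height_staircase[OF h _ m] by (cases "?m = 0") auto
    then have "int b * int (h ?m) \<le> int b * int (snd (path_pt ?D k))"
      by (intro mult_left_mono) auto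
    then have "int (a * ?m) \<le> int (b * snd (path_pt ?D k))"
      using excess_nonneg[OF m] by (simp add: excess_def)
    then have "real (a * ?m) \<le> real (b * snd (path_pt ?D k))" by (simp only: of_nat_le_iff)
    moreover have "0 < real b" using b_pos by simp
    ultimately show ?thesis by (simp add: field_simps)
  qed
  then show ?thesis using end_pt by (simp add: dyck_paths_def)
qed

lemma blocks_in_NC: "blocks h \<in> NC a b"
proof -
  interpret staircase: dyck_path a b N "staircase h b"
    by unfold_locales (rule staircase_dyck)
  have "staircase.profile m = h m" for m
  proof (cases "m \<le> b")
    case True
    have "mono h" using h_mono by (rule monoI)
    then show ?thesis using True east_height_staircase[of h m b] by (simp add: staircase.profile_def)
  next
    case False
    then show ?thesis using h_N[of m] N_less_b by (simp add: staircase.profile_def)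
  qed
  then have "staircase.profile = h" by (rule ext)
  then have "dyck_partition a b (staircase h b) = blocks h"
    using staircase.dyck_partition_eq_blocks by simp
  then show ?thesis unfolding NC_def using staircase_dyck by (metis imageI)
qed

end

lemma (in rational_slope) NC_obtain_heights:
  assumes "\<pi> \<in> NC a b"
  obtains h where "path_heights a b N h" "\<pi> = blocks h"
proof -
  obtain D where D: "D \<in> dyck_paths a b" "\<pi> = dyck_partition a b D"
    using assms by (auto simp: NC_def)
  interpret dyck_path a b N D by unfold_locales (rule D(1))
  show thesis
    by (rule that[OF path_heights_axioms]) (simp add: D(2) dyck_partition_eq_blocks)
qed

subsection \<open>Ranks of blocks\<close>

lemma (in rational_slope) ceiling_slope_eq:
  assumes "int a * int l < int b * n" and "int b * n - int a * int l \<le> int a"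
  shows "\<lceil>real l * (real a / real b)\<rceil> = n"
proof (rule ceiling_unique)
  have b: "0 < real b" using b_pos by simp
  have "int b * (n - 1) < int a * int l" using assms(2) a_less_b by (simp add: algebra_simps)
  then have "real_of_int (int b * (n - 1)) < real_of_int (int a * int l)"
    by (simp only: of_int_less_iff)
  then have "(of_int n - 1) * real b < real l * real a" by (simp add: algebra_simps)
  then show "of_int n - 1 < real l * (real a / real b)" using b by (simp add: pos_less_divide_eq)
  have "real_of_int (int a * int l) < real_of_int (int b * n)"
    using assms(1) by (simp only: of_int_less_iff)
  then have "real l * real a \<le> of_int n * real b" by (simp add: algebra_simps)
  then show "real l * (real a / real b) \<le> of_int n" using b by (simp add: pos_divide_le_eq)
qed

context path_heights
begin

lemma sum_leader_steps:
  assumes "p \<le> m" "m \<le> N"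
  shows "(\<Sum>v | v \<in> leaders h \<and> p < v \<and> v \<le> m. int (h v) - int (h (v - 1))) = int (h m) - int (h p)"
proof -
  have "(\<Sum>v | v \<in> leaders h \<and> p < v \<and> v \<le> m. int (h v) - int (h (v - 1)))
      = (\<Sum>v\<in>{Suc p..m}. int (h v) - int (h (v - 1)))"
  proof (rule sum.mono_neutral_left)
    show "\<forall>v\<in>{Suc p..m} - {v. v \<in> leaders h \<and> p < v \<and> v \<le> m}. int (h v) - int (h (v - 1)) = 0"
    proof
      fix v assume "v \<in> {Suc p..m} - {v. v \<in> leaders h \<and> p < v \<and> v \<le> m}"
      then have "\<not> h (v - 1) < h v" using leaders_iff[of v] assms by auto
      then show "int (h v) - int (h (v - 1)) = 0" using h_mono[of "v - 1" v] by simp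
    qed
  qed auto
  then show ?thesis using sum_telescope''[OF assms(1), of "\<lambda>v. int (h v)"] by simp
qed

lemma obtain_next_smaller_excess:
  assumes "0 < j" "j \<le> N"
  obtains m where "j < m" "m \<le> b" "excess h m < excess h j"
    and "\<And>q. j < q \<Longrightarrow> q < m \<Longrightarrow> excess h j \<le> excess h q"
proof -
  let ?P = "\<lambda>m. j < m \<and> excess h m < excess h j"
  have "?P b" using assms N_less_b excess_b excess_pos[OF assms] by auto
  then show thesis
    using that[of "LEAST m. ?P m"] LeastI[of ?P b] Least_le[of ?P b] not_less_Least[of _ ?P]
    by (meson not_less)
qed

text \<open>The first label after the block with smaller excess loses at most \<open>a\<close>; if its excess were still
  above that of the parent it would belong to the block.\<close>

lemma excess_last_in_block:
  assumes j: "j \<in> {1..N}" and last: "\<And>m. m \<in> {1..N} \<Longrightarrow> leader h m = leader h j \<Longrightarrow> m \<le> j"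
  shows "excess h j - excess h (parent h j) \<le> int a"
proof (rule ccontr)
  assume far: "\<not> ?thesis"
  have j': "0 < j" "j \<le> N" using j by auto
  obtain m where m: "j < m" "m \<le> b" "excess h m < excess h j"
    and between: "\<And>q. j < q \<Longrightarrow> q < m \<Longrightarrow> excess h j \<le> excess h q"
    using obtain_next_smaller_excess[OF j'] by blast
  obtain q where q: "m = Suc q" using m by (cases m) auto
  have "excess h j \<le> excess h q" using between[of q] m q by (cases "q = j") auto
  then have above_parent: "excess h (parent h j) < excess h m"
    using excess_Suc_ge[of q] far q by simp
  have "0 \<le> excess h (parent h j)"
    using parent_less[OF j'] j' N_less_b by (intro excess_nonneg) linarith
  then have "m \<noteq> b" using above_parent excess_b by auto
  then have "m \<le> N" using m(2) b_eq by simp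
  have "parent h m = parent h j"
  proof (rule parent_eqI[OF _ \<open>m \<le> N\<close> above_parent])
    show "parent h j < m" using parent_less[OF j'] m by simp
    fix r assume "parent h j < r" "r < m"
    then consider "parent h j < r" "r < j" | "r = j" | "j < r" "r < m" by linarith
    then show "excess h m < excess h r"
      using excess_after_parent[OF j', of r] between[of r] m(3) by cases auto
  qed
  then have "leader h m = leader h j" by (simp add: leader_def)
  then show False using last[of m] m \<open>m \<le> N\<close> by simp
qed

lemma block_le_iff:
  assumes u: "u \<in> leaders h" and v: "v \<in> leaders h"
  shows "block h u \<preceq> block h v \<longleftrightarrow> v \<le> u \<and> u \<le> Max (block h v)"
proof -
  define j where "j = Max (block h v)"
  define k where "k = Max (block h u)"
  have "k \<in> block h u" "j \<in> block h v"
    unfolding j_def k_def using finite_block leader_in_block u v Max_in by blast+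
  then have j: "j \<in> {1..N}" "leader h j = v" and k: "k \<in> {1..N}" "leader h k = u"
    by (auto simp: block_def)
  have "k \<le> j" if vu: "v \<le> u" "u \<le> j"
  proof (rule ccontr)
    assume "\<not> k \<le> j"
    then have "u \<noteq> v" by (auto simp: j_def k_def)
    then have nested: "parent h j < parent h k" "parent h k < j"
      using vu j(2) k(2) by (auto simp: leader_def)
    have j': "0 < j" "j \<le> N" and k': "0 < k" "k \<le> N" using j k by auto
    have "excess h k < excess h j"
      using excess_after_parent[OF k', of j] nested \<open>\<not> k \<le> j\<close> by simp
    moreover have "excess h j < excess h (parent h k)" using excess_after_parent[OF j'] nested by simp
    ultimately show False using excess_parent[OF k'] by simp
  qed
  moreover have "u \<le> k" "v \<le> j" using leader_le[OF k(1)] leader_le[OF j(1)] j(2) k(2) by auto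
  ultimately show ?thesis
    unfolding block_le_def Min_block[OF u] Min_block[OF v] j_def[symmetric] k_def[symmetric] by auto
qed

lemma ceiling_block_length:
  assumes v: "v \<in> leaders h"
  defines "j \<equiv> Max (block h v)"
  shows "\<lceil>real (j - v + 1) * (real a / real b)\<rceil> = int (h j) - int (h (v - 1))"
proof (rule ceiling_slope_eq)
  have "j \<in> block h v" unfolding j_def using finite_block leader_in_block[OF v] Max_in by blast
  then have j: "j \<in> {1..N}" "leader h j = v" by (auto simp: block_def)
  have parent: "parent h j = v - 1" and "v \<le> j" "0 < v"
    using j leader_le[OF j(1)] by (auto simp: leader_def)
  have excess_diff: "excess h j - excess h (parent h j)
      = int b * (int (h j) - int (h (v - 1))) - int a * int (j - v + 1)"
    using \<open>v \<le> j\<close> \<open>0 < v\<close> by (simp add: excess_def parent of_nat_diff algebra_simps)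
  have "excess h (parent h j) < excess h j" using excess_parent j by simp
  then show "int a * int (j - v + 1) < int b * (int (h j) - int (h (v - 1)))"
    using excess_diff by simp
  have "m \<le> j" if "m \<in> {1..N}" "leader h m = leader h j" for m
    unfolding j_def by (rule Max_ge[OF finite_block]) (use that j in \<open>simp add: block_def\<close>)
  then show "int b * (int (h j) - int (h (v - 1))) - int a * int (j - v + 1) \<le> int a"
    using excess_last_in_block[OF j(1)] excess_diff by simp
qed

lemma is_block_rank_step:
  "is_block_rank a b (blocks h) (\<lambda>B. if B \<in> blocks h then int (h (Min B)) - int (h (Min B - 1)) else 0)"
  (is "is_block_rank a b _ ?r")
  unfolding is_block_rank_def
proof (intro conjI ballI allI impI)
  fix B assume "B \<in> blocks h"
  then obtain v where v: "v \<in> leaders h" and B: "B = block h v" by (auto simp: blocks_def)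
  define j where "j = Max (block h v)"
  let ?below = "{u. u \<in> leaders h \<and> v - 1 < u \<and> u \<le> j}"
  have "0 < v" using v leaders_iff by simp
  have "j \<in> block h v" unfolding j_def using finite_block leader_in_block[OF v] Max_in by blast
  then have "j \<le> N" "v \<le> j" using leader_le[of j] by (auto simp: block_def)
  have r_block: "?r (block h u) = int (h u) - int (h (u - 1))" if "u \<in> leaders h" for u
    using that Min_block by (simp add: blocks_def)
  have "{B'. B' \<in> blocks h \<and> B' \<preceq> B} = block h ` ?below"
    unfolding blocks_def B j_def using block_le_iff[OF _ v] \<open>0 < v\<close> by auto
  moreover have "inj_on (block h) ?below" by (rule inj_on_subset[OF inj_on_block]) auto
  ultimately have "(\<Sum>B' | B' \<in> blocks h \<and> B' \<preceq> B. ?r B') = (\<Sum>u\<in>?below. ?r (block h u))"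
    by (simp only: sum.reindex comp_def)
  also have "\<dots> = (\<Sum>u\<in>?below. int (h u) - int (h (u - 1)))"
    using r_block by (intro sum.cong) auto
  also have "\<dots> = int (h j) - int (h (v - 1))"
    using sum_leader_steps[of "v - 1" j] \<open>j \<le> N\<close> \<open>v \<le> j\<close> by simp
  also have "\<dots> = \<lceil>real (Max B - Min B + 1) * (real a / real b)\<rceil>"
    using ceiling_block_length[OF v] by (simp only: B j_def Min_block[OF v])
  finally show "(\<Sum>B' | B' \<in> blocks h \<and> B' \<preceq> B. ?r B')
      = \<lceil>real (Max B - Min B + 1) * (real a / real b)\<rceil>" .
qed simp

lemma block_rank_eq_step:
  assumes v: "v \<in> leaders h"
  shows "block_rank a b (blocks h) (block h v) = int (h v) - int (h (v - 1))"
proof -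
  have "\<exists>!r. is_block_rank a b (blocks h) r"
  proof (rule ex1_is_block_rank)
    show "finite (blocks h)" by (simp add: blocks_def finite_leaders)
    show "disjoint (blocks h)" by (auto simp: blocks_def block_def disjoint_def)
    show "finite B \<and> B \<noteq> {}" if "B \<in> blocks h" for B
      using that finite_block leader_in_block by (auto simp: blocks_def)
  qed
  then have "block_rank a b (blocks h) =
      (\<lambda>B. if B \<in> blocks h then int (h (Min B)) - int (h (Min B - 1)) else 0)"
    unfolding block_rank_def
    by (rule the1_equality[of "is_block_rank a b (blocks h)", OF _ is_block_rank_step])
  then show ?thesis using v by (simp add: blocks_def Min_block)
qed

end

subsection \<open>Parking functions\<close>

context rational_slope
begin

definition label_height :: "(nat \<Rightarrow> nat) \<Rightarrow> nat \<Rightarrow> nat" where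
  "label_height y m = card {k \<in> {1..a}. 0 < y k \<and> y k \<le> m}"

lemma label_height_0 [simp]: "label_height y 0 = 0"
proof -
  have "{k \<in> {1..a}. 0 < y k \<and> y k \<le> 0} = {}" by auto
  then show ?thesis by (simp add: label_height_def)
qed

lemma label_height_mono: "m \<le> n \<Longrightarrow> label_height y m \<le> label_height y n"
  unfolding label_height_def by (rule card_mono) auto

lemma label_height_le: "label_height y m \<le> a"
proof -
  have "card {k \<in> {1..a}. 0 < y k \<and> y k \<le> m} \<le> card {1..a}" by (rule card_mono) auto
  then show ?thesis by (simp add: label_height_def)
qed

lemma label_height_top:
  assumes "\<And>k. k \<in> {1..a} \<Longrightarrow> y k \<in> {1..m}"
  shows "label_height y m = a"
proof -
  have "{k \<in> {1..a}. 0 < y k \<and> y k \<le> m} = {1..a}" using assms by force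
  then show ?thesis by (simp add: label_height_def)
qed

lemma label_height_step:
  assumes "0 < v"
  shows "label_height y v = label_height y (v - 1) + card {k \<in> {1..a}. y k = v}"
proof -
  have "{k \<in> {1..a}. 0 < y k \<and> y k \<le> v} =
      {k \<in> {1..a}. 0 < y k \<and> y k \<le> v - 1} \<union> {k \<in> {1..a}. y k = v}"
    using assms by auto
  moreover have "{k \<in> {1..a}. 0 < y k \<and> y k \<le> v - 1} \<inter> {k \<in> {1..a}. y k = v} = {}"
    using assms by auto
  ultimately show ?thesis unfolding label_height_def by (simp add: card_Un_disjoint)
qed

definition parking :: "(nat \<Rightarrow> nat) set" where
  "parking = {x \<in> {1..a} \<rightarrow>\<^sub>E {1..N}. \<forall>m\<le>N. 0 \<le> excess (label_height x) m}"

lemma parking_in_range: "x \<in> parking \<Longrightarrow> k \<in> {1..a} \<Longrightarrow> x k \<in> {1..N}"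
  by (auto simp: parking_def)

lemma parking_extensional: "x \<in> parking \<Longrightarrow> x \<in> extensional {1..a}"
  by (auto simp: parking_def PiE_def)

lemma path_heights_parking:
  assumes x: "x \<in> parking"
  shows "path_heights a b N (label_height x)"
proof unfold_locales
  show "label_height x i \<le> label_height x j" if "i \<le> j" for i j using that by (rule label_height_mono)
  show "0 \<le> excess (label_height x) m" if "m \<le> b" for m
  proof (cases "m \<le> N")
    case False
    then have "m = b" using that b_eq by simp
    moreover have "label_height x b = a"
      using parking_in_range[OF x] N_less_b by (intro label_height_top) force
    ultimately show ?thesis by (simp add: excess_def)
  qed (use x in \<open>simp add: parking_def\<close>)
qed (simp_all add: label_height_le)

lemma parking_value_leader:
  assumes x: "x \<in> parking" and k: "k \<in> {1..a}"
  shows "x k \<in> leaders (label_height x)"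
proof -
  interpret path_heights a b N "label_height x" by (rule path_heights_parking[OF x])
  have "x k \<in> {1..N}" by (rule parking_in_range[OF x k])
  moreover have "0 < card {j \<in> {1..a}. x j = x k}" using k by (auto simp: card_gt_0_iff)
  ultimately show ?thesis using label_height_step[of "x k" x] by (simp add: leaders_iff)
qed

lemma parking_value_in_block:
  assumes "x \<in> parking" "k \<in> {1..a}"
  shows "leader (label_height x) (x k) = x k"
  using path_heights.leader_in_block[OF path_heights_parking parking_value_leader] assms
  by (simp add: block_def)

definition noncrossing_of_parking :: "(nat \<Rightarrow> nat) \<Rightarrow> nat set set \<times> (nat set \<Rightarrow> nat set)" where
  "noncrossing_of_parking x =
    (blocks (label_height x), \<lambda>B\<in>blocks (label_height x). {k \<in> {1..a}. x k = Min B})"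

lemma noncrossing_of_parking_in_Park_NC:
  assumes x: "x \<in> parking"
  shows "noncrossing_of_parking x \<in> Park_NC a b"
proof -
  interpret path_heights a b N "label_height x" by (rule path_heights_parking[OF x])
  let ?\<pi> = "blocks (label_height x)" and ?f = "\<lambda>B\<in>blocks (label_height x). {k \<in> {1..a}. x k = Min B}"
  have f_block: "?f (block (label_height x) v) = {k \<in> {1..a}. x k = v}"
    if "v \<in> leaders (label_height x)" for v
    using that Min_block by (simp add: blocks_def)
  have "disjoint_family_on ?f ?\<pi>"
    using Min_block by (auto simp: disjoint_family_on_def blocks_def)
  moreover have "(\<Union>B\<in>?\<pi>. ?f B) = {1..a}"
  proof (intro subset_antisym subsetI)
    fix k assume k: "k \<in> {1..a}"
    have leader: "x k \<in> leaders (label_height x)" by (rule parking_value_leader[OF x k])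
    then have "block (label_height x) (x k) \<in> ?\<pi>" by (simp add: blocks_def)
    moreover have "k \<in> ?f (block (label_height x) (x k))" unfolding f_block[OF leader] using k by simp
    ultimately show "k \<in> (\<Union>B\<in>?\<pi>. ?f B)" by (rule UN_I)
  qed auto
  moreover have "int (card (?f B)) = block_rank a b ?\<pi> B" if B_in: "B \<in> ?\<pi>" for B
  proof -
    obtain v where v: "v \<in> leaders (label_height x)" and B: "B = block (label_height x) v"
      using B_in by (auto simp: blocks_def)
    have "0 < v" using v leaders_iff by simp
    then have "int (card {k \<in> {1..a}. x k = v}) = int (label_height x v) - int (label_height x (v - 1))"
      using label_height_step[of v x] by simp
    then show ?thesis unfolding B f_block[OF v] block_rank_eq_step[OF v] .
  qed
  moreover have "?f \<in> ?\<pi> \<rightarrow>\<^sub>E Pow {1..a}" by auto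
  ultimately show ?thesis
    unfolding noncrossing_of_parking_def Park_NC_def mem_Collect_eq prod.case
    using blocks_in_NC by blast
qed

lemma inj_on_noncrossing_of_parking: "inj_on noncrossing_of_parking parking"
proof (rule inj_onI)
  fix x y assume x: "x \<in> parking" and y: "y \<in> parking"
    and eq: "noncrossing_of_parking x = noncrossing_of_parking y"
  interpret path_heights a b N "label_height x" by (rule path_heights_parking[OF x])
  show "x = y"
  proof (rule extensionalityI[OF parking_extensional[OF x] parking_extensional[OF y]])
    fix k assume k: "k \<in> {1..a}"
    define B where "B = block (label_height x) (x k)"
    have leader: "x k \<in> leaders (label_height x)" by (rule parking_value_leader[OF x k])
    then have "B \<in> blocks (label_height x)" by (simp add: B_def blocks_def)
    moreover from this have "B \<in> blocks (label_height y)"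
      using eq by (simp add: noncrossing_of_parking_def)
    moreover have "snd (noncrossing_of_parking x) B = snd (noncrossing_of_parking y) B"
      by (simp only: eq)
    ultimately have "{j \<in> {1..a}. x j = Min B} = {j \<in> {1..a}. y j = Min B}"
      by (simp add: noncrossing_of_parking_def)
    moreover have "Min B = x k" unfolding B_def by (rule Min_block[OF leader])
    ultimately have "k \<in> {j \<in> {1..a}. y j = x k}" using k by auto
    then show "x k = y k" by simp
  qed
qed

end

lemma obtain_function_with_fibres:
  assumes disjoint: "disjoint_family_on L V" and union: "(\<Union>v\<in>V. L v) = S"
  obtains x where "x \<in> S \<rightarrow>\<^sub>E V" "\<And>v. v \<in> V \<Longrightarrow> {k \<in> S. x k = v} = L v"
proof -
  define x where "x = (\<lambda>k\<in>S. THE v. v \<in> V \<and> k \<in> L v)"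
  have x_eq: "x k = v" if "v \<in> V" "k \<in> L v" for k v
  proof -
    have "(THE v. v \<in> V \<and> k \<in> L v) = v"
      using that disjoint by (intro the_equality) (auto simp: disjoint_family_on_def)
    moreover have "k \<in> S" using that union by blast
    ultimately show ?thesis by (simp add: x_def)
  qed
  have x_label: "x k \<in> V \<and> k \<in> L (x k)" if "k \<in> S" for k
  proof -
    obtain v where "v \<in> V" "k \<in> L v" using \<open>k \<in> S\<close> union by blast
    then show ?thesis using x_eq[of v k] by simp
  qed
  show thesis
  proof (rule that)
    show "x \<in> S \<rightarrow>\<^sub>E V" using x_label by (auto simp: x_def)
    show "{k \<in> S. x k = v} = L v" if "v \<in> V" for v
      using that x_label x_eq union by blast
  qed
qed

context path_heights
begin

lemma label_height_eq:
  assumes x: "x \<in> {1..a} \<rightarrow> leaders h"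
    and card_fibre: "\<And>v. v \<in> leaders h \<Longrightarrow> int (card {k \<in> {1..a}. x k = v}) = int (h v) - int (h (v - 1))"
  shows "label_height x = h"
proof
  have below: "label_height x m = h m" if "m \<le> N" for m
    using that
  proof (induction m)
    case (Suc m)
    have "int (card {k \<in> {1..a}. x k = Suc m}) = int (h (Suc m)) - int (h m)"
    proof (cases "Suc m \<in> leaders h")
      case True
      then show ?thesis using card_fibre[OF True] by simp
    next
      case False
      then have "x k \<noteq> Suc m" if "k \<in> {1..a}" for k using funcset_mem[OF x that] by auto
      then have "{k \<in> {1..a}. x k = Suc m} = {}" by blast
      then have "card {k \<in> {1..a}. x k = Suc m} = 0" by (simp only: card.empty)
      moreover have "h (Suc m) = h m"
        using False Suc.prems leaders_iff[of "Suc m"] h_mono[of m "Suc m"] by simp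
      ultimately show ?thesis by linarith
    qed
    then show ?case using Suc label_height_step[of "Suc m" x] by simp
  qed simp
  fix m
  show "label_height x m = h m"
  proof (cases "m \<le> N")
    case False
    have "x k \<in> {1..m}" if "k \<in> {1..a}" for k
      using funcset_mem[OF x that] False by (simp add: leaders_iff)
    then have "label_height x m = a" by (rule label_height_top)
    then show ?thesis using h_N[of m] False by simp
  qed (rule below)
qed

lemma obtain_parking_of_label_sets:
  assumes disjoint: "disjoint_family_on L (leaders h)" and union: "(\<Union>v\<in>leaders h. L v) = {1..a}"
    and card_L: "\<And>v. v \<in> leaders h \<Longrightarrow> int (card (L v)) = int (h v) - int (h (v - 1))"
  obtains x where "x \<in> parking" "label_height x = h"
    "\<And>v. v \<in> leaders h \<Longrightarrow> {k \<in> {1..a}. x k = v} = L v"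
proof -
  obtain x where x: "x \<in> {1..a} \<rightarrow>\<^sub>E leaders h"
    and fibres: "\<And>v. v \<in> leaders h \<Longrightarrow> {k \<in> {1..a}. x k = v} = L v"
    using obtain_function_with_fibres[OF disjoint union] by blast
  have height: "label_height x = h" using x fibres card_L by (intro label_height_eq) auto
  moreover have "x \<in> {1..a} \<rightarrow>\<^sub>E {1..N}"
    using x leaders_iff by (intro PiE_I) (auto dest: PiE_mem PiE_arb)
  then have "x \<in> parking" unfolding parking_def using height excess_nonneg N_less_b by simp
  ultimately show thesis using fibres by (intro that)
qed

end

context rational_slope
begin

lemma Park_NC_obtain_parking:
  assumes p: "p \<in> Park_NC a b"
  obtains x where "x \<in> parking" "p = noncrossing_of_parking x"
proof -
  obtain \<pi> f where pf: "p = (\<pi>, f)" by (cases p)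
  have \<pi>: "\<pi> \<in> NC a b" and f: "f \<in> \<pi> \<rightarrow>\<^sub>E Pow {1..a}" "disjoint_family_on f \<pi>" "(\<Union>B\<in>\<pi>. f B) = {1..a}"
    "\<And>B. B \<in> \<pi> \<Longrightarrow> int (card (f B)) = block_rank a b \<pi> B"
    using p by (auto simp: pf Park_NC_def)
  obtain h where h: "path_heights a b N h" and \<pi>_eq: "\<pi> = blocks h" using NC_obtain_heights[OF \<pi>] .
  interpret path_heights a b N h by (rule h)
  have disjoint: "disjoint_family_on (\<lambda>v. f (block h v)) (leaders h)"
    unfolding disjoint_family_on_def
  proof (intro ballI impI)
    fix u v assume "u \<in> leaders h" "v \<in> leaders h" "u \<noteq> v"
    then have "block h u \<noteq> block h v" using inj_on_block by (auto simp: inj_on_def)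
    then show "f (block h u) \<inter> f (block h v) = {}"
      using f(2) \<open>u \<in> leaders h\<close> \<open>v \<in> leaders h\<close> by (auto simp: disjoint_family_on_def \<pi>_eq blocks_def)
  qed
  have union: "(\<Union>v\<in>leaders h. f (block h v)) = {1..a}" using f(3) by (simp add: \<pi>_eq blocks_def)
  have card_f: "int (card (f (block h v))) = int (h v) - int (h (v - 1))" if "v \<in> leaders h" for v
    using f(4)[of "block h v"] block_rank_eq_step[OF that] that by (simp add: \<pi>_eq blocks_def)
  obtain x where x: "x \<in> parking" and height: "label_height x = h"
    and label_sets: "\<And>v. v \<in> leaders h \<Longrightarrow> {k \<in> {1..a}. x k = v} = f (block h v)"
    using obtain_parking_of_label_sets[OF disjoint union card_f] by blast
  have "f = (\<lambda>B\<in>\<pi>. {k \<in> {1..a}. x k = Min B})"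
  proof (rule extensionalityI[of _ \<pi>])
    fix B assume "B \<in> \<pi>"
    then obtain v where "v \<in> leaders h" "B = block h v" by (auto simp: \<pi>_eq blocks_def)
    then show "f B = (\<lambda>B\<in>\<pi>. {k \<in> {1..a}. x k = Min B}) B"
      using label_sets Min_block \<open>B \<in> \<pi>\<close> by simp
  qed (use f(1) in \<open>auto simp: PiE_iff\<close>)
  then have "p = noncrossing_of_parking x"
    by (simp add: pf noncrossing_of_parking_def height \<pi>_eq)
  then show thesis using that x by blast
qed

lemma Park_NC_eq: "Park_NC a b = noncrossing_of_parking ` parking"
  using Park_NC_obtain_parking noncrossing_of_parking_in_Park_NC by blast

end

subsection \<open>Rotation of parking functions\<close>

definition residue :: "nat \<Rightarrow> int \<Rightarrow> nat" where
  "residue M i = Suc (nat ((i - 1) mod int M))"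

lemma int_residue: "0 < M \<Longrightarrow> int (residue M i) = (i - 1) mod int M + 1"
  by (simp add: residue_def)

lemma residue_in_range: "0 < M \<Longrightarrow> residue M i \<in> {1..M}"
  using pos_mod_bound[of "int M" "i - 1"] by (simp add: residue_def nat_less_iff Suc_le_eq)

lemma residue_of_nat: "m \<in> {1..M} \<Longrightarrow> residue M (int m) = m"
  by (auto simp: residue_def nat_diff_distrib)

lemma residue_eq_iff: "0 < M \<Longrightarrow> residue M i = residue M j \<longleftrightarrow> int M dvd i - j"
proof -
  assume "0 < M"
  then have "residue M i = residue M j \<longleftrightarrow> (i - 1) mod int M = (j - 1) mod int M"
    using int_residue[of M i] int_residue[of M j] by linarith
  also have "\<dots> \<longleftrightarrow> int M dvd (i - 1) - (j - 1)" by (rule mod_eq_dvd_iff)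
  finally show ?thesis by simp
qed

lemma dvd_residue_diff: "0 < M \<Longrightarrow> int M dvd int (residue M i) - i"
proof -
  assume "0 < M"
  then have "int (residue M i) - i = - (int M * ((i - 1) div int M))"
    unfolding int_residue[OF \<open>0 < M\<close>] using mult_div_mod_eq[of "int M" "i - 1"] by linarith
  then show ?thesis by simp
qed

lemma residue_add: "0 < M \<Longrightarrow> residue M (int (residue M i) + j) = residue M (i + j)"
  using dvd_residue_diff[of M i] by (simp add: residue_eq_iff)

lemma residue_Suc:
  assumes "0 < M"
  shows "residue M (i + 1) = (if residue M i = M then 1 else Suc (residue M i))"
proof -
  have "residue M (i + 1) = residue M (int (Suc (residue M i)))"
    using residue_add[OF assms, of i 1] by (simp add: add.commute)
  also have "\<dots> = (if residue M i = M then 1 else Suc (residue M i))"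
  proof (cases "residue M i = M")
    case True
    then have "residue M (int (Suc (residue M i))) = residue M (int 1)"
      using assms by (subst residue_eq_iff) auto
    then show ?thesis using True residue_of_nat[of 1 M] assms by simp
  next
    case False
    then show ?thesis using residue_in_range[OF assms, of i] by (subst residue_of_nat) auto
  qed
  finally show ?thesis .
qed

lemma obtain_nat_cong:
  assumes "0 < M"
  obtains t where "int M dvd int t - i"
proof
  show "int M dvd int (nat (i mod int M)) - i"
    using assms dvd_minus_mod[of "int M" i] by (simp add: dvd_diff_commute)
qed

context rational_slope
begin

text \<open>A parking function records, for each \<open>k\<close>, the least element of the block labelled by \<open>k\<close>.
  Rotation by one step adds one to it, unless the block contains \<open>N\<close>.\<close>

definition rotated_leader :: "(nat \<Rightarrow> nat) \<Rightarrow> nat \<Rightarrow> nat" where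
  "rotated_leader h v = (if v = leader h N then 1 else Suc v)"

definition rotate_parking :: "(nat \<Rightarrow> nat) \<Rightarrow> nat \<Rightarrow> nat" where
  "rotate_parking x = (\<lambda>k\<in>{1..a}. rotated_leader (label_height x) (x k))"

lemma rotated_leader_eq_iff: "0 < u \<Longrightarrow> 0 < v \<Longrightarrow> rotated_leader h u = rotated_leader h v \<longleftrightarrow> u = v"
  by (simp add: rotated_leader_def)

context
  fixes x
  assumes x: "x \<in> parking"
begin

interpretation path_heights a b N "label_height x"
  by (rule path_heights_parking[OF x])

abbreviation (input) last_leader :: nat where
  "last_leader \<equiv> leader (label_height x) N"

abbreviation (input) rotated_excess :: "nat \<Rightarrow> int" where
  "rotated_excess \<equiv> excess (label_height (rotate_parking x))"

lemma last_leader_in_range: "last_leader \<in> {1..N}"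
  using leader_in_range[of N] N_pos by simp

lemma excess_last_leader:
  "int b * int (card {k \<in> {1..a}. x k = last_leader})
    = excess (label_height x) last_leader - excess (label_height x) (last_leader - 1) + int a"
proof -
  obtain p where p: "last_leader = Suc p" using last_leader_in_range by (cases last_leader) auto
  show ?thesis using label_height_step[of "Suc p" x] unfolding p by (simp add: excess_Suc)
qed

lemma label_height_rotate_parking:
  "label_height (rotate_parking x) (Suc m) =
    label_height x m + (if m < last_leader then card {k \<in> {1..a}. x k = last_leader} else 0)"
proof -
  have pos: "0 < x k" if "k \<in> {1..a}" for k using parking_in_range[OF x that] by simp
  have "{k \<in> {1..a}. 0 < rotate_parking x k \<and> rotate_parking x k \<le> Suc m} =
      {k \<in> {1..a}. 0 < x k \<and> x k \<le> m} \<union> {k \<in> {1..a}. x k = last_leader}"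
    using pos by (auto simp: rotate_parking_def rotated_leader_def)
  moreover have "{k \<in> {1..a}. x k = last_leader} \<subseteq> {k \<in> {1..a}. 0 < x k \<and> x k \<le> m}"
    if "\<not> m < last_leader"
    using that pos by auto
  moreover have "{k \<in> {1..a}. x k = last_leader} \<inter> {k \<in> {1..a}. 0 < x k \<and> x k \<le> m} = {}"
    if "m < last_leader"
    using that by auto
  ultimately show ?thesis
    unfolding label_height_def by (auto simp: card_Un_disjoint Int_commute Un_absorb2)
qed

lemma excess_rotate_parking:
  "rotated_excess (Suc m) = excess (label_height x) m +
    (if m < last_leader
      then excess (label_height x) last_leader - excess (label_height x) (last_leader - 1)
      else - int a)"
proof -
  have "rotated_excess (Suc m) = excess (label_height x) m - int a +
      (if m < last_leader then int b * int (card {k \<in> {1..a}. x k = last_leader}) else 0)"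
    by (simp add: excess_def label_height_rotate_parking algebra_simps)
  then show ?thesis unfolding excess_last_leader by simp
qed

lemma excess_from_last_leader:
  assumes "last_leader \<le> m" "m \<le> N"
  shows "int a \<le> excess (label_height x) m"
proof (cases "m = N")
  case False
  have "excess (label_height x) N < excess (label_height x) m"
    by (rule excess_after_parent) (use assms False N_pos in \<open>auto simp: leader_def\<close>)
  then show ?thesis using excess_N by simp
qed (use excess_N in simp)

lemma excess_before_last_leader: "excess (label_height x) (last_leader - 1) < int a"
  using excess_parent[OF N_pos order_refl] excess_N by (simp add: leader_def)

lemma rotate_parking_in_parking: "rotate_parking x \<in> parking"
proof -
  have "rotate_parking x k \<in> {1..N}" if "k \<in> {1..a}" for k
  proof -
    have "x k \<noteq> N \<or> x k = last_leader" using parking_value_in_block[OF x that] by metis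
    then show ?thesis
      using parking_in_range[OF x that] that N_pos
      by (auto simp: rotate_parking_def rotated_leader_def)
  qed
  moreover have "0 \<le> rotated_excess m" if m: "m \<le> N" for m
  proof (cases m)
    case (Suc p)
    have "p \<le> b" using Suc m N_less_b by linarith
    then show ?thesis
      using excess_nonneg[of p] excess_from_last_leader[of p] excess_from_last_leader[of last_leader]
        excess_before_last_leader last_leader_in_range Suc m
      by (simp add: excess_rotate_parking)
  qed (simp add: excess_def)
  moreover have "rotate_parking x \<in> extensional {1..a}" by (simp add: rotate_parking_def)
  ultimately show ?thesis by (auto simp: parking_def PiE_def)
qed

interpretation rotated: path_heights a b N "label_height (rotate_parking x)"
  by (rule path_heights_parking[OF rotate_parking_in_parking])

lemma leader_rotate_parking_outside:
  assumes m: "m \<in> {1..<N}" and outside: "m < last_leader \<or> last_leader \<le> parent (label_height x) m"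
  shows "leader (label_height (rotate_parking x)) (Suc m) = Suc (leader (label_height x) m)"
    and "leader (label_height x) m \<noteq> last_leader"
proof -
  let ?p = "parent (label_height x) m"
  have m': "0 < m" "m \<le> N" using m by auto
  have "?p < m" by (rule parent_less[OF m'])
  obtain \<delta> where \<delta>: "\<And>q. ?p \<le> q \<Longrightarrow> q \<le> m \<Longrightarrow> rotated_excess (Suc q) = excess (label_height x) q + \<delta>"
    using outside by (auto simp: excess_rotate_parking)
  have "parent (label_height (rotate_parking x)) (Suc m) = Suc ?p"
  proof (rule rotated.parent_eqI)
    fix q assume "Suc ?p < q" "q < Suc m"
    then obtain r where "q = Suc r" "?p < r" "r < m" by (cases q) auto
    then show "rotated_excess (Suc m) < rotated_excess q"
      using excess_after_parent[OF m', of r] \<open>?p < m\<close> by (simp add: \<delta>)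
  qed (use excess_parent[OF m'] \<open>?p < m\<close> m in \<open>auto simp: \<delta>\<close>)
  then show "leader (label_height (rotate_parking x)) (Suc m) = Suc (leader (label_height x) m)"
    by (simp add: leader_def)
  show "leader (label_height x) m \<noteq> last_leader"
    using outside \<open>?p < m\<close> by (auto simp: leader_def[of _ m])
qed

lemma leader_rotate_parking_last_block:
  assumes m: "m \<in> {1..<N}" and straddle: "parent (label_height x) m < last_leader" "last_leader \<le> m"
  shows "leader (label_height (rotate_parking x)) (Suc m) = 1"
    and "leader (label_height x) m = last_leader"
proof -
  have m': "0 < m" "m \<le> N" using m by auto
  have "last_leader - 1 < m"
    using last_leader_in_range straddle(2) unfolding atLeastAtMost_iff by linarith
  then have "\<not> parent (label_height x) m < last_leader - 1"
    using excess_after_parent[OF m', of "last_leader - 1"] excess_from_last_leader[OF straddle(2) m'(2)]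
      excess_before_last_leader by linarith
  then show leader: "leader (label_height x) m = last_leader"
    using straddle by (simp add: leader_def[of _ m])
  have after: "excess (label_height x) m \<le> excess (label_height x) r" if "last_leader \<le> r" "r \<le> m" for r
    using excess_after_parent[OF m', of r] straddle that by (cases "r = m") auto
  have "parent (label_height (rotate_parking x)) (Suc m) = 0"
  proof (rule rotated.parent_eqI)
    show "rotated_excess 0 < rotated_excess (Suc m)"
      using rotated.excess_pos[of "Suc m"] m by simp
    fix q assume "0 < q" "q < Suc m"
    then obtain r where r: "q = Suc r" "r < m" by (cases q) auto
    have "excess (label_height x) m \<noteq> excess (label_height x) r"
      using excess_eq_imp_eq[of m r] r m by auto
    then show "rotated_excess (Suc m) < rotated_excess q"
      using after[of r] after[of last_leader] straddle excess_before_last_leader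
        excess_nonneg[of r] r m' N_less_b
      by (cases "r < last_leader") (simp_all add: excess_rotate_parking)
  qed (use m in auto)
  then show "leader (label_height (rotate_parking x)) (Suc m) = 1"
    by (simp add: leader_def)
qed

lemma leader_rotate_parking_Suc:
  assumes "m \<in> {1..<N}"
  shows "leader (label_height (rotate_parking x)) (Suc m)
    = rotated_leader (label_height x) (leader (label_height x) m)"
  using leader_rotate_parking_outside[OF assms] leader_rotate_parking_last_block[OF assms]
  by (cases "m < last_leader \<or> last_leader \<le> parent (label_height x) m")
    (auto simp: rotated_leader_def not_less not_le)

lemma leader_rotate_parking_1: "leader (label_height (rotate_parking x)) 1 = 1"
  using rotated.leader_le[of 1] N_pos by (simp add: leader_def)

end

definition cyclic_leader :: "(nat \<Rightarrow> nat) \<Rightarrow> int \<Rightarrow> nat" where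
  "cyclic_leader x i = leader (label_height x) (residue N i)"

lemma cyclic_leader_cong: "int N dvd i - j \<Longrightarrow> cyclic_leader x i = cyclic_leader x j"
  using N_pos by (simp add: cyclic_leader_def residue_eq_iff[THEN iffD2])

lemma cyclic_leader_of_nat: "m \<in> {1..N} \<Longrightarrow> cyclic_leader x (int m) = leader (label_height x) m"
  by (simp add: cyclic_leader_def residue_of_nat)

lemma cyclic_leader_value: "x \<in> parking \<Longrightarrow> k \<in> {1..a} \<Longrightarrow> cyclic_leader x (int (x k)) = x k"
  using cyclic_leader_of_nat[OF parking_in_range] parking_value_in_block by simp

lemma cyclic_leader_le:
  assumes "x \<in> parking" "m \<in> {1..N}"
  shows "cyclic_leader x (int m) \<le> m"
  using path_heights.leader_le[OF path_heights_parking] assms by (simp add: cyclic_leader_of_nat)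

lemma cyclic_leader_is_value:
  assumes x: "x \<in> parking"
  obtains k where "k \<in> {1..a}" "cyclic_leader x i = x k"
proof -
  interpret path_heights a b N "label_height x" by (rule path_heights_parking[OF x])
  have "cyclic_leader x i \<in> leaders (label_height x)"
    using residue_in_range[OF N_pos] by (simp add: cyclic_leader_def leaders_def)
  then have "0 < card {k \<in> {1..a}. x k = cyclic_leader x i}"
    using label_height_step[of "cyclic_leader x i" x] by (simp add: leaders_iff)
  then have "{k \<in> {1..a}. x k = cyclic_leader x i} \<noteq> {}" by (metis card.empty less_irrefl)
  then show thesis using that by fastforce
qed

lemma parking_eqI:
  assumes x: "x \<in> parking" and y: "y \<in> parking"
    and same_blocks: "\<And>k i. k \<in> {1..a} \<Longrightarrow> cyclic_leader x i = x k \<longleftrightarrow> cyclic_leader y i = y k"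
  shows "x = y"
proof (rule extensionalityI[OF parking_extensional[OF x] parking_extensional[OF y]])
  fix k assume k: "k \<in> {1..a}"
  have "cyclic_leader x (int (y k)) = x k" "cyclic_leader y (int (x k)) = y k"
    using same_blocks[OF k] cyclic_leader_value[OF x k] cyclic_leader_value[OF y k] by auto
  then show "x k = y k"
    using cyclic_leader_le[OF x parking_in_range[OF y k]]
      cyclic_leader_le[OF y parking_in_range[OF x k]] by simp
qed

lemma cyclic_leader_rotate_parking:
  assumes x: "x \<in> parking"
  shows "cyclic_leader (rotate_parking x) (i + 1) = rotated_leader (label_height x) (cyclic_leader x i)"
proof (cases "residue N i = N")
  case True
  then show ?thesis
    using leader_rotate_parking_1[OF x] N_pos
    by (simp add: cyclic_leader_def residue_Suc rotated_leader_def)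
next
  case False
  then have "residue N i \<in> {1..<N}" using residue_in_range[OF N_pos, of i] by auto
  then show ?thesis
    using leader_rotate_parking_Suc[OF x] False N_pos by (simp add: cyclic_leader_def residue_Suc)
qed

lemma funpow_rotate_parking_in_parking: "x \<in> parking \<Longrightarrow> (rotate_parking ^^ t) x \<in> parking"
  by (induction t) (auto intro: rotate_parking_in_parking)

lemma cyclic_leader_funpow_eq_iff:
  assumes "x \<in> parking"
  shows "cyclic_leader ((rotate_parking ^^ t) x) i = cyclic_leader ((rotate_parking ^^ t) x) j \<longleftrightarrow>
    cyclic_leader x (i - int t) = cyclic_leader x (j - int t)"
proof (induction t arbitrary: i j)
  case (Suc t)
  let ?x = "(rotate_parking ^^ t) x"
  have pos: "0 < cyclic_leader ?x i" for i by (simp add: cyclic_leader_def leader_def)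
  have "cyclic_leader (rotate_parking ?x) i = cyclic_leader (rotate_parking ?x) j \<longleftrightarrow>
      cyclic_leader ?x (i - 1) = cyclic_leader ?x (j - 1)"
    using cyclic_leader_rotate_parking[OF funpow_rotate_parking_in_parking[OF assms, of t], of "i - 1"]
      cyclic_leader_rotate_parking[OF funpow_rotate_parking_in_parking[OF assms, of t], of "j - 1"]
      rotated_leader_eq_iff[OF pos pos] by simp
  then show ?case unfolding Suc.IH by (simp add: algebra_simps)
qed simp

lemma cyclic_leader_funpow_eq_value_iff:
  assumes x: "x \<in> parking" and k: "k \<in> {1..a}"
  shows "cyclic_leader ((rotate_parking ^^ t) x) i = (rotate_parking ^^ t) x k \<longleftrightarrow>
    cyclic_leader x (i - int t) = x k"
proof (induction t arbitrary: i)
  case (Suc t)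
  let ?x = "(rotate_parking ^^ t) x"
  have "?x \<in> parking" by (rule funpow_rotate_parking_in_parking[OF x])
  then have "0 < ?x k" using parking_in_range[of ?x k] k by simp
  moreover have "0 < cyclic_leader ?x (i - 1)" by (simp add: cyclic_leader_def leader_def)
  ultimately have "cyclic_leader (rotate_parking ?x) i = rotate_parking ?x k \<longleftrightarrow>
      cyclic_leader ?x (i - 1) = ?x k"
    using cyclic_leader_rotate_parking[OF \<open>?x \<in> parking\<close>, of "i - 1"] k rotated_leader_eq_iff
    by (simp add: rotate_parking_def)
  then show ?case unfolding funpow.simps comp_apply Suc.IH by (simp add: algebra_simps)
qed simp

lemma funpow_rotate_parking_N:
  assumes "x \<in> parking" "N dvd t"
  shows "(rotate_parking ^^ t) x = x"
proof (rule parking_eqI[OF funpow_rotate_parking_in_parking[OF assms(1)] assms(1)])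
  fix k i assume "k \<in> {1..a}"
  moreover have "cyclic_leader x (i - int t) = cyclic_leader x i"
    using assms(2) by (intro cyclic_leader_cong) simp
  ultimately show "cyclic_leader ((rotate_parking ^^ t) x) i = (rotate_parking ^^ t) x k \<longleftrightarrow>
      cyclic_leader x i = x k"
    using cyclic_leader_funpow_eq_value_iff[OF assms(1)] by simp
qed

lemma cyclic_leader_noncrossing:
  assumes x: "x \<in> parking" and order: "i < j" "j < k" "k < l" "l < i + int N"
    and same: "cyclic_leader x i = cyclic_leader x k" "cyclic_leader x j = cyclic_leader x l"
  shows "cyclic_leader x i = cyclic_leader x j"
proof -
  obtain t where t: "int N dvd int t - (1 - i)" using obtain_nat_cong[OF N_pos] .
  define y where "y = (rotate_parking ^^ t) x"
  interpret path_heights a b N "label_height y"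
    unfolding y_def by (intro path_heights_parking funpow_rotate_parking_in_parking x)
  have "cyclic_leader y (m - i + 1) = cyclic_leader y (m + int t)" for m
    using t by (intro cyclic_leader_cong) (simp add: dvd_diff_commute algebra_simps)
  then have unroll: "cyclic_leader x m = cyclic_leader x n \<longleftrightarrow>
      cyclic_leader y (m - i + 1) = cyclic_leader y (n - i + 1)" for m n
    using cyclic_leader_funpow_eq_iff[OF x, of t "m + int t" "n + int t"] by (simp add: y_def)
  define pos where "pos m = nat (m - i + 1)" for m
  have "cyclic_leader y (m - i + 1) = leader (label_height y) (pos m)" if "i \<le> m" "m < i + int N" for m
    using cyclic_leader_of_nat[of "pos m" y] that by (simp add: pos_def nat_le_iff)
  then have leader_iff: "leader (label_height y) (pos m) = leader (label_height y) (pos n) \<longleftrightarrow>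
      cyclic_leader x m = cyclic_leader x n"
    if "i \<le> m" "m < i + int N" "i \<le> n" "n < i + int N" for m n
    using unroll that by simp
  have "leader (label_height y) (pos i) = leader (label_height y) (pos j)"
  proof (rule leader_noncrossing[of "pos i" "pos j" "pos k" "pos l"])
    show "leader (label_height y) (pos i) = leader (label_height y) (pos k)"
      "leader (label_height y) (pos j) = leader (label_height y) (pos l)"
      using leader_iff same order by auto
  qed (use order in \<open>auto simp: pos_def\<close>)
  then show ?thesis using leader_iff[of i j] order by simp
qed

end

lemma card_permuted_filter:
  assumes "w permutes S"
  shows "card {k \<in> S. P (w k)} = card {k \<in> S. P k}"
proof -
  have "w ` {k \<in> S. P (w k)} = {k \<in> S. P k}"
  proof (intro subset_antisym subsetI)
    fix k assume "k \<in> {k \<in> S. P k}"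
    then show "k \<in> w ` {k \<in> S. P (w k)}"
      using permutes_inverses(1)[OF assms] permutes_in_image[OF permutes_inv[OF assms], of k]
      by (intro image_eqI[of _ _ "inv_into UNIV w k"]) auto
  qed (use permutes_in_image[OF assms] in auto)
  then show ?thesis
    using card_image[OF inj_on_subset[OF permutes_inj[OF assms] subset_UNIV]] by metis
qed

lemma PiE_comp_permutes:
  assumes w: "w permutes S" and x: "x \<in> S \<rightarrow>\<^sub>E A"
  shows "x \<circ> w \<in> S \<rightarrow>\<^sub>E A"
proof (rule PiE_I)
  show "(x \<circ> w) k \<in> A" if "k \<in> S" for k using that x permutes_in_image[OF w, of k] by auto
  show "(x \<circ> w) k = undefined" if "k \<notin> S" for k using that x permutes_not_in[OF w, of k] by auto
qed

context rational_slope
begin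

context
  fixes w :: "nat \<Rightarrow> nat"
  assumes w: "w permutes {1..a}"
begin

lemma label_height_comp: "label_height (x \<circ> w) = label_height x"
  unfolding label_height_def using card_permuted_filter[OF w, of "\<lambda>k. 0 < x k \<and> x k \<le> m" for m]
  by (simp add: fun_eq_iff)

lemma cyclic_leader_comp: "cyclic_leader (x \<circ> w) = cyclic_leader x"
  by (simp add: cyclic_leader_def label_height_comp fun_eq_iff)

lemma parking_comp: "x \<in> parking \<Longrightarrow> x \<circ> w \<in> parking"
  using PiE_comp_permutes[OF w, of x "{1..N}"] by (auto simp: parking_def label_height_comp)

lemma rotate_parking_comp: "rotate_parking (x \<circ> w) = rotate_parking x \<circ> w"
proof
  fix k show "rotate_parking (x \<circ> w) k = (rotate_parking x \<circ> w) k"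
    unfolding rotate_parking_def label_height_comp using permutes_in_image[OF w, of k] by simp
qed

lemma funpow_rotate_parking_comp: "(rotate_parking ^^ t) (x \<circ> w) = (rotate_parking ^^ t) x \<circ> w"
  by (induction t)
    (simp_all only: funpow.simps id_apply comp_apply[of rotate_parking] rotate_parking_comp)

end

end

subsection \<open>Rotation of noncrossing parking functions\<close>

context rational_slope
begin

lemma rot_eq_residue: "m \<in> {1..N} \<Longrightarrow> rot b m = residue N (int m + 1)"
  unfolding rot_def b_minus_1 using residue_Suc[OF N_pos, of "int m"] residue_of_nat[of m N] by auto

lemma inj_rot: "inj (rot b)"
proof (rule inj_on_inverseI)
  fix i
  show "(\<lambda>j. if 1 < j \<and> j \<le> N then j - 1 else if j = 1 then N else j) (rot b i) = i"
    using N_pos unfolding rot_def b_minus_1 by (cases "i = N"; cases "i < N"; cases "i = 0") simp_all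
qed

lemma rot_image: "rot b ` {1..N} = {1..N}"
proof (rule endo_inj_surj)
  show "rot b ` {1..N} \<subseteq> {1..N}" using rot_eq_residue residue_in_range[OF N_pos] by auto
qed (use inj_rot in \<open>auto intro: inj_on_subset\<close>)

lemma leader_rot:
  assumes "x \<in> parking" "m \<in> {1..N}"
  shows "leader (label_height (rotate_parking x)) (rot b m)
    = rotated_leader (label_height x) (leader (label_height x) m)"
  using cyclic_leader_rotate_parking[OF assms(1), of "int m"] rot_eq_residue[OF assms(2)]
    residue_of_nat[OF assms(2)] by (simp add: cyclic_leader_def)

lemma leaders_rotate_parking:
  assumes "x \<in> parking"
  shows "leaders (label_height (rotate_parking x))
    = rotated_leader (label_height x) ` leaders (label_height x)"
proof -
  have "leaders (label_height (rotate_parking x))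
      = (\<lambda>m. leader (label_height (rotate_parking x)) (rot b m)) ` {1..N}"
    unfolding leaders_def by (subst rot_image[symmetric]) (rule image_image)
  then show ?thesis using leader_rot[OF assms] by (simp add: leaders_def image_image)
qed

lemma rot_block:
  assumes x: "x \<in> parking" and v: "0 < v"
  shows "rot b ` block (label_height x) v
    = block (label_height (rotate_parking x)) (rotated_leader (label_height x) v)"
proof -
  let ?g = "rotated_leader (label_height x)"
  have "block (label_height (rotate_parking x)) (?g v)
      = {j \<in> rot b ` {1..N}. leader (label_height (rotate_parking x)) j = ?g v}"
    unfolding rot_image block_def ..
  also have "\<dots> = rot b ` {m \<in> {1..N}. ?g (leader (label_height x) m) = ?g v}"
    using leader_rot[OF x] by (auto simp: image_iff)
  also have "{m \<in> {1..N}. ?g (leader (label_height x) m) = ?g v} = block (label_height x) v"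
    using rotated_leader_eq_iff[OF _ v] by (auto simp: block_def leader_def)
  finally show ?thesis ..
qed

lemma labels_vimage_rot:
  assumes x: "x \<in> parking" and v: "v \<in> leaders (label_height x)"
  shows "snd (noncrossing_of_parking x)
      (rot b -` block (label_height (rotate_parking x)) (rotated_leader (label_height x) v))
    = {k \<in> {1..a}. rotate_parking x k = rotated_leader (label_height x) v}"
proof -
  interpret path_heights a b N "label_height x" by (rule path_heights_parking[OF x])
  have "0 < v" using v leaders_iff by simp
  then have "rot b -` block (label_height (rotate_parking x)) (rotated_leader (label_height x) v)
      = block (label_height x) v"
    using rot_block[OF x] inj_vimage_image_eq[OF inj_rot] by metis
  moreover have "snd (noncrossing_of_parking x) (block (label_height x) v) = {k \<in> {1..a}. x k = v}"
    using v Min_block[OF v] by (auto simp: noncrossing_of_parking_def blocks_def)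
  moreover have "x k = v \<longleftrightarrow> rotated_leader (label_height x) (x k) = rotated_leader (label_height x) v"
    if "k \<in> {1..a}" for k
    using rotated_leader_eq_iff[OF _ \<open>0 < v\<close>, of "x k"] parking_in_range[OF x that] by simp
  ultimately show ?thesis by (auto simp: rotate_parking_def)
qed

lemma rot_act_noncrossing_of_parking:
  assumes x: "x \<in> parking"
  shows "rot_act b (noncrossing_of_parking x) = noncrossing_of_parking (rotate_parking x)"
proof -
  interpret path_heights a b N "label_height x" by (rule path_heights_parking[OF x])
  interpret rotated: path_heights a b N "label_height (rotate_parking x)"
    by (rule path_heights_parking[OF rotate_parking_in_parking[OF x]])
  have "0 < v" if "v \<in> leaders (label_height x)" for v using that leaders_iff by simp
  then have blocks:
    "(\<lambda>B. rot b ` B) ` blocks (label_height x) = blocks (label_height (rotate_parking x))"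
    unfolding blocks_def leaders_rotate_parking[OF x] image_image
    using rot_block[OF x] by (intro image_cong) auto
  have labels: "snd (noncrossing_of_parking x) (rot b -` B) = {k \<in> {1..a}. rotate_parking x k = Min B}"
    if B_in: "B \<in> blocks (label_height (rotate_parking x))" for B
  proof -
    obtain v where v: "v \<in> leaders (label_height x)"
      and B: "B = block (label_height (rotate_parking x)) (rotated_leader (label_height x) v)"
      using B_in unfolding blocks_def leaders_rotate_parking[OF x] by blast
    have "Min B = rotated_leader (label_height x) v"
      unfolding B by (rule rotated.Min_block) (use v in \<open>simp add: leaders_rotate_parking[OF x]\<close>)
    then show ?thesis using labels_vimage_rot[OF x v] by (simp only: B)
  qed
  have "fst (noncrossing_of_parking x) = blocks (label_height x)"
    by (simp add: noncrossing_of_parking_def)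
  then have "rot_act b (noncrossing_of_parking x) = (blocks (label_height (rotate_parking x)),
      \<lambda>B\<in>blocks (label_height (rotate_parking x)). snd (noncrossing_of_parking x) (rot b -` B))"
    unfolding rot_act_def Let_def by (simp only: blocks)
  also have "\<dots> = noncrossing_of_parking (rotate_parking x)"
    unfolding noncrossing_of_parking_def[of "rotate_parking x"] using labels
    by (intro arg_cong2[where f = Pair] refl restrict_ext)
  finally show ?thesis .
qed

lemma funpow_rot_act_noncrossing_of_parking:
  assumes "x \<in> parking"
  shows "(rot_act b ^^ d) (noncrossing_of_parking x) = noncrossing_of_parking ((rotate_parking ^^ d) x)"
  using assms
  by (induction d) (simp_all add: rot_act_noncrossing_of_parking funpow_rotate_parking_in_parking)

lemma perm_act_noncrossing_of_parking:
  assumes w: "w permutes {1..a}"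
  shows "perm_act w (noncrossing_of_parking x) = noncrossing_of_parking (x \<circ> inv_into UNIV w)"
proof -
  have inv: "inv_into UNIV w permutes {1..a}" by (rule permutes_inv[OF w])
  have "w ` {k \<in> {1..a}. x k = v} = {k \<in> {1..a}. x (inv_into UNIV w k) = v}" for v
  proof (intro subset_antisym subsetI)
    fix k assume "k \<in> {k \<in> {1..a}. x (inv_into UNIV w k) = v}"
    then show "k \<in> w ` {k \<in> {1..a}. x k = v}"
      using permutes_inverses(1)[OF w, of k] permutes_in_image[OF inv, of k]
      by (intro image_eqI[of _ _ "inv_into UNIV w k"]) auto
  qed (use permutes_inverses(2)[OF w] permutes_in_image[OF w] in auto)
  then show ?thesis
    by (simp add: perm_act_def noncrossing_of_parking_def label_height_comp[OF inv] restrict_def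
        fun_eq_iff)
qed

lemma noncrossing_of_parking_fixed_iff:
  assumes w: "w permutes {1..a}" and x: "x \<in> parking"
  shows "perm_act w ((rot_act b ^^ d) (noncrossing_of_parking x)) = noncrossing_of_parking x \<longleftrightarrow>
    (rotate_parking ^^ d) x = x \<circ> w"
proof -
  let ?z = "(rotate_parking ^^ d) x"
  have z: "?z \<circ> inv_into UNIV w \<in> parking"
    using parking_comp[OF permutes_inv[OF w]] funpow_rotate_parking_in_parking[OF x] by blast
  have "perm_act w ((rot_act b ^^ d) (noncrossing_of_parking x)) = noncrossing_of_parking x \<longleftrightarrow>
      ?z \<circ> inv_into UNIV w = x"
    using inj_on_eq_iff[OF inj_on_noncrossing_of_parking z x]
    by (simp only: funpow_rot_act_noncrossing_of_parking[OF x] perm_act_noncrossing_of_parking[OF w])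
  also have "\<dots> \<longleftrightarrow> ?z = x \<circ> w"
    using permutes_inv_o[OF w] by (metis comp_assoc comp_id)
  finally show ?thesis .
qed

lemma park_char_eq:
  assumes w: "w permutes {1..a}"
  shows "park_char a b w d = card {x \<in> parking. (rotate_parking ^^ d) x = x \<circ> w}"
proof -
  have "{p \<in> Park_NC a b. perm_act w ((rot_act b ^^ d) p) = p}
      = noncrossing_of_parking ` {x \<in> parking. (rotate_parking ^^ d) x = x \<circ> w}"
    unfolding Park_NC_eq using noncrossing_of_parking_fixed_iff[OF w] by blast
  then show ?thesis
    unfolding park_char_def
    by (simp add: card_image inj_on_subset[OF inj_on_noncrossing_of_parking])
qed

end

subsection \<open>Rotation of labels and the cyclic excess\<close>

lemma residue_div:
  assumes "0 < M"
  shows "(m - int (residue M i)) div int M = (m - i) div int M - (- i) div int M - 1"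
proof -
  obtain c where c: "int (residue M i) = i + int M * c"
    using dvd_residue_diff[OF assms, of i] by (auto simp: dvd_def algebra_simps)
  have shift: "(j - int M * c) div int M = j div int M - c" for j
    using div_mult_self2[of "int M" j "- c"] assms by simp
  have "1 \<le> int (residue M i)" "int (residue M i) \<le> int M"
    using residue_in_range[OF assms, of i] by auto
  then have "(int M - int (residue M i)) div int M = 0" by (intro div_pos_pos_trivial) auto
  then have "(- int (residue M i)) div int M = - 1"
    using div_add_self1[of "int M" "- int (residue M i)"] assms by simp
  then have "c = (- i) div int M + 1" using shift[of "- i"] by (simp add: c)
  then show ?thesis using shift[of "m - i"] by (simp add: c algebra_simps)
qed

definition rotate_value :: "nat \<Rightarrow> int \<Rightarrow> nat \<Rightarrow> nat" where
  "rotate_value M s v = (if v = 0 then 0 else residue M (int v + s))"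

lemma rotate_value_eq_0_iff [simp]: "rotate_value M s v = 0 \<longleftrightarrow> v = 0"
  by (simp add: rotate_value_def residue_def)

lemma rotate_value_pos_iff [simp]: "0 < rotate_value M s v \<longleftrightarrow> 0 < v"
  using rotate_value_eq_0_iff[of M s v] by linarith

lemma rotate_value_le: "0 < M \<Longrightarrow> rotate_value M s v \<le> M"
  using residue_in_range[of M] by (simp add: rotate_value_def)

lemma rotate_value_add: "0 < M \<Longrightarrow> rotate_value M s (rotate_value M t v) = rotate_value M (s + t) v"
  using residue_add[of M "int v + t" s] rotate_value_eq_0_iff[of M t v]
  by (simp add: rotate_value_def algebra_simps split: if_splits)

lemma rotate_value_eq_self_iff:
  assumes "v \<le> M" "0 < v"
  shows "rotate_value M s v = v \<longleftrightarrow> int M dvd s"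
proof -
  have "rotate_value M s v = v \<longleftrightarrow> residue M (int v + s) = residue M (int v)"
    using assms residue_of_nat[of v M] by (simp add: rotate_value_def)
  then show ?thesis using assms by (simp add: residue_eq_iff)
qed

context rational_slope
begin

definition rotate_labels :: "nat \<Rightarrow> int \<Rightarrow> (nat \<Rightarrow> nat) \<Rightarrow> nat \<Rightarrow> nat" where
  "rotate_labels M s y = (\<lambda>k\<in>{1..a}. rotate_value M s (y k))"

lemma rotate_labels_apply: "k \<in> {1..a} \<Longrightarrow> rotate_labels M s y k = rotate_value M s (y k)"
  by (simp add: rotate_labels_def)

lemma rotate_labels_add:
  "0 < M \<Longrightarrow> rotate_labels M s (rotate_labels M t y) = rotate_labels M (s + t) y"
  by (auto simp: rotate_labels_def rotate_value_add)

lemma rotate_labels_multiple: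
  assumes "y \<in> {1..a} \<rightarrow>\<^sub>E {0..M}" "int M dvd s"
  shows "rotate_labels M s y = y"
proof (rule extensionalityI[of _ "{1..a}"])
  fix k assume "k \<in> {1..a}"
  moreover from this have "y k \<le> M" using assms(1) by auto
  ultimately show "rotate_labels M s y k = y k"
    using rotate_value_eq_self_iff[of "y k" M s] assms(2)
    by (cases "y k = 0") (simp_all add: rotate_labels_apply)
qed (use assms in \<open>auto simp: rotate_labels_def PiE_iff\<close>)

lemma rotate_labels_range: "0 < M \<Longrightarrow> rotate_labels M s y \<in> {1..a} \<rightarrow>\<^sub>E {0..M}"
  by (auto simp: rotate_labels_def rotate_value_le)

lemma rotate_labels_nonzero_range:
  assumes "y \<in> {1..a} \<rightarrow>\<^sub>E {1..M}"
  shows "rotate_labels M s y \<in> {1..a} \<rightarrow>\<^sub>E {1..M}"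
proof (rule PiE_I)
  fix k assume k: "k \<in> {1..a}"
  then have "y k \<in> {1..M}" using assms by auto
  then show "rotate_labels M s y k \<in> {1..M}"
    using k rotate_value_le[of M s "y k"] by (simp add: rotate_labels_apply Suc_le_eq)
qed (auto simp: rotate_labels_def)

lemma rotate_labels_comp: "w permutes {1..a} \<Longrightarrow> rotate_labels M s (y \<circ> w) = rotate_labels M s y \<circ> w"
  using permutes_in_image[of w "{1..a}"] by (auto simp: rotate_labels_def fun_eq_iff)

text \<open>The quotient \<open>(m - v) div M + 1\<close> counts, with sign, the representatives of \<open>v\<close> modulo \<open>M\<close> in
  \<open>{1..m}\<close>, so this continues \<open>label_height y\<close> from \<open>{0..M}\<close> to all integers. Labels equal to \<open>0\<close> are
  not on the circle.\<close>

definition cyclic_height :: "nat \<Rightarrow> (nat \<Rightarrow> nat) \<Rightarrow> int \<Rightarrow> int" where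
  "cyclic_height M y m = (\<Sum>k\<in>{1..a}. if y k = 0 then 0 else (m - int (y k)) div int M + 1)"

definition cyclic_excess :: "nat \<Rightarrow> (nat \<Rightarrow> nat) \<Rightarrow> int \<Rightarrow> int" where
  "cyclic_excess M y m = int b * cyclic_height M y m - int a * m"

lemma cyclic_height_of_nat:
  assumes y: "y \<in> {1..a} \<rightarrow>\<^sub>E {0..M}" and m: "m \<le> M"
  shows "cyclic_height M y (int m) = int (label_height y m)"
proof -
  have "(if y k = 0 then 0 else (int m - int (y k)) div int M + 1) = of_bool (0 < y k \<and> y k \<le> m)"
    if k: "k \<in> {1..a}" for k
  proof (cases "y k = 0")
    case False
    have "y k \<le> M" using y k by auto
    show ?thesis
    proof (cases "y k \<le> m")
      case True
      then have "(int m - int (y k)) div int M = 0"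
        using False m by (intro div_pos_pos_trivial) auto
      then show ?thesis using True False by simp
    next
      case less: False
      have "(int m - int (y k) + int M) div int M = 0"
        using less \<open>y k \<le> M\<close> by (intro div_pos_pos_trivial) auto
      then have "(int m - int (y k)) div int M = - 1"
        using less \<open>y k \<le> M\<close> div_add_self2[of "int M" "int m - int (y k)"] by simp
      then show ?thesis using less by simp
    qed
  qed simp
  then have "cyclic_height M y (int m) = (\<Sum>k\<in>{1..a}. of_bool (0 < y k \<and> y k \<le> m))"
    unfolding cyclic_height_def by (rule sum.cong[OF refl])
  then show ?thesis by (simp add: label_height_def Int_def)
qed

lemma cyclic_excess_of_nat:
  "y \<in> {1..a} \<rightarrow>\<^sub>E {0..M} \<Longrightarrow> m \<le> M \<Longrightarrow> cyclic_excess M y (int m) = excess (label_height y) m"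
  by (simp add: cyclic_excess_def cyclic_height_of_nat excess_def)

lemma cyclic_height_add_multiple:
  assumes "0 < M"
  shows "cyclic_height M y (m + t * int M) = cyclic_height M y m + t * int (card {k \<in> {1..a}. y k \<noteq> 0})"
proof -
  have "(if y k = 0 then 0 else (m + t * int M - int (y k)) div int M + 1)
      = (if y k = 0 then 0 else (m - int (y k)) div int M + 1) + t * of_bool (y k \<noteq> 0)" for k
    using div_mult_self1[of "int M" "m - int (y k)" t] assms by (simp add: algebra_simps)
  then show ?thesis
    unfolding cyclic_height_def by (simp add: sum.distrib Int_def flip: sum_distrib_left)
qed

lemma cyclic_excess_add_multiple:
  "0 < M \<Longrightarrow> cyclic_excess M y (m + t * int M)
    = cyclic_excess M y m + t * (int b * int (card {k \<in> {1..a}. y k \<noteq> 0}) - int a * int M)"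
  by (simp add: cyclic_excess_def cyclic_height_add_multiple algebra_simps)

lemma cyclic_height_rotate_labels:
  assumes "0 < M"
  shows "cyclic_height M (rotate_labels M s y) m = cyclic_height M y (m - s) - cyclic_height M y (- s)"
proof -
  have "(if rotate_labels M s y k = 0 then 0 else (m - int (rotate_labels M s y k)) div int M + 1)
      = (if y k = 0 then 0 else (m - s - int (y k)) div int M + 1)
        - (if y k = 0 then 0 else (- s - int (y k)) div int M + 1)" if "k \<in> {1..a}" for k
    using residue_div[OF assms, of m "int (y k) + s"] that rotate_value_eq_0_iff[of M s "y k"]
    by (simp add: rotate_labels_apply rotate_value_def algebra_simps)
  then show ?thesis
    unfolding cyclic_height_def sum_subtractf[symmetric] by (rule sum.cong[OF refl])
qed

lemma cyclic_excess_rotate_labels: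
  "0 < M \<Longrightarrow>
    cyclic_excess M (rotate_labels M s y) m = cyclic_excess M y (m - s) - cyclic_excess M y (- s)"
  by (simp add: cyclic_excess_def cyclic_height_rotate_labels algebra_simps)

lemma cyclic_excess_comp:
  assumes "w permutes {1..a}"
  shows "cyclic_excess M (y \<circ> w) = cyclic_excess M y"
proof
  fix m
  show "cyclic_excess M (y \<circ> w) m = cyclic_excess M y m"
    using sum.permute[OF assms, of "\<lambda>k. if y k = 0 then 0 else (m - int (y k)) div int M + 1"]
    unfolding cyclic_excess_def cyclic_height_def comp_def by simp
qed

end

subsection \<open>The cycle lemma\<close>

lemma quasiperiodic_obtain_argmin:
  fixes f :: "int \<Rightarrow> int"
  assumes M: "0 < M" and f: "\<And>m t. f (m + t * int M) = f m + t * T" and T: "0 \<le> T"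
  obtains q where "q < M" "\<And>m. 0 \<le> m \<Longrightarrow> f (int q) \<le> f m"
proof -
  obtain q where q: "q \<in> {..<M}" and min: "Min ((\<lambda>n. f (int n)) ` {..<M}) = f (int q)"
    using obtains_MIN[of "{..<M}" "\<lambda>n. f (int n)"] M by blast
  have "f (int q) \<le> f m" if "0 \<le> m" for m
  proof -
    have r: "int (nat (m mod int M)) = m mod int M" "nat (m mod int M) \<in> {..<M}"
      using M by (auto simp: nat_less_iff)
    have "f (int q) \<le> f (m mod int M)"
      using Min_le[of "(\<lambda>n. f (int n)) ` {..<M}" "f (m mod int M)"] r min
      by (metis finite_imageI finite_lessThan imageI)
    also have "\<dots> \<le> f (m mod int M) + m div int M * T"
      using T that M by (simp add: pos_imp_zdiv_nonneg_iff)
    also have "\<dots> = f m" using f[of "m mod int M" "m div int M"] by simp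
    finally show ?thesis .
  qed
  then show thesis using that q by blast
qed

context rational_slope
begin

lemma cyclic_excess_b_periodic:
  assumes "x \<in> {1..a} \<rightarrow>\<^sub>E {1..b}"
  shows "cyclic_excess b x (m + t * int b) = cyclic_excess b x m"
proof -
  have "x k \<noteq> 0" if "k \<in> {1..a}" for k using PiE_mem[OF assms that] by simp
  then have "{k \<in> {1..a}. x k \<noteq> 0} = {1..a}" by auto
  then show ?thesis using cyclic_excess_add_multiple[OF b_pos, of x m t] by simp
qed

lemma parking_cyclic_excess_nonneg:
  assumes x: "x \<in> {1..a} \<rightarrow>\<^sub>E {1..b}" and parking: "x \<in> parking"
  shows "0 \<le> cyclic_excess b x m"
proof -
  define r where "r = nat (m mod int b)"
  have r: "int r = m mod int b" "r \<le> b"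
    using b_pos by (auto simp: r_def nat_le_iff less_imp_le)
  have "cyclic_excess b x m = cyclic_excess b x (int r)"
    using cyclic_excess_b_periodic[OF x, of "int r" "m div int b"] by (simp add: r)
  also have "\<dots> = excess (label_height x) r"
    using x r(2) by (intro cyclic_excess_of_nat) (auto simp: PiE_iff)
  finally show ?thesis
    using path_heights.excess_nonneg[OF path_heights_parking[OF parking] r(2)] by simp
qed

lemma parking_if_excess_nonneg:
  assumes x: "x \<in> {1..a} \<rightarrow>\<^sub>E {1..b}"
    and nonneg: "\<And>m. m \<le> N \<Longrightarrow> 0 \<le> excess (label_height x) m"
  shows "x \<in> parking"
proof -
  have "{k \<in> {1..a}. x k = b} = {}"
  proof (rule ccontr)
    assume "\<not> ?thesis"
    then have "0 < card {k \<in> {1..a}. x k = b}" by (simp add: card_gt_0_iff)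
    moreover have "label_height x b = a" using x by (intro label_height_top) auto
    ultimately have "label_height x N < a"
      using label_height_step[OF b_pos, of x] unfolding b_minus_1 by linarith
    then have "int b * (int (label_height x N) + 1) \<le> int b * int a" by (intro mult_left_mono) auto
    then have "excess (label_height x) N < 0"
      using int_b a_less_b by (simp add: excess_def algebra_simps)
    then show False using nonneg[of N] by simp
  qed
  then have "x k \<in> {1..N}" if "k \<in> {1..a}" for k
    using x that b_eq by (force simp: le_Suc_eq PiE_iff)
  then have "x \<in> {1..a} \<rightarrow>\<^sub>E {1..N}" using x by (auto simp: PiE_iff)
  then show ?thesis unfolding parking_def using nonneg by simp
qed

lemma parking_iff_cyclic_excess_nonneg:
  assumes x: "x \<in> {1..a} \<rightarrow>\<^sub>E {1..b}"
  shows "x \<in> parking \<longleftrightarrow> (\<forall>m. 0 \<le> cyclic_excess b x m)"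
proof
  assume nonneg: "\<forall>m. 0 \<le> cyclic_excess b x m"
  have "x \<in> {1..a} \<rightarrow>\<^sub>E {0..b}" using x by (auto simp: PiE_iff)
  then have "0 \<le> excess (label_height x) m" if "m \<le> N" for m
    using nonneg cyclic_excess_of_nat[of x b m] that N_less_b by (metis less_imp_le order_trans)
  then show "x \<in> parking" by (rule parking_if_excess_nonneg[OF x])
qed (use parking_cyclic_excess_nonneg[OF x] in blast)

lemma rotate_labels_parking_iff:
  assumes z: "z \<in> {1..a} \<rightarrow>\<^sub>E {1..b}"
  shows "rotate_labels b s z \<in> parking \<longleftrightarrow> (\<forall>m. cyclic_excess b z (- s) \<le> cyclic_excess b z m)"
proof -
  have "rotate_labels b s z \<in> parking \<longleftrightarrow> (\<forall>m. 0 \<le> cyclic_excess b (rotate_labels b s z) m)"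
    by (rule parking_iff_cyclic_excess_nonneg[OF rotate_labels_nonzero_range[OF z]])
  also have "\<dots> \<longleftrightarrow> (\<forall>m. cyclic_excess b z (- s) \<le> cyclic_excess b z (m - s))"
    by (simp add: cyclic_excess_rotate_labels[OF b_pos])
  also have "\<dots> \<longleftrightarrow> (\<forall>m. cyclic_excess b z (- s) \<le> cyclic_excess b z m)"
    by (metis add_diff_cancel)
  finally show ?thesis .
qed

lemma rotate_labels_parking_unique:
  assumes z: "z \<in> {1..a} \<rightarrow>\<^sub>E {1..b}"
    and parking: "rotate_labels b s z \<in> parking" "rotate_labels b t z \<in> parking"
  shows "int b dvd s - t"
proof -
  have "cyclic_excess b z (- s) = cyclic_excess b z (- t)"
    using parking unfolding rotate_labels_parking_iff[OF z] by (simp add: order_antisym)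
  then have "int a * (s - t) = int b * (cyclic_height b z (- t) - cyclic_height b z (- s))"
    by (simp add: cyclic_excess_def algebra_simps)
  then show ?thesis by (metis b_dvd_a_mult_iff dvd_triv_left)
qed

lemma obtain_rotation_to_parking:
  assumes z: "z \<in> {1..a} \<rightarrow>\<^sub>E {1..b}"
  obtains q where "q < b" "rotate_labels b (- int q) z \<in> parking"
proof -
  obtain q where "q < b" and min: "\<And>m. 0 \<le> m \<Longrightarrow> cyclic_excess b z (int q) \<le> cyclic_excess b z m"
    using quasiperiodic_obtain_argmin[OF b_pos, of "cyclic_excess b z" 0] cyclic_excess_b_periodic[OF z]
    by auto
  have "cyclic_excess b z (int q) \<le> cyclic_excess b z m" for m
    using min[of "m mod int b"] cyclic_excess_b_periodic[OF z, of "m mod int b" "m div int b"] b_pos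
    by simp
  with \<open>q < b\<close> show thesis using that rotate_labels_parking_iff[OF z, of "- int q"] by simp
qed

lemma parking_range_b:
  assumes "x \<in> parking"
  shows "x \<in> {1..a} \<rightarrow>\<^sub>E {1..b}"
proof -
  have "{1..a} \<rightarrow>\<^sub>E {1..N} \<subseteq> {1..a} \<rightarrow>\<^sub>E {1..b}" by (rule PiE_mono) (simp add: b_eq)
  then show ?thesis using assms by (auto simp: parking_def)
qed

lemma rotate_labels_inject_on_parking:
  assumes x: "x \<in> parking" "x' \<in> parking" and q: "q < b" "q' < b"
    and eq: "rotate_labels b (int q) x = rotate_labels b (int q') x'"
  shows "q = q' \<and> x = x'"
proof -
  have trivial: "rotate_labels b 0 y = y" if "y \<in> parking" for y
    using parking_range_b[OF that] by (intro rotate_labels_multiple) (auto simp: PiE_iff)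
  have "x = rotate_labels b (int q' - int q) x'"
    using arg_cong[OF eq, of "rotate_labels b (- int q)"] trivial[OF x(1)] b_pos
    by (simp add: rotate_labels_add)
  moreover from this have "int b dvd (int q' - int q) - 0"
    using x trivial by (intro rotate_labels_parking_unique[OF parking_range_b[OF x(2)]]) auto
  then have "int q' = int q" using q by (intro dvd_diff_imp_eq_int[of "int b"]) auto
  ultimately show ?thesis using trivial[OF x(2)] by simp
qed

lemma card_fixed_parking:
  assumes w: "w permutes {1..a}"
  shows "b * card {x \<in> parking. x \<circ> w = x} = card {z \<in> {1..a} \<rightarrow>\<^sub>E {1..b}. z \<circ> w = z}"
    (is "b * card ?X = card ?Z")
proof -
  let ?rotate = "\<lambda>(q, x). rotate_labels b (int q) x"
  have "?rotate ` ({..<b} \<times> ?X) = ?Z"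
  proof (intro subset_antisym subsetI)
    fix z assume z: "z \<in> ?Z"
    then obtain q where q: "q < b" "rotate_labels b (- int q) z \<in> parking"
      using obtain_rotation_to_parking[of z] by blast
    define x where "x = rotate_labels b (- int q) z"
    have "x \<circ> w = x" using z rotate_labels_comp[OF w, of b "- int q" z] by (simp add: x_def)
    moreover have "z \<in> {1..a} \<rightarrow>\<^sub>E {0..b}" using z by (auto simp: PiE_iff)
    then have "rotate_labels b (int q) x = z"
      using rotate_labels_multiple[of z b 0] b_pos by (simp add: x_def rotate_labels_add)
    ultimately show "z \<in> ?rotate ` ({..<b} \<times> ?X)"
      using q by (intro image_eqI[of _ _ "(q, x)"]) (auto simp: x_def)
  next
    fix z assume "z \<in> ?rotate ` ({..<b} \<times> ?X)"
    then obtain q x where "x \<in> parking" "x \<circ> w = x" "z = rotate_labels b (int q) x" by auto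
    then show "z \<in> ?Z"
      using rotate_labels_nonzero_range[OF parking_range_b, of x "int q"]
        rotate_labels_comp[OF w, of b "int q" x] by simp
  qed
  moreover have "inj_on ?rotate ({..<b} \<times> ?X)"
    using rotate_labels_inject_on_parking by (auto simp: inj_on_def)
  then have "card (?rotate ` ({..<b} \<times> ?X)) = card ({..<b} \<times> ?X)" by (rule card_image)
  ultimately have "card ({..<b} \<times> ?X) = card ?Z" by (simp only:)
  then show ?thesis unfolding card_cartesian_product card_lessThan .
qed

end

subsection \<open>Cyclic labellings and their parking functions\<close>

context rational_slope
begin

text \<open>A function into \<open>{0..N}\<close> describes a labelled noncrossing partition of the integers modulo \<open>N\<close>:
  a value \<open>v > 0\<close> marks the block that starts at \<open>v\<close>, the value \<open>0\<close> the block of those integers that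
  have no parent.\<close>

definition cyclic_parent :: "(nat \<Rightarrow> nat) \<Rightarrow> int \<Rightarrow> int \<Rightarrow> bool" where
  "cyclic_parent y p m \<longleftrightarrow> p < m \<and> cyclic_excess N y p < cyclic_excess N y m \<and>
    (\<forall>q. p < q \<longrightarrow> q < m \<longrightarrow> cyclic_excess N y m \<le> cyclic_excess N y q)"

definition in_labelled_block :: "(nat \<Rightarrow> nat) \<Rightarrow> nat \<Rightarrow> int \<Rightarrow> bool" where
  "in_labelled_block y k i \<longleftrightarrow>
    (if y k = 0 then \<nexists>p. cyclic_parent y p i
     else \<exists>p. int N dvd p + 1 - int (y k) \<and> cyclic_parent y p i)"

lemma cyclic_parent_unique: "cyclic_parent y p m \<Longrightarrow> cyclic_parent y q m \<Longrightarrow> p = q"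
  unfolding cyclic_parent_def by (meson linorder_neqE not_less)

lemma obtain_cyclic_parent:
  assumes "p < m" "cyclic_excess N y p < cyclic_excess N y m"
  obtains q where "p \<le> q" "cyclic_parent y q m"
proof -
  define S where "S = {q \<in> {p..<m}. cyclic_excess N y q < cyclic_excess N y m}"
  have "finite S" unfolding S_def by (rule finite_subset[of _ "{p..<m}"]) auto
  have "p \<in> S" using assms by (simp add: S_def)
  then have "Max S \<in> S" using \<open>finite S\<close> Max_in by blast
  moreover have "cyclic_excess N y m \<le> cyclic_excess N y q" if "Max S < q" "q < m" for q
  proof (rule ccontr)
    assume "\<not> ?thesis"
    then have "q \<in> S" using that \<open>Max S \<in> S\<close> by (auto simp: S_def)
    then show False using Max_ge[OF \<open>finite S\<close>] that(1) by (meson not_less)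
  qed
  ultimately show thesis using that[of "Max S"] by (auto simp: S_def cyclic_parent_def)
qed

lemma cyclic_parent_translate:
  assumes "\<And>m. cyclic_excess N z (m + s) = cyclic_excess N y m + c"
  shows "cyclic_parent z (p + s) (m + s) \<longleftrightarrow> cyclic_parent y p m"
proof -
  have "(\<forall>q. p + s < q \<longrightarrow> q < m + s \<longrightarrow> cyclic_excess N z (m + s) \<le> cyclic_excess N z q) \<longleftrightarrow>
      (\<forall>q. p + s < q + s \<longrightarrow> q + s < m + s \<longrightarrow> cyclic_excess N z (m + s) \<le> cyclic_excess N z (q + s))"
    by (metis diff_add_cancel)
  then show ?thesis by (simp add: cyclic_parent_def assms)
qed

lemma cyclic_parent_rotate_labels:
  "cyclic_parent (rotate_labels N s y) p m \<longleftrightarrow> cyclic_parent y (p - s) (m - s)"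
  using cyclic_parent_translate[of "rotate_labels N s y" s y "- cyclic_excess N y (- s)"
      "p - s" "m - s"]
  by (simp add: cyclic_excess_rotate_labels[OF N_pos])

lemma in_labelled_block_rotate_labels:
  assumes k: "k \<in> {1..a}"
  shows "in_labelled_block (rotate_labels N s y) k i \<longleftrightarrow> in_labelled_block y k (i - s)"
proof (cases "y k = 0")
  case True
  then show ?thesis
    using k by (auto simp: in_labelled_block_def rotate_labels_apply cyclic_parent_rotate_labels)
      (metis add_diff_cancel)
next
  case False
  then have label: "rotate_labels N s y k = residue N (int (y k) + s)" "rotate_labels N s y k \<noteq> 0"
    using k by (simp_all add: rotate_labels_apply rotate_value_def residue_def)
  have dvd: "int N dvd p + 1 - int (residue N (int (y k) + s)) \<longleftrightarrow>
      int N dvd (p - s) + 1 - int (y k)" for p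
    using dvd_residue_diff[OF N_pos, of "int (y k) + s"]
      dvd_add_right_iff[of "int N" "int (residue N (int (y k) + s)) - (int (y k) + s)"
        "p + 1 - int (residue N (int (y k) + s))"]
    by (simp add: algebra_simps)
  have "(\<exists>p. int N dvd (p - s) + 1 - int (y k) \<and> cyclic_parent y (p - s) (i - s)) \<longleftrightarrow>
      (\<exists>p. int N dvd p + 1 - int (y k) \<and> cyclic_parent y p (i - s))"
    by (metis add_diff_cancel)
  then show ?thesis
    using False label by (simp only: in_labelled_block_def cyclic_parent_rotate_labels dvd if_False)
qed

lemma in_labelled_block_cong:
  assumes "y \<in> {1..a} \<rightarrow>\<^sub>E {0..N}" "k \<in> {1..a}" "int N dvd i - j"
  shows "in_labelled_block y k i \<longleftrightarrow> in_labelled_block y k j"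
  using in_labelled_block_rotate_labels[OF assms(2), of "i - j" y i]
    rotate_labels_multiple[OF assms(1,3)] by simp

lemma in_labelled_block_comp:
  assumes "w permutes {1..a}"
  shows "in_labelled_block (y \<circ> w) k i \<longleftrightarrow> in_labelled_block y (w k) i"
  by (simp add: in_labelled_block_def cyclic_parent_def[abs_def] cyclic_excess_comp[OF assms])

definition zeros :: "(nat \<Rightarrow> nat) \<Rightarrow> nat set" where
  "zeros y = {k \<in> {1..a}. y k = 0}"

lemma zeros_rotate_labels [simp]: "zeros (rotate_labels M s y) = zeros y"
  by (auto simp: zeros_def rotate_labels_apply)

lemma cyclic_excess_add_N:
  "cyclic_excess N y (m + t * int N) = cyclic_excess N y m + t * (int a - int b * int (card (zeros y)))"
proof -
  have "zeros y \<union> {k \<in> {1..a}. y k \<noteq> 0} = {1..a}" "zeros y \<inter> {k \<in> {1..a}. y k \<noteq> 0} = {}"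
    by (auto simp: zeros_def)
  then have "card (zeros y) + card {k \<in> {1..a}. y k \<noteq> 0} = a"
    using card_Un_disjoint[of "zeros y" "{k \<in> {1..a}. y k \<noteq> 0}"] by (simp add: zeros_def)
  then have nonzeros: "int (card {k \<in> {1..a}. y k \<noteq> 0}) = int a - int (card (zeros y))" by linarith
  show ?thesis
    unfolding cyclic_excess_add_multiple[OF N_pos] nonzeros int_b by (simp add: algebra_simps)
qed

lemma a_less_b_mult_card_zeros:
  assumes "zeros y \<noteq> {}"
  shows "int a < int b * int (card (zeros y))"
proof -
  have "1 \<le> card (zeros y)" using assms by (simp add: zeros_def Suc_le_eq card_gt_0_iff)
  then have "int b * 1 \<le> int b * int (card (zeros y))" by (intro mult_left_mono) auto
  then show ?thesis using a_less_b by linarith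
qed

definition zeros_to_ones :: "(nat \<Rightarrow> nat) \<Rightarrow> nat \<Rightarrow> nat" where
  "zeros_to_ones y = (\<lambda>k\<in>{1..a}. if y k = 0 then 1 else y k)"

lemma zeros_to_ones_range:
  "y \<in> {1..a} \<rightarrow>\<^sub>E {0..N} \<Longrightarrow> zeros_to_ones y \<in> {1..a} \<rightarrow>\<^sub>E {1..N}"
  using N_pos by (auto simp: zeros_to_ones_def Suc_le_eq)

lemma zeros_to_ones_trivial:
  assumes "y \<in> {1..a} \<rightarrow>\<^sub>E {0..N}" "zeros y = {}"
  shows "zeros_to_ones y = y"
  using assms by (intro extensionalityI[of _ "{1..a}"]) (auto simp: zeros_to_ones_def zeros_def PiE_iff)

lemma excess_zeros_to_ones:
  assumes y: "y \<in> {1..a} \<rightarrow>\<^sub>E {0..N}" and m: "0 < m \<or> zeros y = {}" "m \<le> N"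
  shows "excess (label_height (zeros_to_ones y)) m
    = cyclic_excess N y (int m) + int b * int (card (zeros y))"
proof (cases "zeros y = {}")
  case True
  then show ?thesis using y m(2) by (simp add: zeros_to_ones_trivial cyclic_excess_of_nat)
next
  case False
  then have "0 < m" using m(1) by simp
  have "{k \<in> {1..a}. 0 < zeros_to_ones y k \<and> zeros_to_ones y k \<le> m}
      = zeros y \<union> {k \<in> {1..a}. 0 < y k \<and> y k \<le> m}"
    using \<open>0 < m\<close> by (auto simp: zeros_to_ones_def zeros_def)
  moreover have "zeros y \<inter> {k \<in> {1..a}. 0 < y k \<and> y k \<le> m} = {}" by (auto simp: zeros_def)
  ultimately have "label_height (zeros_to_ones y) m = card (zeros y) + label_height y m"
    using card_Un_disjoint[of "zeros y" "{k \<in> {1..a}. 0 < y k \<and> y k \<le> m}"]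
    by (simp add: label_height_def zeros_def)
  then show ?thesis
    unfolding cyclic_excess_of_nat[OF y m(2)] by (simp add: excess_def algebra_simps)
qed

text \<open>A frame cuts the circle open either in front of all blocks or at an element of the block
  labelled \<open>0\<close>.\<close>

definition framed :: "(nat \<Rightarrow> nat) \<Rightarrow> bool" where
  "framed y \<longleftrightarrow> y \<in> {1..a} \<rightarrow>\<^sub>E {0..N} \<and> (zeros y \<noteq> {} \<longrightarrow> 1 \<notin> y ` {1..a}) \<and>
    zeros_to_ones y \<in> parking"

lemma dvd_Suc_diff_iff:
  assumes "p < n" "v \<in> {1..n}"
  shows "int n dvd int p + 1 - int v \<longleftrightarrow> Suc p = v"
proof
  assume "int n dvd int p + 1 - int v"
  then have "int p + 1 = int v" using assms by (intro dvd_diff_imp_eq_int[of "int n"]) auto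
  then show "Suc p = v" by simp
next
  assume "Suc p = v"
  then have "int v = int p + 1" by simp
  then show "int n dvd int p + 1 - int v" by simp
qed

context
  fixes y :: "nat \<Rightarrow> nat"
  assumes framed: "framed y"
begin

interpretation path_heights a b N "label_height (zeros_to_ones y)"
  using framed by (intro path_heights_parking) (simp add: framed_def)

lemma framed_range: "y \<in> {1..a} \<rightarrow>\<^sub>E {0..N}"
  using framed by (simp add: framed_def)

lemma cyclic_parent_of_parent:
  assumes m: "m \<in> {1..N}" and p: "parent (label_height (zeros_to_ones y)) m = p"
    and "0 < p \<or> zeros y = {}"
  shows "cyclic_parent y (int p) (int m)"
  unfolding cyclic_parent_def
proof (intro conjI allI impI)
  have m': "0 < m" "m \<le> N" using m by auto
  note excess = excess_zeros_to_ones[OF framed_range]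
  have "p < m" using parent_less[OF m'] p by simp
  then show "int p < int m" by simp
  show "cyclic_excess N y (int p) < cyclic_excess N y (int m)"
    using excess_parent[OF m'] excess[of m] excess[of p] p \<open>p < m\<close> m' assms(3) by simp
  fix q assume q: "int p < q" "q < int m"
  then obtain r where r: "q = int r" using zero_le_imp_eq_int[of q] by auto
  then show "cyclic_excess N y (int m) \<le> cyclic_excess N y q"
    using excess_after_parent[OF m', of r] excess[of m] excess[of r] p q m' by simp
qed

lemma no_cyclic_parent_of_parent_0:
  assumes m: "m \<in> {1..N}" and parent: "parent (label_height (zeros_to_ones y)) m = 0"
    and zeros: "zeros y \<noteq> {}"
  shows "\<not> cyclic_parent y p (int m)"
proof
  assume p: "cyclic_parent y p (int m)"
  have m': "0 < m" "m \<le> N" using m by auto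
  note excess = excess_zeros_to_ones[OF framed_range]
  have below: "cyclic_excess N y (int m) \<le> cyclic_excess N y (int r)" if "0 < r" "r \<le> m" for r
    using excess_after_parent[OF m', of r] excess[of m] excess[of r] parent that m'
    by (cases "r = m") auto
  have "{k \<in> {1..a}. 0 < y k \<and> y k \<le> 1} = {}"
    using framed zeros by (force simp: framed_def)
  then have "label_height y 1 = 0" unfolding label_height_def by (simp only: card.empty)
  then have "cyclic_excess N y 1 = - int a"
    using cyclic_excess_of_nat[OF framed_range, of 1] N_pos by (simp add: excess_def)
  then have top: "cyclic_excess N y (int m) \<le> - int a" using below[of 1] m' by simp
  have "\<not> 0 < p"
    using p below[of "nat p"] by (auto simp: cyclic_parent_def nat_le_iff)
  define r where "r = residue N p"
  have r: "r \<in> {1..N}" unfolding r_def by (rule residue_in_range[OF N_pos])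
  obtain t where t: "p = int r + t * int N"
    using dvd_residue_diff[OF N_pos, of p] unfolding r_def dvd_def
    by (metis add_diff_cancel_left' diff_add_cancel diff_minus_eq_add minus_mult_right mult.commute)
  have "t < 0"
  proof (rule ccontr)
    assume "\<not> t < 0"
    then have "0 \<le> t * int N" by simp
    then show False using t r \<open>\<not> 0 < p\<close> by simp
  qed
  then have "(t + 1) * (int a - int b * int (card (zeros y))) \<ge> 0"
    using a_less_b_mult_card_zeros[OF zeros] by (intro mult_nonpos_nonpos) auto
  moreover have "0 < excess (label_height (zeros_to_ones y)) r" using excess_pos r by simp
  ultimately have "- int a < cyclic_excess N y p"
    using excess[of r] r by (simp add: t cyclic_excess_add_N algebra_simps)
  then show False using top p by (simp add: cyclic_parent_def)
qed

lemma in_labelled_block_framed: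
  assumes k: "k \<in> {1..a}"
  shows "in_labelled_block y k i \<longleftrightarrow> cyclic_leader (zeros_to_ones y) i = zeros_to_ones y k"
proof -
  define m where "m = residue N i"
  define p where "p = parent (label_height (zeros_to_ones y)) m"
  have m: "m \<in> {1..N}" unfolding m_def by (rule residue_in_range[OF N_pos])
  then have p_less: "p < N" using parent_less[of m] by (simp add: p_def)
  have leader: "cyclic_leader (zeros_to_ones y) i = Suc p"
    by (simp add: cyclic_leader_def leader_def p_def m_def)
  have "in_labelled_block y k i \<longleftrightarrow> in_labelled_block y k (int m)"
    unfolding m_def using dvd_residue_diff[OF N_pos, of i]
    by (intro in_labelled_block_cong[OF framed_range k]) (simp add: dvd_diff_commute)
  also have "\<dots> \<longleftrightarrow> Suc p = zeros_to_ones y k"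
  proof (cases "p = 0 \<and> zeros y \<noteq> {}")
    case True
    then have "\<nexists>q. cyclic_parent y q (int m)"
      using no_cyclic_parent_of_parent_0[OF m] by (auto simp: p_def)
    moreover have "y k \<noteq> 1" using framed True imageI[OF k, of y] by (auto simp: framed_def)
    ultimately show ?thesis using True k by (simp add: in_labelled_block_def zeros_to_ones_def)
  next
    case False
    then have "cyclic_parent y (int p) (int m)"
      using cyclic_parent_of_parent[OF m p_def[symmetric]] by auto
    then have parent: "cyclic_parent y q (int m) \<longleftrightarrow> q = int p" for q
      using cyclic_parent_unique by blast
    have "y k \<le> N" using framed_range k by auto
    then have "int N dvd int p + 1 - int (y k) \<longleftrightarrow> Suc p = y k" if "y k \<noteq> 0"
      using that p_less by (intro dvd_Suc_diff_iff) auto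
    moreover have "p \<noteq> 0" if "y k = 0" using False that k by (auto simp: zeros_def)
    ultimately show ?thesis using k by (simp add: in_labelled_block_def parent zeros_to_ones_def)
  qed
  finally show ?thesis unfolding leader .
qed

end

lemma obtain_framed_rotation:
  assumes y: "y \<in> {1..a} \<rightarrow>\<^sub>E {0..N}" and zeros: "zeros y = {}"
  obtains s where "framed (rotate_labels N s y)"
proof -
  have "cyclic_excess N y (m + t * int N) = cyclic_excess N y m + t * int a" for m t
    using cyclic_excess_add_N[of y] zeros by simp
  then obtain q where min: "\<And>m. 0 \<le> m \<Longrightarrow> cyclic_excess N y (int q) \<le> cyclic_excess N y m"
    using quasiperiodic_obtain_argmin[OF N_pos _ of_nat_0_le_iff] by blast
  let ?z = "rotate_labels N (- int q) y"
  have z: "?z \<in> {1..a} \<rightarrow>\<^sub>E {0..N}" by (rule rotate_labels_range[OF N_pos])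
  then have trivial: "zeros_to_ones ?z = ?z" using zeros by (intro zeros_to_ones_trivial) simp_all
  have "0 \<le> excess (label_height ?z) m" if "m \<le> N" for m
    using cyclic_excess_of_nat[OF z that] min[of "int m + int q"]
    by (simp add: cyclic_excess_rotate_labels[OF N_pos])
  then have "?z \<in> parking" unfolding parking_def using zeros_to_ones_range[OF z] trivial by simp
  then have "framed ?z" using z zeros trivial by (simp add: framed_def)
  then show thesis by (rule that)
qed

lemma label_height_1_eq_0:
  assumes "excess (label_height z) 1 \<le> 0"
  shows "label_height z 1 = 0"
proof (rule ccontr)
  assume "\<not> ?thesis"
  then have "int b * 1 \<le> int b * int (label_height z 1)" by (intro mult_left_mono) auto
  moreover have "excess (label_height z) 1 = int b * int (label_height z 1) - int a"
    by (simp add: excess_def)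
  ultimately show False using assms a_less_b by linarith
qed

lemma obtain_minimum_before_N:
  assumes zeros: "zeros y \<noteq> {}"
  obtains q where "0 \<le> q" "q < int N"
    "\<And>m. m \<le> int N \<Longrightarrow> cyclic_excess N y (q + 1) \<le> cyclic_excess N y m"
proof -
  let ?C = "cyclic_excess N y" and ?n = "int b * int (card (zeros y))"
  have "?C (int N - (m + t * int N)) = ?C (int N - m) + t * (?n - int a)" for m t
    using cyclic_excess_add_N[of y "int N - m" "- t"] by (simp add: algebra_simps)
  then obtain r where r: "r < N" "\<And>m. 0 \<le> m \<Longrightarrow> ?C (int N - int r) \<le> ?C (int N - m)"
    using quasiperiodic_obtain_argmin[OF N_pos, of "\<lambda>m. ?C (int N - m)" "?n - int a"]
      a_less_b_mult_card_zeros[OF zeros] by auto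
  have "?C (int N - int r - 1 + 1) \<le> ?C m" if "m \<le> int N" for m
    using r(2)[of "int N - m"] that by simp
  then show thesis using r(1) by (intro that[of "int N - int r - 1"]) auto
qed

lemma framed_rotation_at_minimum:
  assumes y: "y \<in> {1..a} \<rightarrow>\<^sub>E {0..N}" and zeros: "zeros y \<noteq> {}" and q: "0 \<le> q" "q < int N"
    and min: "\<And>m. m \<le> int N \<Longrightarrow> cyclic_excess N y (q + 1) \<le> cyclic_excess N y m"
  shows "framed (rotate_labels N (- q) y)"
proof -
  let ?C = "cyclic_excess N y"
  define z where "z = rotate_labels N (- q) y"
  have z: "z \<in> {1..a} \<rightarrow>\<^sub>E {0..N}" unfolding z_def by (rule rotate_labels_range[OF N_pos])
  have excess_z: "excess (label_height z) m = ?C (int m + q) - ?C q" if "m \<le> N" for m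
    unfolding cyclic_excess_of_nat[OF z that, symmetric]
    by (simp add: z_def cyclic_excess_rotate_labels[OF N_pos])
  then have excess_1: "excess (label_height z) 1 = ?C (q + 1) - ?C q"
    using excess_z[of 1] N_pos by (simp add: add.commute)
  then have no_1: "label_height z 1 = 0" using min[of q] q by (intro label_height_1_eq_0) simp
  then have C_q: "?C (q + 1) = ?C q - int a" using excess_1 by (simp add: excess_def)
  have "0 \<le> excess (label_height (zeros_to_ones z)) m" if m: "m \<le> N" for m
  proof (cases "m = 0")
    case False
    have "?C (q + 1) + int a - int b * int (card (zeros y)) \<le> ?C (int m + q)"
    proof (cases "int m + q \<le> int N")
      case True
      then show ?thesis using min[of "int m + q"] a_less_b_mult_card_zeros[OF zeros] by simp
    next
      case False
      then show ?thesis
        using min[of "int m + q - int N"] cyclic_excess_add_N[of y "int m + q - int N" 1] m q by simp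
    qed
    then have "0 \<le> excess (label_height z) m + int b * int (card (zeros y))"
      using excess_z[OF m] C_q by simp
    then show ?thesis
      using excess_zeros_to_ones[OF z, of m] cyclic_excess_of_nat[OF z m] False m by (simp add: z_def)
  qed (simp add: excess_def)
  moreover have "1 \<notin> z ` {1..a}" using no_1 by (auto simp: label_height_def)
  ultimately show ?thesis
    using z zeros_to_ones_range[OF z] by (simp add: framed_def parking_def flip: z_def)
qed

definition represents :: "(nat \<Rightarrow> nat) \<Rightarrow> (nat \<Rightarrow> nat) \<Rightarrow> bool" where
  "represents y x \<longleftrightarrow> x \<in> parking \<and>
    (\<forall>k\<in>{1..a}. \<forall>i. in_labelled_block y k i \<longleftrightarrow> cyclic_leader x i = x k)"

lemma represents_parking: "represents y x \<Longrightarrow> x \<in> parking"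
  by (simp add: represents_def)

lemma represents_unique: "represents y x \<Longrightarrow> represents y x' \<Longrightarrow> x = x'"
  by (rule parking_eqI) (auto simp: represents_def)

lemma framed_represents: "framed y \<Longrightarrow> represents y (zeros_to_ones y)"
  using in_labelled_block_framed by (simp add: represents_def framed_def)

lemma represents_rotate:
  assumes "represents y x"
  shows "represents (rotate_labels N (int t) y) ((rotate_parking ^^ t) x)"
  using assms funpow_rotate_parking_in_parking
  by (simp add: represents_def in_labelled_block_rotate_labels cyclic_leader_funpow_eq_value_iff)

lemma represents_comp:
  assumes "w permutes {1..a}" "represents y x"
  shows "represents (y \<circ> w) (x \<circ> w)"
  using assms permutes_in_image[OF assms(1)] parking_comp[OF assms(1)]
  by (simp add: represents_def in_labelled_block_comp cyclic_leader_comp)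

lemma obtain_represented_parking:
  assumes y: "y \<in> {1..a} \<rightarrow>\<^sub>E {0..N}"
  obtains x where "represents y x"
proof -
  obtain s where s: "framed (rotate_labels N s y)"
    using obtain_framed_rotation[OF y] framed_rotation_at_minimum[OF y] obtain_minimum_before_N by metis
  obtain t where "int N dvd int t - (- s)" using obtain_nat_cong[OF N_pos] .
  then have "rotate_labels N (int t) (rotate_labels N s y) = y"
    using y by (simp add: rotate_labels_add[OF N_pos] rotate_labels_multiple)
  then show thesis using represents_rotate[OF framed_represents[OF s], of t] that by simp
qed

end

subsection \<open>Uniqueness of labellings with given blocks\<close>

context rational_slope
begin

lemma represents_in_block_of_label:
  assumes rep: "represents y x" and y: "y \<in> {1..a} \<rightarrow>\<^sub>E {0..N}" and k: "k \<in> {1..a}" "y k \<noteq> 0"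
  shows "cyclic_leader x (int (y k)) = x k"
proof -
  obtain v where v: "y k = Suc v" using k(2) by (cases "y k") auto
  have "Suc v \<le> N" using y k v by (metis PiE_mem atLeastAtMost_iff)
  have "0 < card {j \<in> {1..a}. y j = Suc v}" using k(1) v by (auto simp: card_gt_0_iff)
  then have "int b * 1 \<le> int b * (int (label_height y (Suc v)) - int (label_height y v))"
    using label_height_step[of "Suc v" y] by (intro mult_left_mono) auto
  then have "int a < int b * (int (label_height y (Suc v)) - int (label_height y v))"
    using a_less_b by linarith
  then have "cyclic_excess N y (int v) < cyclic_excess N y (int (Suc v))"
    using cyclic_excess_of_nat[OF y, of "Suc v"] cyclic_excess_of_nat[OF y, of v] \<open>Suc v \<le> N\<close>
    by (simp add: excess_Suc)
  then have "cyclic_parent y (int v) (int (Suc v))" by (simp add: cyclic_parent_def)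
  then have "in_labelled_block y k (int (y k))"
    unfolding in_labelled_block_def v by (auto intro!: exI[of _ "int v"])
  then show ?thesis using rep k(1) by (simp add: represents_def)
qed

lemma represents_no_parent_iff:
  assumes "represents y x" "k \<in> {1..a}" "y k = 0"
  shows "(\<nexists>p. cyclic_parent y p i) \<longleftrightarrow> cyclic_leader x i = x k"
proof -
  have "in_labelled_block y k i \<longleftrightarrow> cyclic_leader x i = x k"
    using assms(1,2) by (simp add: represents_def)
  then show ?thesis using assms(3) by (simp add: in_labelled_block_def)
qed

lemma represents_zero_iff:
  assumes rep: "represents y x" and k: "k \<in> {1..a}" "k' \<in> {1..a}" "y k = 0"
  shows "y k' = 0 \<longleftrightarrow> x k' = x k"
proof
  assume "y k' = 0"
  then have "cyclic_leader x (int (x k)) = x k' \<longleftrightarrow> cyclic_leader x (int (x k)) = x k"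
    using represents_no_parent_iff[OF rep] k by metis
  then show "x k' = x k" using cyclic_leader_value[OF represents_parking[OF rep] k(1)] by simp
next
  assume eq: "x k' = x k"
  have leader: "cyclic_leader x (int (x k)) = x k"
    by (rule cyclic_leader_value[OF represents_parking[OF rep] k(1)])
  then have "\<nexists>p. cyclic_parent y p (int (x k))" using represents_no_parent_iff[OF rep k(1,3)] by simp
  moreover have "in_labelled_block y k' (int (x k))"
    using leader eq rep k(2) by (simp add: represents_def)
  ultimately show "y k' = 0" by (auto simp: in_labelled_block_def split: if_splits)
qed

text \<open>Going backwards from the start of a block, one meets the block labelled \<open>0\<close> first.\<close>

lemma labelled_block_avoids_gap:
  assumes block: "in_labelled_block y k j" and label: "y k \<noteq> 0"
    and c: "\<nexists>p. cyclic_parent y p c" "int (y k) - int N \<le> c"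
    and j: "c < j" "j < int (y k)"
  shows False
proof -
  obtain p where p: "int N dvd p + 1 - int (y k)" "cyclic_parent y p j"
    using block label by (auto simp: in_labelled_block_def)
  have "p + 1 < int (y k)" using p(2) j by (simp add: cyclic_parent_def)
  then have "int N \<le> int (y k) - (p + 1)"
    using p(1) by (intro zdvd_imp_le) (simp_all add: dvd_diff_commute)
  then have "p < c" using c(2) by simp
  moreover from this have "cyclic_excess N y p < cyclic_excess N y c"
    using p(2) j(1) by (auto simp: cyclic_parent_def)
  ultimately show False using obtain_cyclic_parent[of p c y] c(1) by blast
qed

lemma represents_common_zero_le:
  assumes rep: "represents y x" "represents y' x"
    and y: "y \<in> {1..a} \<rightarrow>\<^sub>E {0..N}" "y' \<in> {1..a} \<rightarrow>\<^sub>E {0..N}"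
    and k0: "k0 \<in> {1..a}" "y k0 = 0" "y' k0 = 0" and k: "k \<in> {1..a}"
  shows "y' k \<le> y k"
proof (rule ccontr)
  assume less: "\<not> ?thesis"
  then have "y' k \<noteq> 0" by simp
  moreover have "y k = 0 \<longleftrightarrow> y' k = 0"
    using represents_zero_iff[OF rep(1) k0(1) k k0(2)] represents_zero_iff[OF rep(2) k0(1) k k0(3)]
    by simp
  ultimately have nonzero: "y k \<noteq> 0" "y' k \<noteq> 0" by simp_all
  then have "x k \<noteq> x k0" using represents_zero_iff[OF rep(1) k0(1) k k0(2)] by simp
  have in_block: "in_labelled_block z k i \<longleftrightarrow> cyclic_leader x i = x k" if "represents z x" for z i
    using that k by (simp add: represents_def)
  have y_block: "cyclic_leader x (int (y k)) = x k" and y'_block: "cyclic_leader x (int (y' k)) = x k"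
    using represents_in_block_of_label rep y k nonzero by blast+
  define c where "c = int (y' k) - int N + (int (x k0) - int (y' k)) mod int N"
  have c: "int (y' k) - int N \<le> c" "c < int (y' k)" using N_pos by (auto simp: c_def)
  have "int (x k0) - c
      = int N + ((int (x k0) - int (y' k)) - (int (x k0) - int (y' k)) mod int N)" by (simp add: c_def)
  then have "int N dvd int (x k0) - c" by (simp only: dvd_add_triv_left_iff dvd_minus_mod)
  then have leader_c: "cyclic_leader x c = x k0" "cyclic_leader x (c - int N) = x k0"
    using cyclic_leader_value[OF represents_parking[OF rep(1)] k0(1)]
      cyclic_leader_cong[of "int (x k0)" c x] cyclic_leader_cong[of c "c - int N" x] by simp_all
  have "\<not> c < int (y k)"
  proof
    assume "c < int (y k)"
    then show False
      using less y_block leader_c(1) in_block[OF rep(2)] c(1) nonzero(2)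
        represents_no_parent_iff[OF rep(2) k0(1,3)]
      by (intro labelled_block_avoids_gap[of y' k "int (y k)" c]) auto
  qed
  moreover have "c \<noteq> int (y k)" using leader_c(1) y_block \<open>x k \<noteq> x k0\<close> by auto
  moreover have "cyclic_leader x (int (y' k) - int N) = x k"
    using y'_block cyclic_leader_cong[of "int (y' k)" "int (y' k) - int N" x] by simp
  moreover have "y' k \<le> N" using y(2) k by auto
  ultimately show False
    using leader_c(2) in_block[OF rep(1)] represents_no_parent_iff[OF rep(1) k0(1,2)] c(2) nonzero(1)
    by (intro labelled_block_avoids_gap[of y k "int (y' k) - int N" "c - int N"]) auto
qed

lemma represents_common_zero_unique:
  assumes "represents y x" "represents y' x" "y \<in> {1..a} \<rightarrow>\<^sub>E {0..N}" "y' \<in> {1..a} \<rightarrow>\<^sub>E {0..N}"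
    and "k0 \<in> {1..a}" "y k0 = 0" "y' k0 = 0"
  shows "y = y'"
proof (rule PiE_ext[OF assms(3,4)])
  fix k assume "k \<in> {1..a}"
  then show "y k = y' k"
    using assms represents_common_zero_le[of y x y' k0 k] represents_common_zero_le[of y' x y k0 k]
    by (intro order_antisym)
qed

definition short_blocks :: "nat \<Rightarrow> (nat \<Rightarrow> nat) \<Rightarrow> bool" where
  "short_blocks e y \<longleftrightarrow> (\<forall>p m. cyclic_parent y p m \<longrightarrow> m \<le> p + int e)"

lemma short_blocks_rotate_labels:
  assumes "short_blocks e y"
  shows "short_blocks e (rotate_labels N s y)"
  unfolding short_blocks_def cyclic_parent_rotate_labels
proof (intro allI impI)
  fix p m assume "cyclic_parent y (p - s) (m - s)"
  then have "m - s \<le> p - s + int e" using assms unfolding short_blocks_def by blast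
  then show "m \<le> p + int e" by simp
qed

lemma short_blocks_comp: "w permutes {1..a} \<Longrightarrow> short_blocks e (y \<circ> w) \<longleftrightarrow> short_blocks e y"
  by (simp add: short_blocks_def cyclic_parent_def cyclic_excess_comp)

lemma represents_short_le:
  assumes rep: "represents y x" "represents y' x"
    and y: "y \<in> {1..a} \<rightarrow>\<^sub>E {0..N}" "y' \<in> {1..a} \<rightarrow>\<^sub>E {0..N}"
    and short: "short_blocks e y" "short_blocks e y'" and e: "2 * e \<le> N"
    and k: "k \<in> {1..a}" and nonzero: "y k \<noteq> 0" "y' k \<noteq> 0"
  shows "y' k \<le> y k"
proof (rule ccontr)
  assume less: "\<not> ?thesis"
  have "cyclic_leader x (int (y' k)) = x k" "cyclic_leader x (int (y k)) = x k"
    using represents_in_block_of_label rep y k nonzero by blast+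
  then have "in_labelled_block y k (int (y' k))" "in_labelled_block y' k (int (y k))"
    using rep k by (simp_all add: represents_def)
  then obtain p p' where p: "int N dvd p + 1 - int (y k)" "cyclic_parent y p (int (y' k))"
    and p': "int N dvd p' + 1 - int (y' k)" "cyclic_parent y' p' (int (y k))"
    using nonzero by (auto simp: in_labelled_block_def)
  have p_bounds: "p < int (y' k)" "int (y' k) \<le> p + int e"
    and p'_bounds: "p' < int (y k)" "int (y k) \<le> p' + int e"
    using p(2) p'(2) short by (auto simp: cyclic_parent_def short_blocks_def)
  have "y' k \<le> N" using y(2) k by auto
  then have "p + 1 = int (y k)"
    using p_bounds less e p(1) nonzero(1) by (intro dvd_diff_imp_eq_int[of "int N"]) auto
  have "p' + 1 < int (y' k)" using p'_bounds less by simp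
  then have "int N \<le> int (y' k) - (p' + 1)"
    using p'(1) by (intro zdvd_imp_le) (simp_all add: dvd_diff_commute)
  then show False using \<open>p + 1 = int (y k)\<close> p_bounds p'_bounds e by simp
qed

lemma represents_short_unique:
  assumes rep: "represents y x" "represents y' x"
    and y: "y \<in> {1..a} \<rightarrow>\<^sub>E {0..N}" "y' \<in> {1..a} \<rightarrow>\<^sub>E {0..N}"
    and short: "short_blocks e y" "short_blocks e y'" and e: "2 * e \<le> N"
    and nonzero: "zeros y = {}" "zeros y' = {}"
  shows "y = y'"
proof (rule PiE_ext[OF y])
  fix k assume k: "k \<in> {1..a}"
  then have "y k \<noteq> 0" "y' k \<noteq> 0" using nonzero by (auto simp: zeros_def)
  then show "y k = y' k"
    using represents_short_le[OF rep y short e k] represents_short_le[OF rep(2,1) y(2,1) short(2,1) e k]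
    by (intro order_antisym)
qed

end

subsection \<open>Blocks that are periodic under rotation\<close>

lemma periodic_multiple:
  fixes Q :: "int \<Rightarrow> 'a"
  assumes "\<And>i. Q (i + d) = Q i"
  shows "Q (i + t * d) = Q i"
proof (induction t rule: int_induct[of _ 0])
  case (step1 t)
  then show ?case using assms[of "i + t * d"] by (simp add: algebra_simps)
next
  case (step2 t)
  then show ?case using assms[of "i + (t - 1) * d"] by (simp add: algebra_simps)
qed simp

lemma periodic_gcd:
  fixes Q :: "int \<Rightarrow> 'a"
  assumes "\<And>i. Q (i + d) = Q i" "\<And>i. Q (i + n) = Q i"
  shows "Q (i + gcd d n) = Q i"
proof -
  obtain u v where "u * d + v * n = gcd d n" using bezout_int by blast
  then have "Q (i + gcd d n) = Q ((i + u * d) + v * n)" by (simp add: add.assoc)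
  then show ?thesis by (simp add: periodic_multiple assms)
qed

context rational_slope
begin

definition block_periodic :: "nat \<Rightarrow> (nat \<Rightarrow> nat) \<Rightarrow> bool" where
  "block_periodic e x \<longleftrightarrow>
    (\<forall>i j. cyclic_leader x (i + int e) = cyclic_leader x (j + int e) \<longleftrightarrow>
      cyclic_leader x i = cyclic_leader x j)"

lemma block_periodic_multiple:
  assumes "block_periodic e x"
  shows "cyclic_leader x (i + t * int e) = cyclic_leader x (j + t * int e) \<longleftrightarrow>
    cyclic_leader x i = cyclic_leader x j"
  using periodic_multiple[of "\<lambda>m. cyclic_leader x (i + m) = cyclic_leader x (j + m)" "int e" 0 t] assms
  by (simp add: block_periodic_def add.assoc[symmetric])

lemma central_block_multiple:
  assumes periodic: "block_periodic e x" and s: "cyclic_leader x s = cyclic_leader x (s + int e)"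
  shows "cyclic_leader x (s + t * int e) = cyclic_leader x s"
proof -
  have "cyclic_leader x (s + u * int e + int e) = cyclic_leader x (s + u * int e)" for u
    using block_periodic_multiple[OF periodic, of s u "s + int e"] s by (simp add: algebra_simps)
  then have "cyclic_leader x (s + (u + 1) * int e) = cyclic_leader x (s + u * int e)" for u
    by (simp add: algebra_simps)
  then show ?thesis using periodic_multiple[of "\<lambda>u. cyclic_leader x (s + u * int e)" 1 0 t] by simp
qed

lemma central_block_unique:
  assumes x: "x \<in> parking" and periodic: "block_periodic e x" and e: "0 < e" "2 * e \<le> N"
    and s: "cyclic_leader x s = cyclic_leader x (s + int e)"
    and t: "cyclic_leader x t = cyclic_leader x (t + int e)"
  shows "cyclic_leader x s = cyclic_leader x t"
proof -
  define r where "r = s + (t - s) mod int e"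
  have "r = t + (- ((t - s) div int e)) * int e"
    using div_mult_mod_eq[of "t - s" "int e"] by (simp add: r_def algebra_simps)
  then have r_t: "cyclic_leader x r = cyclic_leader x t"
    using central_block_multiple[OF periodic t, of "- ((t - s) div int e)"] by simp
  have "r + int e = t + (1 - (t - s) div int e) * int e"
    using div_mult_mod_eq[of "t - s" "int e"] by (simp add: r_def algebra_simps)
  then have r_e: "cyclic_leader x (r + int e) = cyclic_leader x r"
    using central_block_multiple[OF periodic t, of "1 - (t - s) div int e"] r_t by simp
  have "s \<le> r" "r < s + int e" using e(1) by (auto simp: r_def)
  then have "cyclic_leader x s = cyclic_leader x r"
    using cyclic_leader_noncrossing[OF x, of s r "s + int e" "r + int e"] s r_e e(2)
    by (cases "r = s") auto
  then show ?thesis using r_t by simp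
qed

context
  fixes x :: "nat \<Rightarrow> nat" and e :: nat
  assumes x: "x \<in> parking" and periodic: "block_periodic e x" and e: "0 < e" "2 * e \<le> N"
    and no_central_block: "\<And>t. cyclic_leader x t \<noteq> cyclic_leader x (t + int e)"
begin

lemma block_cyclic_width:
  assumes ij: "i < j" "j < i + int N" "cyclic_leader x i = cyclic_leader x j"
  shows "j - i < int e \<or> int N - int e < j - i"
proof (rule ccontr)
  assume wide: "\<not> ?thesis"
  have "j \<noteq> i + int e" using no_central_block[of i] ij(3) by auto
  moreover have "j - i \<noteq> int N - int e"
  proof
    assume "j - i = int N - int e"
    then have "cyclic_leader x (j + int e) = cyclic_leader x i"
      by (intro cyclic_leader_cong) (simp add: algebra_simps)
    then show False using no_central_block[of j] ij(3) by simp
  qed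
  moreover have "cyclic_leader x (i + int e) = cyclic_leader x (j + int e)"
    using periodic ij(3) by (simp add: block_periodic_def)
  ultimately have "cyclic_leader x i = cyclic_leader x (i + int e)"
    using cyclic_leader_noncrossing[OF x, of i "i + int e" j "j + int e"] ij e wide by auto
  then show False using no_central_block by simp
qed

lemma obtain_longest_related_pair:
  obtains t u where "t \<le> u" "u < t + int e" "cyclic_leader x t = cyclic_leader x u"
    "\<And>i j. i \<le> j \<Longrightarrow> j < i + int e \<Longrightarrow> cyclic_leader x i = cyclic_leader x j \<Longrightarrow> j - i \<le> u - t"
proof -
  define L where "L = {n. n < e \<and> (\<exists>i. cyclic_leader x i = cyclic_leader x (i + int n))}"
  have "finite L" by (simp add: L_def)
  have "0 \<in> L" using e by (simp add: L_def)
  then have "Max L \<in> L" using \<open>finite L\<close> Max_in by blast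
  then obtain t where t: "Max L < e" "cyclic_leader x t = cyclic_leader x (t + int (Max L))"
    by (auto simp: L_def)
  have "j - i \<le> int (Max L)"
    if "i \<le> j" "j < i + int e" "cyclic_leader x i = cyclic_leader x j" for i j
  proof -
    have "nat (j - i) \<in> L" using that by (auto simp: L_def intro!: exI[of _ i])
    then have "nat (j - i) \<le> Max L" using \<open>finite L\<close> by simp
    then show ?thesis by simp
  qed
  then show thesis using that[of t "t + int (Max L)"] t by simp
qed

text \<open>A cut at the start of a longest related pair at distance less than \<open>e\<close> separates no other such
  pair: a pair straddling it would, with its translate by \<open>e\<close>, contradict the absence of crossings.\<close>

lemma longest_related_pair_cut:
  assumes tu: "t \<le> u" "u < t + int e" "cyclic_leader x t = cyclic_leader x u"
    and longest: "\<And>i j. i \<le> j \<Longrightarrow> j < i + int e \<Longrightarrow> cyclic_leader x i = cyclic_leader x j \<Longrightarrow> j - i \<le> u - t"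
    and ij: "i < t" "t \<le> j" "j < i + int e"
  shows "cyclic_leader x i \<noteq> cyclic_leader x j"
proof
  assume eq: "cyclic_leader x i = cyclic_leader x j"
  then have "j < u" using longest[of i j] ij by simp
  have i_t: "cyclic_leader x i = cyclic_leader x t"
  proof (cases "j = t")
    case False
    then show ?thesis
      using cyclic_leader_noncrossing[OF x, of i t j u] ij \<open>j < u\<close> eq tu e by auto
  qed (use eq in simp)
  have "\<not> u < i + int e" using longest[of i u] i_t tu ij by auto
  moreover have "u \<noteq> i + int e" using no_central_block[of i] i_t tu(3) by auto
  ultimately have "i + int e < u" by simp
  have i_t': "cyclic_leader x (i + int e) = cyclic_leader x (t + int e)"
    using periodic i_t by (simp add: block_periodic_def)
  then have "cyclic_leader x t = cyclic_leader x (i + int e)"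
    using cyclic_leader_noncrossing[OF x, of t "i + int e" u "t + int e"] tu \<open>i + int e < u\<close> ij e
    by auto
  then show False using i_t' no_central_block[of t] by simp
qed

lemma obtain_cut_between_blocks:
  obtains t where "\<And>i j. t \<le> i \<Longrightarrow> i \<le> j \<Longrightarrow> j < t + int N \<Longrightarrow>
    cyclic_leader x i = cyclic_leader x j \<Longrightarrow> j < i + int e"
proof -
  obtain t u where tu: "t \<le> u" "u < t + int e" "cyclic_leader x t = cyclic_leader x u"
    and longest: "\<And>i j. i \<le> j \<Longrightarrow> j < i + int e \<Longrightarrow> cyclic_leader x i = cyclic_leader x j \<Longrightarrow> j - i \<le> u - t"
    using obtain_longest_related_pair by blast
  have "j < i + int e"
    if ij: "t \<le> i" "i \<le> j" "j < t + int N" "cyclic_leader x i = cyclic_leader x j" for i j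
  proof (rule ccontr)
    assume "\<not> ?thesis"
    then have "int N - int e < j - i" using block_cyclic_width[of i j] ij e by auto
    have "cyclic_leader x (j - int N) = cyclic_leader x i"
      using cyclic_leader_cong[of "j - int N" j x] ij(4) by simp
    moreover have "cyclic_leader x (j - int N) \<noteq> cyclic_leader x i"
      using ij(1-3) \<open>int N - int e < j - i\<close> by (intro longest_related_pair_cut[OF tu longest]) simp_all
    ultimately show False by simp
  qed
  then show thesis by (rule that)
qed

end

end

subsection \<open>Labellings and parking functions fixed by a rotation\<close>

context rational_slope
begin

definition ones_to_zeros :: "(nat \<Rightarrow> nat) \<Rightarrow> nat \<Rightarrow> nat" where
  "ones_to_zeros x = (\<lambda>k\<in>{1..a}. if x k = 1 then 0 else x k)"

lemma zeros_to_ones_to_zeros: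
  assumes x: "x \<in> parking"
  shows "zeros_to_ones (ones_to_zeros x) = x"
proof (rule extensionalityI[OF _ parking_extensional[OF x]])
  fix k assume k: "k \<in> {1..a}"
  then show "zeros_to_ones (ones_to_zeros x) k = x k"
    using parking_in_range[OF x k] by (simp add: zeros_to_ones_def ones_to_zeros_def)
qed (simp add: zeros_to_ones_def)

lemma framed_ones_to_zeros: "x \<in> parking \<Longrightarrow> framed (ones_to_zeros x)"
  using zeros_to_ones_to_zeros[of x] parking_in_range[of x] by (auto simp: framed_def ones_to_zeros_def)

lemma parking_framed:
  assumes x: "x \<in> parking"
  shows "framed x" "zeros x = {}" "zeros_to_ones x = x"
proof -
  show zeros: "zeros x = {}" using parking_in_range[OF x] by (force simp: zeros_def)
  have range: "x \<in> {1..a} \<rightarrow>\<^sub>E {0..N}" using x by (auto simp: parking_def PiE_iff)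
  then show "zeros_to_ones x = x" using zeros by (rule zeros_to_ones_trivial)
  then show "framed x" using x zeros range by (simp add: framed_def)
qed

definition narrow_blocks :: "nat \<Rightarrow> (nat \<Rightarrow> nat) \<Rightarrow> bool" where
  "narrow_blocks e x \<longleftrightarrow> (\<forall>i\<in>{1..N}. \<forall>j\<in>{1..N}.
    cyclic_leader x (int i) = cyclic_leader x (int j) \<longrightarrow> i \<le> j \<longrightarrow> j < i + e)"

lemma parking_short_blocks:
  assumes x: "x \<in> parking" and narrow: "narrow_blocks e x"
  shows "short_blocks e x"
  unfolding short_blocks_def
proof (intro allI impI)
  fix p i assume parent: "cyclic_parent x p i"
  interpret path_heights a b N "label_height x" by (rule path_heights_parking[OF x])
  define m where "m = residue N i"
  have m: "m \<in> {1..N}" unfolding m_def by (rule residue_in_range[OF N_pos])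
  obtain q where q: "leader (label_height x) m = Suc q" by (simp add: leader_def)
  have "cyclic_parent x (int q) (int m)"
    using cyclic_parent_of_parent[OF parking_framed(1)[OF x] m _] q parking_framed(2,3)[OF x]
    by (simp add: leader_def)
  moreover have "rotate_labels N (int m - i) x = x"
    using parking_framed(1)[OF x] dvd_residue_diff[OF N_pos, of i]
    by (intro rotate_labels_multiple) (simp_all add: framed_def m_def)
  then have "cyclic_parent x (p + int m - i) (int m)"
    using cyclic_parent_rotate_labels[of "int m - i" x "p + int m - i" "int m"] parent by simp
  ultimately have p: "p + int m - i = int q" using cyclic_parent_unique by blast
  have range: "Suc q \<in> {1..N}" "Suc q \<le> m" using leader_in_range[OF m] leader_le[OF m] q by auto
  have "cyclic_leader x (int (Suc q)) = cyclic_leader x (int m)"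
    using leader_leader[OF m] q by (simp only: cyclic_leader_of_nat m range)
  then have "m < Suc q + e" using narrow m range unfolding narrow_blocks_def by blast
  then show "i \<le> p + int e" using p by linarith
qed

context
  fixes w :: "nat \<Rightarrow> nat" and d e :: nat
  assumes w: "w permutes {1..a}" and not_dvd: "\<not> N dvd d" and e_def: "e = gcd d N"
begin

abbreviation (input) fixed_parking :: "(nat \<Rightarrow> nat) \<Rightarrow> bool" where
  "fixed_parking x \<equiv> x \<in> parking \<and> (rotate_parking ^^ d) x = x \<circ> w"

abbreviation (input) fixed_labelling :: "(nat \<Rightarrow> nat) \<Rightarrow> bool" where
  "fixed_labelling y \<equiv> y \<in> {1..a} \<rightarrow>\<^sub>E {0..N} \<and> y \<circ> w = rotate_labels N (int d) y"

lemma period_pos: "0 < e"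
  using N_pos by (simp add: e_def)

lemma period_dvd: "e dvd N" "e dvd d"
  by (simp_all add: e_def)

lemma period_le_half: "2 * e \<le> N"
proof -
  obtain q where q: "N = e * q" using period_dvd by blast
  have "e \<noteq> N" using not_dvd period_dvd by auto
  then have "q \<noteq> 1" "q \<noteq> 0" using q N_pos by auto
  then have "e * 2 \<le> e * q" by (intro mult_le_mono) auto
  then show ?thesis using q by simp
qed

lemma periodic_period:
  fixes Q :: "int \<Rightarrow> 'b"
  assumes "\<And>i. Q (i + int d) = Q i" "\<And>i. Q (i + int N) = Q i"
  shows "Q (i + int e) = Q i"
  using periodic_gcd[of Q "int d" "int N" i] assms by (simp add: e_def)

lemma fixed_parking_block_periodic:
  assumes x: "fixed_parking x"
  shows "block_periodic e x"
  unfolding block_periodic_def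
proof (intro allI)
  fix i j
  have "cyclic_leader x (i + (m + int d)) = cyclic_leader x (j + (m + int d)) \<longleftrightarrow>
      cyclic_leader x (i + m) = cyclic_leader x (j + m)" for m
    using cyclic_leader_funpow_eq_iff[of x d "i + (m + int d)" "j + (m + int d)"] x
    by (simp add: cyclic_leader_comp[OF w] add.assoc[symmetric])
  moreover have "cyclic_leader x (l + (m + int N)) = cyclic_leader x (l + m)" for l m
    by (rule cyclic_leader_cong) simp
  ultimately show "cyclic_leader x (i + int e) = cyclic_leader x (j + int e) \<longleftrightarrow>
      cyclic_leader x i = cyclic_leader x j"
    using periodic_period[of "\<lambda>m. cyclic_leader x (i + m) = cyclic_leader x (j + m)" 0] by simp
qed

lemma fixed_parking_funpow: "fixed_parking x \<Longrightarrow> fixed_parking ((rotate_parking ^^ t) x)"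
proof -
  assume x: "fixed_parking x"
  have "(rotate_parking ^^ d) ((rotate_parking ^^ t) x)
      = (rotate_parking ^^ t) ((rotate_parking ^^ d) x)"
    by (simp only: funpow_add[symmetric, unfolded comp_def, THEN fun_cong] add.commute)
  then show "fixed_parking ((rotate_parking ^^ t) x)"
    using x by (simp add: funpow_rotate_parking_comp[OF w] funpow_rotate_parking_in_parking)
qed

lemma fixed_labelling_excess_add:
  assumes y: "fixed_labelling y"
  shows "cyclic_excess N y (m + int e) = cyclic_excess N y m + cyclic_excess N y (int e)"
proof -
  let ?C = "cyclic_excess N y"
  have "?C m = ?C (m - int d) - ?C (- int d)" for m
    using cyclic_excess_rotate_labels[OF N_pos, of "int d" y m] y cyclic_excess_comp[OF w, of N y]
    by simp
  from this[of "l + int d" for l] have shift_d: "?C (l + int d) = ?C l - ?C (- int d)" for l by simp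
  have shift_N: "?C (l + int N) = ?C l + (int a - int b * int (card (zeros y)))" for l
    using cyclic_excess_add_N[of y l 1] by simp
  have "?C (m + (0 + int e)) - ?C (0 + int e) = ?C (m + 0) - ?C 0"
  proof (rule periodic_period[of "\<lambda>l. ?C (m + l) - ?C l"])
    show "?C (m + (l + int d)) - ?C (l + int d) = ?C (m + l) - ?C l" for l
      using shift_d[of "m + l"] shift_d[of l] by (simp add: add.assoc)
    show "?C (m + (l + int N)) - ?C (l + int N) = ?C (m + l) - ?C l" for l
      using shift_N[of "m + l"] shift_N[of l] by (simp add: add.assoc)
  qed
  moreover have "?C 0 = 0" using cyclic_excess_of_nat[of y N 0] y by (simp add: excess_def)
  ultimately show ?thesis by simp
qed

lemma fixed_labelling_parent_add:
  "fixed_labelling y \<Longrightarrow> cyclic_parent y (p + int e) (m + int e) \<longleftrightarrow> cyclic_parent y p m"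
  by (rule cyclic_parent_translate[OF fixed_labelling_excess_add])

lemma fixed_labelling_short_blocks:
  assumes y: "fixed_labelling y" and zeros: "zeros y = {}"
  shows "short_blocks e y"
  unfolding short_blocks_def
proof (intro allI impI)
  let ?C = "cyclic_excess N y"
  fix p m assume parent: "cyclic_parent y p m"
  obtain q where q: "N = e * q" using period_dvd by blast
  have "?C (int e * int n) = int n * ?C (int e)" for n
  proof (induction n)
    case (Suc n)
    then show ?case
      using fixed_labelling_excess_add[OF y, of "int e * int n"] by (simp add: algebra_simps)
  qed (use cyclic_excess_of_nat[of y N 0] y in \<open>simp add: excess_def\<close>)
  from this[of q] have "?C (int N) = int q * ?C (int e)" by (simp add: q)
  moreover have "?C (int N) = int a"
    using cyclic_excess_add_N[of y 0 1] zeros cyclic_excess_of_nat[of y N 0] y by (simp add: excess_def)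
  ultimately have "0 < int q * ?C (int e)" using a_pos by simp
  then have "0 < ?C (int e)" by (simp add: zero_less_mult_iff)
  then have "?C (m - int e) < ?C m" using fixed_labelling_excess_add[OF y, of "m - int e"] by simp
  moreover have "?C m \<le> ?C (m - int e)" if "p < m - int e"
    using parent period_pos that by (simp add: cyclic_parent_def)
  ultimately show "m \<le> p + int e" by linarith
qed

lemma fixed_labelling_zero_block_central:
  assumes y: "fixed_labelling y" and rep: "represents y x" and k: "k \<in> {1..a}" "y k = 0"
  shows "cyclic_leader x (int (x k)) = cyclic_leader x (int (x k) + int e)"
proof -
  have leader: "cyclic_leader x (int (x k)) = x k"
    by (rule cyclic_leader_value[OF represents_parking[OF rep] k(1)])
  then have "\<nexists>p. cyclic_parent y p (int (x k))"
    using represents_no_parent_iff[OF rep k] by simp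
  then have "\<nexists>p. cyclic_parent y p (int (x k) + int e)"
    using fixed_labelling_parent_add[OF y, of "p - int e" "int (x k)" for p] by (metis diff_add_cancel)
  then show ?thesis using represents_no_parent_iff[OF rep k] leader by simp
qed

lemma fixed_labelling_no_central_block:
  assumes y: "fixed_labelling y" and rep: "represents y x" and zeros: "zeros y = {}"
  shows "cyclic_leader x t \<noteq> cyclic_leader x (t + int e)"
proof
  assume central: "cyclic_leader x t = cyclic_leader x (t + int e)"
  obtain k where k: "k \<in> {1..a}" "cyclic_leader x t = x k"
    using cyclic_leader_is_value[OF represents_parking[OF rep]] by blast
  have "y k \<noteq> 0" using zeros k(1) by (auto simp: zeros_def)
  moreover have "in_labelled_block y k t" "in_labelled_block y k (t + int e)"
    using rep k central by (simp_all add: represents_def)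
  ultimately obtain p p' where p: "int N dvd p + 1 - int (y k)" "cyclic_parent y p t"
    and p': "int N dvd p' + 1 - int (y k)" "cyclic_parent y p' (t + int e)"
    by (auto simp: in_labelled_block_def)
  have "p' = p + int e"
    using cyclic_parent_unique[OF p'(2)] fixed_labelling_parent_add[OF y] p(2) by blast
  then have "int N dvd int e" using dvd_diff[OF p'(1) p(1)] by simp
  then show False using period_pos period_le_half by (auto dest: dvd_imp_le)
qed

lemma represents_fixed:
  assumes y: "fixed_labelling y" and rep: "represents y x"
  shows "fixed_parking x"
proof -
  have "represents (y \<circ> w) ((rotate_parking ^^ d) x)"
    using represents_rotate[OF rep, of d] y by simp
  then have "(rotate_parking ^^ d) x = x \<circ> w"
    using represents_comp[OF w rep] by (rule represents_unique)
  then show ?thesis using represents_parking[OF rep] by simp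
qed

lemma fixed_labelling_zeros_iff:
  assumes y: "fixed_labelling y" and rep: "represents y x"
  shows "zeros y \<noteq> {} \<longleftrightarrow> (\<exists>t. cyclic_leader x t = cyclic_leader x (t + int e))"
proof
  assume "zeros y \<noteq> {}"
  then obtain k where "k \<in> {1..a}" "y k = 0" by (auto simp: zeros_def)
  then have "cyclic_leader x (int (x k)) = cyclic_leader x (int (x k) + int e)"
    by (rule fixed_labelling_zero_block_central[OF y rep])
  then show "\<exists>t. cyclic_leader x t = cyclic_leader x (t + int e)" by (rule exI)
qed (use fixed_labelling_no_central_block[OF y rep] in blast)

lemma fixed_labelling_unique:
  assumes y: "fixed_labelling y" "fixed_labelling y'" and rep: "represents y x" "represents y' x"
  shows "y = y'"
proof (cases "zeros y = {} \<and> zeros y' = {}")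
  case True
  then show ?thesis
    using represents_short_unique[OF rep] fixed_labelling_short_blocks y period_le_half by blast
next
  case False
  have x: "fixed_parking x" by (rule represents_fixed[OF y(1) rep(1)])
  have "zeros y \<noteq> {}" "zeros y' \<noteq> {}"
    using False fixed_labelling_zeros_iff[OF y(1) rep(1)] fixed_labelling_zeros_iff[OF y(2) rep(2)]
    by simp_all
  then obtain k k' where k: "k \<in> {1..a}" "y k = 0" and k': "k' \<in> {1..a}" "y' k' = 0"
    by (auto simp: zeros_def)
  have "cyclic_leader x (int (x k)) = cyclic_leader x (int (x k'))"
    by (rule central_block_unique[OF conjunct1[OF x] fixed_parking_block_periodic[OF x] period_pos
          period_le_half fixed_labelling_zero_block_central[OF y(1) rep(1) k]
          fixed_labelling_zero_block_central[OF y(2) rep(2) k']])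
  then have "x k = x k'"
    using cyclic_leader_value[of x k] cyclic_leader_value[of x k'] x k(1) k'(1) by simp
  then have "y' k = 0" using represents_zero_iff[OF rep(2) k'(1) k(1) k'(2)] by simp
  then show ?thesis using represents_common_zero_unique[OF rep _ _ k(1,2)] y by blast
qed

lemma ones_to_zeros_fixed_labelling:
  assumes x: "fixed_parking x" and central: "cyclic_leader x 1 = cyclic_leader x (1 + int e)"
  shows "fixed_labelling (ones_to_zeros x)" "represents (ones_to_zeros x) x"
proof -
  let ?y = "ones_to_zeros x"
  have parking: "x \<in> parking" using x by simp
  show rep: "represents ?y x"
    using framed_represents[OF framed_ones_to_zeros[OF parking]] zeros_to_ones_to_zeros[OF parking]
    by simp
  have y: "?y \<in> {1..a} \<rightarrow>\<^sub>E {0..N}"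
    using framed_ones_to_zeros[OF parking] by (simp add: framed_def)
  have "cyclic_leader x 1 = 1"
    using cyclic_leader_le[OF parking, of 1] N_pos by (simp add: cyclic_leader_def leader_def)
  then obtain k where k: "k \<in> {1..a}" "x k = 1" using cyclic_leader_is_value[OF parking, of 1] by metis
  obtain c where "d = e * c" using period_dvd by blast
  then have "cyclic_leader x (1 - int d) = 1"
    using central_block_multiple[OF fixed_parking_block_periodic[OF x] central, of "- int c"]
      \<open>cyclic_leader x 1 = 1\<close> by (simp add: algebra_simps)
  then have "cyclic_leader (x \<circ> w) 1 = (x \<circ> w) k"
    using cyclic_leader_funpow_eq_value_iff[OF parking k(1), of d 1] x k(2) by simp
  then have "x (w k) = 1" using \<open>cyclic_leader x 1 = 1\<close> by (simp add: cyclic_leader_comp[OF w])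
  then have zero: "(?y \<circ> w) k = 0" "rotate_labels N (int d) ?y k = 0"
    using k permutes_in_image[OF w] by (simp_all add: ones_to_zeros_def rotate_labels_apply)
  have "represents (rotate_labels N (int d) ?y) (x \<circ> w)"
    using represents_rotate[OF rep, of d] x by simp
  then have "?y \<circ> w = rotate_labels N (int d) ?y"
    using represents_common_zero_unique[OF represents_comp[OF w rep] _ PiE_comp_permutes[OF w y]
      rotate_labels_range[OF N_pos] k(1)] zero by blast
  then show "fixed_labelling ?y" using y by simp
qed

lemma narrow_parking_fixed_labelling:
  assumes x: "fixed_parking x" and narrow: "narrow_blocks e x"
  shows "fixed_labelling x" "represents x x"
proof -
  have parking: "x \<in> parking" using x by simp
  show rep: "represents x x"
    using framed_represents[OF parking_framed(1)] parking_framed(3) parking by metis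
  have range: "x \<in> {1..a} \<rightarrow>\<^sub>E {0..N}" using parking_framed(1)[OF parking] by (simp add: framed_def)
  have "short_blocks e x" by (rule parking_short_blocks[OF parking narrow])
  moreover have "zeros (x \<circ> w) = {}" using parking_framed(2)[OF parking_comp[OF w parking]] .
  moreover have "represents (rotate_labels N (int d) x) (x \<circ> w)"
    using represents_rotate[OF rep, of d] x by simp
  ultimately have "x \<circ> w = rotate_labels N (int d) x"
    using represents_short_unique[OF represents_comp[OF w rep] _ PiE_comp_permutes[OF w range]
      rotate_labels_range[OF N_pos] _ short_blocks_rotate_labels period_le_half]
      short_blocks_comp[OF w] parking_framed(2)[OF parking] by simp
  then show "fixed_labelling x" using range by simp
qed

lemma ex_fixed_labelling_rotated:
  assumes x: "fixed_parking x"
  shows "\<exists>s y. fixed_labelling y \<and> represents y ((rotate_parking ^^ s) x)"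
proof (cases "\<exists>t. cyclic_leader x t = cyclic_leader x (t + int e)")
  case True
  then obtain t where t: "cyclic_leader x t = cyclic_leader x (t + int e)" by blast
  obtain s where s: "int N dvd int s - (1 - t)" using obtain_nat_cong[OF N_pos] .
  have "cyclic_leader x (1 - int s) = cyclic_leader x t"
    "cyclic_leader x (1 + int e - int s) = cyclic_leader x (t + int e)"
    using s by (auto intro!: cyclic_leader_cong simp: dvd_diff_commute algebra_simps)
  then have "cyclic_leader ((rotate_parking ^^ s) x) 1
      = cyclic_leader ((rotate_parking ^^ s) x) (1 + int e)"
    using cyclic_leader_funpow_eq_iff[of x s 1 "1 + int e"] x t by simp
  then show ?thesis
    using ones_to_zeros_fixed_labelling[OF fixed_parking_funpow[OF x]] by blast
next
  case False
  then obtain t where t: "\<And>i j. t \<le> i \<Longrightarrow> i \<le> j \<Longrightarrow> j < t + int N \<Longrightarrow>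
      cyclic_leader x i = cyclic_leader x j \<Longrightarrow> j < i + int e"
    using obtain_cut_between_blocks[of x e] x fixed_parking_block_periodic[OF x] period_pos
      period_le_half by blast
  obtain s where s: "int N dvd int s - (1 - t)" using obtain_nat_cong[OF N_pos] .
  have shifted: "cyclic_leader x (int m - int s) = cyclic_leader x (t + int m - 1)" for m
    using s by (intro cyclic_leader_cong) (simp add: dvd_diff_commute algebra_simps)
  have "narrow_blocks e ((rotate_parking ^^ s) x)"
    unfolding narrow_blocks_def
  proof (intro ballI impI)
    fix i j assume "i \<in> {1..N}" "j \<in> {1..N}" "i \<le> j"
      and "cyclic_leader ((rotate_parking ^^ s) x) (int i)
        = cyclic_leader ((rotate_parking ^^ s) x) (int j)"
    then show "j < i + e"
      using t[of "t + int i - 1" "t + int j - 1"] x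
        cyclic_leader_funpow_eq_iff[of x s "int i" "int j"] by (simp add: shifted)
  qed
  then have "fixed_labelling ((rotate_parking ^^ s) x)"
    "represents ((rotate_parking ^^ s) x) ((rotate_parking ^^ s) x)"
    using narrow_parking_fixed_labelling[OF fixed_parking_funpow[OF x], of s] by blast+
  then show ?thesis by blast
qed

lemma obtain_fixed_labelling:
  assumes x: "fixed_parking x"
  obtains y where "fixed_labelling y" "represents y x"
proof -
  obtain s y where y: "fixed_labelling y" "represents y ((rotate_parking ^^ s) x)"
    using ex_fixed_labelling_rotated[OF x] by blast
  define t where "t = N * s - s"
  have t: "t + s = N * s" using N_pos by (simp add: t_def)
  have "(rotate_parking ^^ t) ((rotate_parking ^^ s) x) = (rotate_parking ^^ (t + s)) x"
    by (simp only: funpow_add comp_apply)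
  also have "\<dots> = x" using funpow_rotate_parking_N[of x "t + s"] x t by simp
  finally have "represents (rotate_labels N (int t) y) x" using represents_rotate[OF y(2), of t] by simp
  moreover have "rotate_labels N (int t) y \<circ> w = rotate_labels N (int d) (rotate_labels N (int t) y)"
    using y(1) rotate_labels_comp[OF w, of N "int t" y]
    by (simp add: rotate_labels_add[OF N_pos] add.commute)
  ultimately show thesis using that rotate_labels_range[OF N_pos] by blast
qed

lemma card_fixed_parking_eq_card_fixed_labelling:
  "card {x \<in> parking. (rotate_parking ^^ d) x = x \<circ> w} =
    card {y \<in> {1..a} \<rightarrow>\<^sub>E {0..N}. y \<circ> w = rotate_labels N (int d) y}"
proof -
  define parking_of where "parking_of y = (THE x. represents y x)" for y
  have parking_of: "parking_of y = x" if "represents y x" for x y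
    unfolding parking_of_def using that represents_unique by blast
  have "bij_betw parking_of {y. fixed_labelling y} {x. fixed_parking x}"
  proof (rule bij_betw_imageI)
    show "inj_on parking_of {y. fixed_labelling y}"
    proof (rule inj_onI)
      fix y y' assume y: "y \<in> {y. fixed_labelling y}" "y' \<in> {y. fixed_labelling y}"
        and eq: "parking_of y = parking_of y'"
      obtain x where x: "represents y x" using obtain_represented_parking[of y] y(1) by blast
      obtain x' where x': "represents y' x'" using obtain_represented_parking[of y'] y(2) by blast
      have "x' = x" using eq parking_of[OF x] parking_of[OF x'] by simp
      then show "y = y'" using y fixed_labelling_unique[of y y' x] x x' by simp
    qed
    show "parking_of ` {y. fixed_labelling y} = {x. fixed_parking x}"
    proof (intro subset_antisym subsetI)
      fix x assume "x \<in> parking_of ` {y. fixed_labelling y}"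
      then obtain y where y: "fixed_labelling y" "x = parking_of y" by blast
      obtain x' where x': "represents y x'" using obtain_represented_parking[of y] y(1) by blast
      then show "x \<in> {x. fixed_parking x}"
        using represents_fixed[OF y(1) x'] parking_of[OF x'] y(2) by simp
    next
      fix x assume "x \<in> {x. fixed_parking x}"
      then obtain y where "fixed_labelling y" "represents y x" using obtain_fixed_labelling by blast
      then show "x \<in> parking_of ` {y. fixed_labelling y}"
        using parking_of[of y x] by (intro image_eqI[of _ _ y]) simp_all
    qed
  qed
  then show ?thesis by (simp add: bij_betw_same_card)
qed

end

end

subsection \<open>Equivariant functions on a permuted set\<close>

lemma permutes_funpow_in: "w permutes S \<Longrightarrow> k \<in> S \<Longrightarrow> (w ^^ n) k \<in> S"
  by (induction n) (auto simp: permutes_in_image)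

definition cycle_min :: "('a::linorder \<Rightarrow> 'a) \<Rightarrow> 'a \<Rightarrow> 'a" where
  "cycle_min w j = Min (orbit w j)"

definition cycle_mins :: "('a::linorder \<Rightarrow> 'a) \<Rightarrow> 'a set \<Rightarrow> 'a set" where
  "cycle_mins w S = {t \<in> S. cycle_min w t = t}"

definition cycle_extend :: "('a::linorder \<Rightarrow> 'a) \<Rightarrow> ('b \<Rightarrow> 'b) \<Rightarrow> ('a \<Rightarrow> 'b) \<Rightarrow> 'a \<Rightarrow> 'b" where
  "cycle_extend w \<sigma> u j = (\<sigma> ^^ funpow_dist w (cycle_min w j) j) (u (cycle_min w j))"

definition cycle_fixed :: "('a \<Rightarrow> 'a) \<Rightarrow> ('b \<Rightarrow> 'b) \<Rightarrow> 'a \<Rightarrow> 'b set" where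
  "cycle_fixed w \<sigma> t = {v. \<forall>l. (w ^^ l) t = t \<longrightarrow> (\<sigma> ^^ l) v = v}"

definition equivariant_functions ::
  "('a \<Rightarrow> 'a) \<Rightarrow> 'a set \<Rightarrow> ('b \<Rightarrow> 'b) \<Rightarrow> 'b set \<Rightarrow> ('a \<Rightarrow> 'b) set" where
  "equivariant_functions w S \<sigma> A = {y \<in> S \<rightarrow>\<^sub>E A. \<forall>k\<in>S. y (w k) = \<sigma> (y k)}"

context
  fixes w :: "'a::linorder \<Rightarrow> 'a" and S :: "'a set"
  assumes S: "finite S" and w: "w permutes S"
begin

lemma permutation_w: "permutation w"
  using S w permutation_permutes by blast

lemma cycle_min_in_orbit: "cycle_min w j \<in> orbit w j"
  unfolding cycle_min_def
  by (intro Min_in finite_orbit permutation_self_in_orbit[OF permutation_w] orbit_nonempty)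

lemma in_orbit_cycle_min: "j \<in> orbit w (cycle_min w j)"
  by (rule orbit_swap[OF permutation_self_in_orbit[OF permutation_w] cycle_min_in_orbit])

lemma cycle_min_apply: "cycle_min w (w j) = cycle_min w j"
  by (simp add: cycle_min_def permutation_orbit_step[OF permutation_w])

lemma cycle_min_funpow: "cycle_min w ((w ^^ n) j) = cycle_min w j"
  by (induction n) (simp_all add: cycle_min_apply)

lemma cycle_min_in: "j \<in> S \<Longrightarrow> cycle_min w j \<in> S"
  using cycle_min_in_orbit permutes_orbit_subset[OF w] by blast

lemma cycle_min_is_min:
  assumes "j \<in> S"
  shows "cycle_min w j \<in> cycle_mins w S"
proof -
  obtain n where n: "cycle_min w j = (w ^^ n) j"
    using cycle_min_in_orbit[of j] by (auto simp: orbit_altdef)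
  then have "cycle_min w (cycle_min w j) = cycle_min w j" using cycle_min_funpow[of n j] by simp
  then show ?thesis using cycle_min_in[OF assms] by (simp add: cycle_mins_def)
qed

lemma cycle_min_le: "cycle_min w j \<le> (w ^^ n) j"
  unfolding cycle_min_def
  by (intro Min_le finite_orbit permutation_self_in_orbit[OF permutation_w] funpow_in_orbit)

lemma funpow_from_cycle_min: "(w ^^ funpow_dist w (cycle_min w j) j) (cycle_min w j) = j"
  by (rule funpow_dist_prop[OF in_orbit_cycle_min])

lemma cycle_fixed_funpow_eq:
  assumes v: "v \<in> cycle_fixed w \<sigma> t" and eq: "(w ^^ n) t = (w ^^ m) t"
  shows "(\<sigma> ^^ n) v = (\<sigma> ^^ m) v"
proof -
  have "(\<sigma> ^^ n) v = (\<sigma> ^^ m) v" if "m \<le> n" "(w ^^ n) t = (w ^^ m) t" for n m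
  proof -
    have split: "f ^^ n = f ^^ m \<circ> f ^^ (n - m)" for f :: "'c \<Rightarrow> 'c"
      using \<open>m \<le> n\<close> by (simp flip: funpow_add)
    have "(w ^^ m) ((w ^^ (n - m)) t) = (w ^^ m) t" using that(2) by (simp add: split)
    moreover have "inj (w ^^ m)" using permutes_inj[OF w] by (rule inj_fn)
    ultimately have "(w ^^ (n - m)) t = t" by (simp add: inj_eq)
    then have "(\<sigma> ^^ (n - m)) v = v" using v by (simp add: cycle_fixed_def)
    then show ?thesis by (simp add: split)
  qed
  then show ?thesis using eq by (cases "m \<le> n") (metis nat_le_linear)+
qed

lemma cycle_extend_funpow:
  assumes t: "t \<in> cycle_mins w S" "u t \<in> cycle_fixed w \<sigma> t"
  shows "cycle_extend w \<sigma> u ((w ^^ n) t) = (\<sigma> ^^ n) (u t)"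
proof -
  have "cycle_min w ((w ^^ n) t) = t" using t(1) cycle_min_funpow by (simp add: cycle_mins_def)
  then show ?thesis
    using cycle_fixed_funpow_eq[OF t(2), of "funpow_dist w t ((w ^^ n) t)" n]
      funpow_from_cycle_min[of "(w ^^ n) t"] by (simp add: cycle_extend_def)
qed

lemma cycle_extend_apply:
  assumes u: "\<And>t. t \<in> cycle_mins w S \<Longrightarrow> u t \<in> cycle_fixed w \<sigma> t" and j: "j \<in> S"
  shows "cycle_extend w \<sigma> u (w j) = \<sigma> (cycle_extend w \<sigma> u j)"
proof -
  let ?t = "cycle_min w j" and ?n = "funpow_dist w (cycle_min w j) j"
  have t: "?t \<in> cycle_mins w S" by (rule cycle_min_is_min[OF j])
  have "cycle_extend w \<sigma> u ((w ^^ n) ?t) = (\<sigma> ^^ n) (u ?t)" for n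
    using cycle_extend_funpow[of ?t u \<sigma> n] t u by blast
  from this[of ?n] this[of "Suc ?n"] show ?thesis by (simp add: funpow_from_cycle_min)
qed

lemma equivariant_funpow:
  assumes "y \<in> equivariant_functions w S \<sigma> A" "k \<in> S"
  shows "y ((w ^^ n) k) = (\<sigma> ^^ n) (y k)"
  using assms permutes_funpow_in[OF w] by (induction n) (auto simp: equivariant_functions_def)

lemma equivariant_eqI:
  assumes y: "y \<in> equivariant_functions w S \<sigma> A" "y' \<in> equivariant_functions w S \<sigma> A"
    and eq: "\<And>t. t \<in> cycle_mins w S \<Longrightarrow> y t = y' t"
  shows "y = y'"
proof -
  have "y \<in> S \<rightarrow>\<^sub>E A" "y' \<in> S \<rightarrow>\<^sub>E A" using y by (simp_all add: equivariant_functions_def)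
  moreover have "y j = y' j" if j: "j \<in> S" for j
    using equivariant_funpow[OF y(1) cycle_min_in[OF j]] equivariant_funpow[OF y(2) cycle_min_in[OF j]]
      eq[OF cycle_min_is_min[OF j]] funpow_from_cycle_min[of j] by metis
  ultimately show ?thesis by (rule PiE_ext)
qed

lemma restrict_equivariant:
  assumes y: "y \<in> equivariant_functions w S \<sigma> A"
  shows "restrict y (cycle_mins w S) \<in> (\<Pi>\<^sub>E t\<in>cycle_mins w S. A \<inter> cycle_fixed w \<sigma> t)"
proof -
  have "y t \<in> A \<inter> cycle_fixed w \<sigma> t" if "t \<in> cycle_mins w S" for t
  proof -
    have "t \<in> S" using that by (simp add: cycle_mins_def)
    moreover from this have "(\<sigma> ^^ l) (y t) = y t" if "(w ^^ l) t = t" for l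
      using equivariant_funpow[OF y, of t l] that by simp
    ultimately show ?thesis using y by (auto simp: cycle_fixed_def equivariant_functions_def)
  qed
  then show ?thesis unfolding restrict_PiE_iff by blast
qed

lemma
  assumes \<sigma>: "\<And>v. v \<in> A \<Longrightarrow> \<sigma> v \<in> A"
    and u: "u \<in> (\<Pi>\<^sub>E t\<in>cycle_mins w S. A \<inter> cycle_fixed w \<sigma> t)"
  shows restrict_cycle_extend_equivariant:
      "restrict (cycle_extend w \<sigma> u) S \<in> equivariant_functions w S \<sigma> A"
    and restrict_cycle_extend_cycle_mins:
      "restrict (restrict (cycle_extend w \<sigma> u) S) (cycle_mins w S) = u"
proof -
  let ?R = "cycle_mins w S" and ?y = "restrict (cycle_extend w \<sigma> u) S"
  have funpow_in: "(\<sigma> ^^ n) v \<in> A" if "v \<in> A" for n v using that by (induction n) (auto intro: \<sigma>)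
  have fixed: "u t \<in> cycle_fixed w \<sigma> t" "u t \<in> A" if "t \<in> ?R" for t using u that by auto
  have "cycle_extend w \<sigma> u j \<in> A" if "j \<in> S" for j
    unfolding cycle_extend_def by (intro funpow_in fixed cycle_min_is_min that)
  then have "?y \<in> S \<rightarrow>\<^sub>E A" unfolding restrict_PiE_iff by blast
  moreover have "?y (w k) = \<sigma> (?y k)" if "k \<in> S" for k
    using cycle_extend_apply[of u \<sigma> k, OF fixed(1)] that permutes_in_image[OF w, of k] by simp
  ultimately show "?y \<in> equivariant_functions w S \<sigma> A" by (simp add: equivariant_functions_def)
  have "cycle_extend w \<sigma> u t = u t" if "t \<in> ?R" for t
    using cycle_extend_funpow[of t u \<sigma> 0] that fixed(1) by simp
  then show "restrict ?y ?R = u"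
    using u by (intro extensionalityI[of _ ?R]) (auto simp: PiE_iff cycle_mins_def)
qed

lemma bij_betw_equivariant_restrict:
  assumes \<sigma>: "\<And>v. v \<in> A \<Longrightarrow> \<sigma> v \<in> A"
  shows "bij_betw (\<lambda>y. restrict y (cycle_mins w S)) (equivariant_functions w S \<sigma> A)
    (\<Pi>\<^sub>E t\<in>cycle_mins w S. A \<inter> cycle_fixed w \<sigma> t)"
proof (rule bij_betw_imageI)
  show "inj_on (\<lambda>y. restrict y (cycle_mins w S)) (equivariant_functions w S \<sigma> A)"
  proof (rule inj_onI, erule (1) equivariant_eqI)
    fix y y' t assume "restrict y (cycle_mins w S) = restrict y' (cycle_mins w S)" "t \<in> cycle_mins w S"
    then show "y t = y' t" by (metis restrict_apply')
  qed
  show "(\<lambda>y. restrict y (cycle_mins w S)) ` equivariant_functions w S \<sigma> A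
      = (\<Pi>\<^sub>E t\<in>cycle_mins w S. A \<inter> cycle_fixed w \<sigma> t)"
  proof (intro subset_antisym subsetI)
    fix u assume u: "u \<in> (\<Pi>\<^sub>E t\<in>cycle_mins w S. A \<inter> cycle_fixed w \<sigma> t)"
    then show "u \<in> (\<lambda>y. restrict y (cycle_mins w S)) ` equivariant_functions w S \<sigma> A"
      using restrict_cycle_extend_cycle_mins[OF \<sigma> u] restrict_cycle_extend_equivariant[OF \<sigma> u]
      by (intro image_eqI[of _ _ "restrict (cycle_extend w \<sigma> u) S"]) simp_all
  qed (use restrict_equivariant in blast)
qed

end

definition divisible_cycle_mins :: "('a::linorder \<Rightarrow> 'a) \<Rightarrow> 'a set \<Rightarrow> nat \<Rightarrow> 'a set" where
  "divisible_cycle_mins w S q = {t \<in> cycle_mins w S. \<forall>l. (w ^^ l) t = t \<longrightarrow> q dvd l}"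

lemma card_equivariant_functions:
  assumes S: "finite S" and w: "w permutes S" and z: "z \<in> A" and \<sigma>: "\<And>v. v \<in> A \<Longrightarrow> \<sigma> v \<in> A"
    and orders: "\<And>v l. v \<in> A \<Longrightarrow> (\<sigma> ^^ l) v = v \<longleftrightarrow> v = z \<or> q dvd l"
  shows "card (equivariant_functions w S \<sigma> A) = card A ^ card (divisible_cycle_mins w S q)"
proof -
  let ?R = "cycle_mins w S" and ?D = "divisible_cycle_mins w S q"
  have R: "finite ?R" using S by (simp add: cycle_mins_def)
  have "card (A \<inter> cycle_fixed w \<sigma> t) = (if t \<in> ?D then card A else 1)" if t: "t \<in> ?R" for t
  proof (cases "t \<in> ?D")
    case True
    then have "A \<inter> cycle_fixed w \<sigma> t = A"
      using orders by (auto simp: cycle_fixed_def divisible_cycle_mins_def)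
    then show ?thesis using True by simp
  next
    case False
    then have "A \<inter> cycle_fixed w \<sigma> t = {z}"
      using orders z t by (auto simp: cycle_fixed_def divisible_cycle_mins_def)
    then show ?thesis using False by simp
  qed
  then have "(\<Prod>t\<in>?R. card (A \<inter> cycle_fixed w \<sigma> t)) = (\<Prod>t\<in>?R. if t \<in> ?D then card A else 1)"
    by (rule prod.cong[OF refl])
  also have "\<dots> = card A ^ card (?R \<inter> ?D)" by (simp add: prod.If_cases[OF R])
  also have "?R \<inter> ?D = ?D" by (auto simp: divisible_cycle_mins_def)
  finally show ?thesis
    using bij_betw_same_card[OF bij_betw_equivariant_restrict[OF S w, of A \<sigma>, OF \<sigma>]]
    by (simp add: card_PiE[OF R])
qed

lemma equivariant_functions_eq:
  assumes w: "w permutes S"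
  shows "equivariant_functions w S \<sigma> A = {y \<in> S \<rightarrow>\<^sub>E A. y \<circ> w = (\<lambda>k\<in>S. \<sigma> (y k))}"
proof -
  have "y (w k) = undefined" if "y \<in> S \<rightarrow>\<^sub>E A" "k \<notin> S" for y k
    using that permutes_not_in[OF w that(2)] by auto
  then have "(\<forall>k\<in>S. y (w k) = \<sigma> (y k)) \<longleftrightarrow> y \<circ> w = (\<lambda>k\<in>S. \<sigma> (y k))" if "y \<in> S \<rightarrow>\<^sub>E A" for y
    using that by (auto simp: fun_eq_iff)
  then show ?thesis unfolding equivariant_functions_def by blast
qed

lemma dvd_mult_iff_div_gcd:
  fixes n d l :: nat
  assumes "0 < n"
  shows "n dvd d * l \<longleftrightarrow> n div gcd d n dvd l"
proof -
  have "gcd d n \<noteq> 0" using assms by simp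
  have "n dvd d * l \<longleftrightarrow> gcd d n * (n div gcd d n) dvd gcd d n * ((d div gcd d n) * l)"
    by (simp add: mult.assoc[symmetric])
  also have "\<dots> \<longleftrightarrow> n div gcd d n dvd (d div gcd d n) * l"
    using \<open>gcd d n \<noteq> 0\<close> by (intro nat_mult_dvd_cancel1) simp
  also have "\<dots> \<longleftrightarrow> n div gcd d n dvd l"
    using div_gcd_coprime[of d n] assms
    by (intro coprime_dvd_mult_right_iff) (auto simp: coprime_commute)
  finally show ?thesis .
qed

lemma div_gcd_eq_1_iff:
  fixes n d :: nat
  assumes "0 < n"
  shows "n div gcd d n = 1 \<longleftrightarrow> n dvd d"
  using dvd_mult_iff_div_gcd[OF assms, of d 1] by (simp only: mult_1_right nat_dvd_1_iff_1)

context rational_slope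
begin

lemma funpow_rotate_value: "v \<le> N \<Longrightarrow> (rotate_value N s ^^ n) v = rotate_value N (int n * s) v"
proof (induction n)
  case 0
  then show ?case
    using rotate_value_eq_self_iff[of v N 0] by (cases "v = 0") (simp_all add: rotate_value_def)
next
  case (Suc n)
  then show ?case by (simp add: rotate_value_add[OF N_pos] algebra_simps)
qed

lemma card_fixed_labellings:
  assumes w: "w permutes {1..a}"
  shows "card {y \<in> {1..a} \<rightarrow>\<^sub>E {0..N}. y \<circ> w = rotate_labels N (int d) y}
    = b ^ card (divisible_cycle_mins w {1..a} (N div gcd d N))"
proof -
  have "card (equivariant_functions w {1..a} (rotate_value N (int d)) {0..N})
      = card {0..N} ^ card (divisible_cycle_mins w {1..a} (N div gcd d N))"
  proof (rule card_equivariant_functions[OF _ w, of 0])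
    fix v l :: nat assume v: "v \<in> {0..N}"
    then have "(rotate_value N (int d) ^^ l) v = v \<longleftrightarrow> v = 0 \<or> N dvd d * l"
      using funpow_rotate_value[of v l "int d"] rotate_value_eq_self_iff[of v N "int (d * l)"]
      by (cases "v = 0") (simp_all add: rotate_value_def mult.commute flip: of_nat_mult)
    then show "(rotate_value N (int d) ^^ l) v = v \<longleftrightarrow> v = 0 \<or> N div gcd d N dvd l"
      by (simp only: dvd_mult_iff_div_gcd[OF N_pos])
  qed (use rotate_value_le[OF N_pos] in auto)
  then show ?thesis
    using equivariant_functions_eq[OF w, of "rotate_value N (int d)" "{0..N}"]
    by (simp add: rotate_labels_def b_eq)
qed

lemma card_invariant_functions:
  assumes w: "w permutes {1..a}"
  shows "card {z \<in> {1..a} \<rightarrow>\<^sub>E {1..b}. z \<circ> w = z} = b ^ card (divisible_cycle_mins w {1..a} 1)"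
proof -
  have "card (equivariant_functions w {1..a} id {1..b})
      = card {1..b} ^ card (divisible_cycle_mins w {1..a} 1)"
    by (rule card_equivariant_functions[OF _ w, of 1]) (use b_pos in auto)
  moreover have "equivariant_functions w {1..a} id {1..b} = {z \<in> {1..a} \<rightarrow>\<^sub>E {1..b}. z \<circ> w = z}"
    unfolding equivariant_functions_eq[OF w]
    by (intro Collect_cong conj_cong refl) (simp add: PiE_restrict)
  ultimately show ?thesis by simp
qed

end

subsection \<open>Eigenspaces of the reflection representation\<close>

unbundle no vec_syntax

abbreviation (input) diag_coset :: "nat \<Rightarrow> complex vec \<Rightarrow> complex vec set" where
  "diag_coset a x \<equiv> {x + c \<cdot>\<^sub>v vec a (\<lambda>_. 1) | c. True}"

lemma diag_coset_eq_iff: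
  assumes x: "x \<in> carrier_vec a" and y: "y \<in> carrier_vec a"
  shows "diag_coset a x = diag_coset a y \<longleftrightarrow> (\<exists>c. x = y + c \<cdot>\<^sub>v vec a (\<lambda>_. 1))"
proof
  have "x = x + 0 \<cdot>\<^sub>v vec a (\<lambda>_. 1)" using x by (intro eq_vecI) auto
  then have "x \<in> diag_coset a x" by blast
  moreover assume "diag_coset a x = diag_coset a y"
  ultimately have "x \<in> diag_coset a y" by (simp only:)
  then show "\<exists>c. x = y + c \<cdot>\<^sub>v vec a (\<lambda>_. 1)" by blast
next
  assume "\<exists>c. x = y + c \<cdot>\<^sub>v vec a (\<lambda>_. 1)"
  then obtain c where c: "x = y + c \<cdot>\<^sub>v vec a (\<lambda>_. 1)" by blast
  have "x + e \<cdot>\<^sub>v vec a (\<lambda>_. 1) = y + (c + e) \<cdot>\<^sub>v vec a (\<lambda>_. 1)" for e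
    using y by (intro eq_vecI) (auto simp: c)
  moreover have "y + e \<cdot>\<^sub>v vec a (\<lambda>_. 1) = x + (e - c) \<cdot>\<^sub>v vec a (\<lambda>_. 1)" for e
    using y by (intro eq_vecI) (auto simp: c algebra_simps)
  ultimately show "diag_coset a x = diag_coset a y" by blast
qed

lemma perm_mat_mult_index:
  assumes w: "w permutes {1..a}" and x: "x \<in> carrier_vec a" and k: "k \<in> {1..a}"
  shows "(perm_mat a w *\<^sub>v x) $ (w k - 1) = x $ (k - 1)"
proof -
  have "w k \<in> {1..a}" using permutes_in_image[OF w] k by simp
  then have i: "w k - 1 < a" "w k - 1 + 1 = w k" by auto
  have "(perm_mat a w *\<^sub>v x) $ (w k - 1)
      = (\<Sum>j<a. (if w (j + 1) = w k - 1 + 1 then 1 else 0) * x $ j)"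
    using i(1) x by (simp add: perm_mat_def scalar_prod_def row_def lessThan_atLeast0)
  also have "\<dots> = (\<Sum>j<a. (if w (j + 1) = w k then 1 else 0) * x $ j)" unfolding i(2) ..
  also have "\<dots> = (\<Sum>j<a. if j = k - 1 then x $ j else 0)"
  proof (rule sum.cong)
    fix j assume "j \<in> {..<a}"
    have "w (j + 1) = w k \<longleftrightarrow> j + 1 = k" using permutes_inj[OF w] by (simp add: inj_eq)
    then show "(if w (j + 1) = w k then 1 else 0) * x $ j = (if j = k - 1 then x $ j else 0)"
      using k by auto
  qed simp
  also have "\<dots> = x $ (k - 1)" using k by (simp add: sum.delta) auto
  finally show ?thesis .
qed

context
  fixes a q :: nat and w :: "nat \<Rightarrow> nat" and z :: complex
  assumes a_pos: "0 < a" and w: "w permutes {1..a}"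
    and z_order: "\<And>l. z ^ l = 1 \<longleftrightarrow> q dvd l" and q_pos: "0 < q"
begin

lemma z_nonzero: "z \<noteq> 0"
proof
  assume "z = 0"
  moreover have "z ^ q = 1" using z_order by simp
  ultimately show False using zero_power[OF q_pos, where 'a = complex] by simp
qed

lemma index_less: "k \<in> {1..a} \<Longrightarrow> k - 1 < a" "k \<in> {1..a} \<Longrightarrow> w k - 1 < a"
  using permutes_in_image[OF w, of k] by auto

lemma perm_mat_affine_eigen_iff:
  assumes x: "x \<in> carrier_vec a"
  shows "perm_mat a w *\<^sub>v x = z \<cdot>\<^sub>v x + c \<cdot>\<^sub>v vec a (\<lambda>_. 1) \<longleftrightarrow>
    (\<forall>k\<in>{1..a}. x $ (k - 1) = z * x $ (w k - 1) + c)"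
proof
  assume eq: "perm_mat a w *\<^sub>v x = z \<cdot>\<^sub>v x + c \<cdot>\<^sub>v vec a (\<lambda>_. 1)"
  show "\<forall>k\<in>{1..a}. x $ (k - 1) = z * x $ (w k - 1) + c"
  proof
    fix k assume k: "k \<in> {1..a}"
    then show "x $ (k - 1) = z * x $ (w k - 1) + c"
      using perm_mat_mult_index[OF w x k] index_less(2)[OF k] x by (simp add: eq)
  qed
next
  assume eq: "\<forall>k\<in>{1..a}. x $ (k - 1) = z * x $ (w k - 1) + c"
  show "perm_mat a w *\<^sub>v x = z \<cdot>\<^sub>v x + c \<cdot>\<^sub>v vec a (\<lambda>_. 1)"
  proof (rule eq_vecI)
    fix i assume "i < dim_vec (z \<cdot>\<^sub>v x + c \<cdot>\<^sub>v vec a (\<lambda>_. 1))"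
    then have i: "i < a" using x by simp
    define k where "k = inv_into UNIV w (i + 1)"
    have k: "k \<in> {1..a}" "w k = i + 1"
      using i permutes_in_image[OF permutes_inv[OF w], of "i + 1"] permutes_inverses(1)[OF w]
      by (auto simp: k_def)
    then have "(perm_mat a w *\<^sub>v x) $ i = x $ (k - 1)" using perm_mat_mult_index[OF w x k(1)] by simp
    also have "\<dots> = z * x $ i + c" using eq k by auto
    finally show "(perm_mat a w *\<^sub>v x) $ i = (z \<cdot>\<^sub>v x + c \<cdot>\<^sub>v vec a (\<lambda>_. 1)) $ i" using i x by simp
  qed (use x in \<open>simp add: perm_mat_def\<close>)
qed

definition eigvec :: "complex vec \<Rightarrow> bool" where
  "eigvec x \<longleftrightarrow> x \<in> carrier_vec a \<and> (\<forall>k\<in>{1..a}. x $ (k - 1) = z * x $ (w k - 1))"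

lemma eigvec_carrier: "eigvec x \<Longrightarrow> x \<in> carrier_vec a"
  by (simp add: eigvec_def)

lemma eigvec_zero: "eigvec (0\<^sub>v a)"
  using index_less by (simp add: eigvec_def)

lemma eigvec_add:
  assumes "eigvec x" "eigvec y"
  shows "eigvec (x + y)"
  unfolding eigvec_def
proof (intro conjI ballI)
  fix k assume k: "k \<in> {1..a}"
  then have "x $ (k - 1) = z * x $ (w k - 1)" "y $ (k - 1) = z * y $ (w k - 1)"
    using assms unfolding eigvec_def by blast+
  then show "(x + y) $ (k - 1) = z * (x + y) $ (w k - 1)"
    using index_less[OF k] eigvec_carrier[OF assms(2)] by (simp add: algebra_simps)
qed (use assms in \<open>simp add: eigvec_def\<close>)

lemma eigvec_smult:
  assumes "eigvec x"
  shows "eigvec (r \<cdot>\<^sub>v x)"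
  unfolding eigvec_def
proof (intro conjI ballI)
  fix k assume k: "k \<in> {1..a}"
  then have "x $ (k - 1) = z * x $ (w k - 1)" using assms unfolding eigvec_def by blast
  then show "(r \<cdot>\<^sub>v x) $ (k - 1) = z * (r \<cdot>\<^sub>v x) $ (w k - 1)"
    using index_less[OF k] eigvec_carrier[OF assms] by simp
qed (use assms in \<open>simp add: eigvec_def\<close>)

lemma eigvec_translate_iff:
  assumes x: "x \<in> carrier_vec a"
  shows "eigvec (x + s \<cdot>\<^sub>v vec a (\<lambda>_. 1)) \<longleftrightarrow>
    (\<forall>k\<in>{1..a}. x $ (k - 1) = z * x $ (w k - 1) + (z - 1) * s)"
proof -
  have "(x + s \<cdot>\<^sub>v vec a (\<lambda>_. 1)) $ (k - 1) = z * (x + s \<cdot>\<^sub>v vec a (\<lambda>_. 1)) $ (w k - 1) \<longleftrightarrow>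
      x $ (k - 1) = z * x $ (w k - 1) + (z - 1) * s" if "k \<in> {1..a}" for k
    using index_less[OF that] x by (auto simp: algebra_simps)
  then show ?thesis using x by (simp add: eigvec_def)
qed

lemma diag_coset_in_eigenspace_iff:
  assumes x: "x \<in> carrier_vec a"
  shows "diag_coset a x \<in> refl_eigenspace a w z \<longleftrightarrow>
    (\<exists>c. \<forall>k\<in>{1..a}. x $ (k - 1) = z * x $ (w k - 1) + c)"
proof -
  have image: "perm_mat a w *\<^sub>v x \<in> carrier_vec a"
    by (rule mult_mat_vec_carrier[OF _ x]) (simp add: perm_mat_def)
  have "diag_coset a x \<in> carrier (refl_rep a)" unfolding refl_rep_carrier using x by blast
  then have "diag_coset a x \<in> refl_eigenspace a w z \<longleftrightarrow>
      diag_coset a (perm_mat a w *\<^sub>v x) = diag_coset a (z \<cdot>\<^sub>v x)"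
    unfolding refl_eigenspace_def mem_Collect_eq refl_act_coset[OF w x] refl_rep_smult[OF x] by simp
  also have "\<dots> \<longleftrightarrow> (\<exists>c. perm_mat a w *\<^sub>v x = z \<cdot>\<^sub>v x + c \<cdot>\<^sub>v vec a (\<lambda>_. 1))"
    using x by (intro diag_coset_eq_iff[OF image]) simp
  also have "\<dots> \<longleftrightarrow> (\<exists>c. \<forall>k\<in>{1..a}. x $ (k - 1) = z * x $ (w k - 1) + c)"
    unfolding perm_mat_affine_eigen_iff[OF x] ..
  finally show ?thesis .
qed

lemma affine_invariant_imp_invariant:
  assumes "\<And>k. k \<in> {1..a} \<Longrightarrow> x $ (k - 1) = x $ (w k - 1) + (c :: complex)"
  shows "c = 0"
proof -
  have step: "x $ (1 - 1) = x $ ((w ^^ n) 1 - 1) + of_nat n * c" for n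
  proof (induction n)
    case (Suc n)
    have "(w ^^ n) 1 \<in> {1..a}" using permutes_funpow_in[OF w, of 1 n] a_pos by simp
    from assms[OF this] Suc show ?case by (simp add: algebra_simps)
  qed simp
  obtain n where "0 < n" "(w ^^ n) 1 = 1"
    using permutation_self[OF permutation_w[OF finite_atLeastAtMost w], of 1] by metis
  then show ?thesis using step[of n] by simp
qed

lemma refl_eigenspace_eq: "refl_eigenspace a w z = (\<lambda>x. diag_coset a x) ` {x. eigvec x}"
proof (intro subset_antisym subsetI)
  fix X assume X: "X \<in> refl_eigenspace a w z"
  then have "X \<in> carrier (refl_rep a)" by (simp add: refl_eigenspace_def)
  then obtain x where x: "x \<in> carrier_vec a" "X = diag_coset a x" unfolding refl_rep_carrier by blast
  then obtain c where c: "\<And>k. k \<in> {1..a} \<Longrightarrow> x $ (k - 1) = z * x $ (w k - 1) + c"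
    using X diag_coset_in_eigenspace_iff by blast
  obtain s where s: "(z - 1) * s = c"
  proof (cases "z = 1")
    case True
    then have "c = 0" using affine_invariant_imp_invariant[of x c] c by simp
    then show thesis using that[of 0] by simp
  next
    case False
    then show thesis using that[of "c / (z - 1)"] by simp
  qed
  let ?x = "x + s \<cdot>\<^sub>v vec a (\<lambda>_. 1)"
  have "eigvec ?x" unfolding eigvec_translate_iff[OF x(1)] s using c by simp
  moreover have "X = diag_coset a ?x"
    unfolding x(2) using diag_coset_eq_iff[OF eigvec_carrier[OF \<open>eigvec ?x\<close>] x(1)] by blast
  ultimately show "X \<in> (\<lambda>x. diag_coset a x) ` {x. eigvec x}" by blast
next
  fix X assume "X \<in> (\<lambda>x. diag_coset a x) ` {x. eigvec x}"
  then obtain x where x: "eigvec x" "X = diag_coset a x" by blast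
  have "\<forall>k\<in>{1..a}. x $ (k - 1) = z * x $ (w k - 1) + 0" using x(1) by (simp add: eigvec_def)
  then show "X \<in> refl_eigenspace a w z"
    unfolding x(2) using diag_coset_in_eigenspace_iff[OF eigvec_carrier[OF x(1)]] by blast
qed

lemma vectorspace_eigenspace:
  "vectorspace class_ring ((refl_rep a)\<lparr>carrier := refl_eigenspace a w z\<rparr>)"
proof (rule vectorspace.subspace_is_vs[OF vectorspace_refl_rep])
  have mod: "module class_ring (refl_rep a)" using vectorspace_refl_rep by (simp add: vectorspace_def)
  show "subspace class_ring (refl_eigenspace a w z) (refl_rep a)"
  proof (intro subspace.intro vectorspace_refl_rep submodule.intro mod)
    show "refl_eigenspace a w z \<subseteq> carrier (refl_rep a)" by (auto simp: refl_eigenspace_def)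
    show "\<zero>\<^bsub>refl_rep a\<^esub> \<in> refl_eigenspace a w z"
      unfolding refl_rep_zero refl_eigenspace_eq using eigvec_zero by blast
    fix X Y assume "X \<in> refl_eigenspace a w z" "Y \<in> refl_eigenspace a w z"
    then obtain x y where "eigvec x" "X = diag_coset a x" "eigvec y" "Y = diag_coset a y"
      unfolding refl_eigenspace_eq by blast
    then show "X \<oplus>\<^bsub>refl_rep a\<^esub> Y \<in> refl_eigenspace a w z"
      using refl_rep_add[OF eigvec_carrier eigvec_carrier] eigvec_add
      unfolding refl_eigenspace_eq by blast
  next
    fix r X assume "X \<in> refl_eigenspace a w z"
    then obtain x where "eigvec x" "X = diag_coset a x" unfolding refl_eigenspace_eq by blast
    then show "r \<odot>\<^bsub>refl_rep a\<^esub> X \<in> refl_eigenspace a w z"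
      using refl_rep_smult[OF eigvec_carrier] eigvec_smult unfolding refl_eigenspace_eq by blast
  qed
qed

lemma inverse_z_order: "inverse z ^ l = 1 \<longleftrightarrow> q dvd l"
  using z_order[of l] by (simp add: power_inverse inverse_eq_1_iff)

lemma cycle_fixed_inverse_z:
  "v \<in> cycle_fixed w ((*) (inverse z)) t \<longleftrightarrow> v = 0 \<or> (\<forall>l. (w ^^ l) t = t \<longrightarrow> q dvd l)"
  using inverse_z_order by (auto simp: cycle_fixed_def funpow_times_power[where f = "\<lambda>_. l" for l])

lemma eigvec_equivariant:
  assumes u: "eigvec u"
  shows "(\<lambda>k\<in>{1..a}. u $ (k - 1)) \<in> equivariant_functions w {1..a} ((*) (inverse z)) UNIV"
  unfolding equivariant_functions_def
proof (intro CollectI conjI ballI)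
  fix k assume k: "k \<in> {1..a}"
  then have "u $ (k - 1) = z * u $ (w k - 1)" using u unfolding eigvec_def by blast
  then show "(\<lambda>k\<in>{1..a}. u $ (k - 1)) (w k) = inverse z * (\<lambda>k\<in>{1..a}. u $ (k - 1)) k"
    using k permutes_in_image[OF w, of k] z_nonzero by simp
qed simp

lemma eigvec_vanishes:
  assumes u: "eigvec u" and t: "t \<in> cycle_mins w {1..a}" "t \<notin> divisible_cycle_mins w {1..a} q"
  shows "u $ (t - 1) = 0"
proof -
  have range: "t \<in> {1..a}" using t(1) by (simp add: cycle_mins_def)
  obtain l where l: "(w ^^ l) t = t" "\<not> q dvd l" using t by (auto simp: divisible_cycle_mins_def)
  have "u $ (t - 1) = inverse z ^ l * u $ (t - 1)"
    using equivariant_funpow[OF finite_atLeastAtMost w eigvec_equivariant[OF u] range, of l] range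
    by (simp add: l(1) funpow_times_power[where f = "\<lambda>_. l"])
  then show ?thesis using l(2) inverse_z_order[of l] by simp
qed

lemma eigvec_eqI:
  assumes x: "eigvec x" "eigvec y"
    and eq: "\<And>t. t \<in> divisible_cycle_mins w {1..a} q \<Longrightarrow> x $ (t - 1) = y $ (t - 1)"
  shows "x = y"
proof -
  have "(\<lambda>k\<in>{1..a}. x $ (k - 1)) = (\<lambda>k\<in>{1..a}. y $ (k - 1))"
  proof (rule equivariant_eqI[OF finite_atLeastAtMost w x[THEN eigvec_equivariant]])
    fix t assume t: "t \<in> cycle_mins w {1..a}"
    then have "x $ (t - 1) = y $ (t - 1)" using eq[of t] x[THEN eigvec_vanishes] by metis
    then show "(\<lambda>k\<in>{1..a}. x $ (k - 1)) t = (\<lambda>k\<in>{1..a}. y $ (k - 1)) t" by simp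
  qed
  then have "x $ (k - 1) = y $ (k - 1)" if "k \<in> {1..a}" for k
    using that by (metis restrict_apply')
  from this[of "Suc i" for i] show ?thesis
    using eigvec_carrier[OF x(1)] eigvec_carrier[OF x(2)] by (intro eq_vecI) auto
qed

lemma divisible_cycle_min_in_range: "t \<in> divisible_cycle_mins w {1..a} q \<Longrightarrow> t \<in> {1..a}"
  by (simp add: divisible_cycle_mins_def cycle_mins_def)

definition min_values :: "(nat \<Rightarrow> complex) \<Rightarrow> nat \<Rightarrow> complex" where
  "min_values g t = (if t \<in> divisible_cycle_mins w {1..a} q then g t else 0)"

lemma min_values_fixed:
  "t \<in> cycle_mins w {1..a} \<Longrightarrow> min_values g t \<in> cycle_fixed w ((*) (inverse z)) t"
  by (simp add: cycle_fixed_inverse_z min_values_def divisible_cycle_mins_def)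

definition eigvec_of :: "(nat \<Rightarrow> complex) \<Rightarrow> complex vec" where
  "eigvec_of g = vec a (\<lambda>i. cycle_extend w ((*) (inverse z)) (min_values g) (Suc i))"

lemma eigvec_of_carrier: "eigvec_of g \<in> carrier_vec a"
  by (simp add: eigvec_of_def)

lemma eigvec_of_index:
  "k \<in> {1..a} \<Longrightarrow> eigvec_of g $ (k - 1) = cycle_extend w ((*) (inverse z)) (min_values g) k"
  using index_less(1)[of k] by (simp add: eigvec_of_def)

lemma eigvec_eigvec_of: "eigvec (eigvec_of g)"
  unfolding eigvec_def
proof (intro conjI ballI eigvec_of_carrier)
  fix k assume k: "k \<in> {1..a}"
  then have "w k \<in> {1..a}" using permutes_in_image[OF w] by simp
  then show "eigvec_of g $ (k - 1) = z * eigvec_of g $ (w k - 1)"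
    unfolding eigvec_of_index[OF k] eigvec_of_index[OF \<open>w k \<in> {1..a}\<close>]
    using cycle_extend_apply[OF finite_atLeastAtMost w min_values_fixed[of _ g] k] z_nonzero
    by simp
qed

lemma eigvec_of_at_min:
  assumes t: "t \<in> divisible_cycle_mins w {1..a} q"
  shows "eigvec_of g $ (t - 1) = g t"
proof -
  have "t \<in> cycle_mins w {1..a}" using t by (simp add: divisible_cycle_mins_def)
  then have "cycle_extend w ((*) (inverse z)) (min_values g) t = min_values g t"
    using cycle_extend_funpow[OF finite_atLeastAtMost w, of t "min_values g" _ 0] min_values_fixed
    by simp
  then show ?thesis
    using eigvec_of_index[OF divisible_cycle_min_in_range[OF t]] t by (simp add: min_values_def)
qed

lemma eigvec_of_add: "eigvec_of (\<lambda>t. f t + g t) = eigvec_of f + eigvec_of g"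
proof (rule eigvec_eqI[OF eigvec_eigvec_of eigvec_add[OF eigvec_eigvec_of eigvec_eigvec_of]])
  fix t assume t: "t \<in> divisible_cycle_mins w {1..a} q"
  then have "t - 1 < a" by (intro index_less divisible_cycle_min_in_range)
  then show "eigvec_of (\<lambda>t. f t + g t) $ (t - 1) = (eigvec_of f + eigvec_of g) $ (t - 1)"
    using eigvec_of_at_min[OF t] carrier_vecD[OF eigvec_of_carrier] by simp
qed

lemma eigvec_of_smult: "eigvec_of (\<lambda>t. r * g t) = r \<cdot>\<^sub>v eigvec_of g"
proof (rule eigvec_eqI[OF eigvec_eigvec_of eigvec_smult[OF eigvec_eigvec_of]])
  fix t assume t: "t \<in> divisible_cycle_mins w {1..a} q"
  then have "t - 1 < a" by (intro index_less divisible_cycle_min_in_range)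
  then show "eigvec_of (\<lambda>t. r * g t) $ (t - 1) = (r \<cdot>\<^sub>v eigvec_of g) $ (t - 1)"
    using eigvec_of_at_min[OF t] carrier_vecD[OF eigvec_of_carrier] by simp
qed

lemma one_divisible_cycle_min:
  assumes "z = 1"
  shows "1 \<in> divisible_cycle_mins w {1..a} q"
proof -
  have "q dvd 1" using assms z_order[of 1] by simp
  moreover have "1 \<in> {1..a}" using a_pos by simp
  moreover from this have "cycle_min w 1 = 1"
    using cycle_min_le[OF finite_atLeastAtMost w, of 1 0] cycle_min_in[OF finite_atLeastAtMost w, of 1]
    by simp
  ultimately show ?thesis by (simp add: divisible_cycle_mins_def cycle_mins_def)
qed

text \<open>For \<open>z = 1\<close> the diagonal line consists of eigenvectors; normalising the first coordinate to \<open>0\<close>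
  picks one representative of each coset.\<close>

definition free_cycle_mins :: "nat set" where
  "free_cycle_mins = divisible_cycle_mins w {1..a} q - (if z = 1 then {1} else {})"

lemma eigvec_coset_normalised_unique:
  assumes x: "eigvec x" "eigvec y" and coset: "diag_coset a x = diag_coset a y"
    and normalised: "z = 1 \<Longrightarrow> x $ 0 = y $ 0"
  shows "x = y"
proof -
  obtain c where c: "x = y + c \<cdot>\<^sub>v vec a (\<lambda>_. 1)"
    using coset diag_coset_eq_iff[OF eigvec_carrier eigvec_carrier] x by blast
  have y: "y \<in> carrier_vec a" by (rule eigvec_carrier[OF x(2)])
  have "c = 0"
  proof (cases "z = 1")
    case True
    then show ?thesis using normalised a_pos y by (simp add: c)
  next
    case False
    have one: "1 \<in> {1..a}" using a_pos by simp
    have "y $ (1 - 1) = z * y $ (w 1 - 1) + (z - 1) * c"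
      using x(1) one unfolding c eigvec_translate_iff[OF y] by blast
    moreover have "y $ (1 - 1) = z * y $ (w 1 - 1)" using x(2) one unfolding eigvec_def by blast
    ultimately show ?thesis using False by simp
  qed
  then show ?thesis using y by (intro eq_vecI) (auto simp: c)
qed

lemma eigvec_coset_normalise:
  assumes x: "eigvec x"
  obtains y where "eigvec y" "diag_coset a y = diag_coset a x" "z = 1 \<Longrightarrow> y $ 0 = 0"
proof -
  define s where "s = (if z = 1 then - x $ 0 else 0)"
  let ?y = "x + s \<cdot>\<^sub>v vec a (\<lambda>_. 1)"
  have xc: "x \<in> carrier_vec a" by (rule eigvec_carrier[OF x])
  have "eigvec ?y"
    unfolding eigvec_translate_iff[OF xc] using x by (simp add: eigvec_def s_def)
  moreover have "diag_coset a ?y = diag_coset a x"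
    using diag_coset_eq_iff[OF eigvec_carrier[OF \<open>eigvec ?y\<close>] xc] by blast
  moreover have "?y $ 0 = 0" if "z = 1" using that a_pos xc by (simp add: s_def)
  ultimately show thesis by (rule that)
qed

context
  fixes n :: nat and idx :: "nat \<Rightarrow> nat"
  assumes idx: "bij_betw idx free_cycle_mins {..<n}"
begin

definition eigen_coset :: "complex vec \<Rightarrow> complex vec set" where
  "eigen_coset u = diag_coset a (eigvec_of (\<lambda>t. if t \<in> free_cycle_mins then u $ idx t else 0))"

abbreviation (input) eigenspace_module :: "(complex, complex vec set) module" where
  "eigenspace_module \<equiv> (refl_rep a)\<lparr>carrier := refl_eigenspace a w z\<rparr>"

lemma idx_less: "t \<in> free_cycle_mins \<Longrightarrow> idx t < n"
  using bij_betwE[OF idx] by auto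

lemma eigen_coset_add:
  assumes "u \<in> carrier_vec n" "v \<in> carrier_vec n"
  shows "eigen_coset (u + v) = eigen_coset u \<oplus>\<^bsub>refl_rep a\<^esub> eigen_coset v"
proof -
  have "(\<lambda>t. if t \<in> free_cycle_mins then (u + v) $ idx t else 0)
      = (\<lambda>t. (if t \<in> free_cycle_mins then u $ idx t else 0)
          + (if t \<in> free_cycle_mins then v $ idx t else 0))"
    using assms idx_less by (auto simp: fun_eq_iff)
  then show ?thesis
    by (simp only: eigen_coset_def eigvec_of_add refl_rep_add[OF eigvec_of_carrier eigvec_of_carrier])
qed

lemma eigen_coset_smult:
  assumes "u \<in> carrier_vec n"
  shows "eigen_coset (r \<cdot>\<^sub>v u) = r \<odot>\<^bsub>refl_rep a\<^esub> eigen_coset u"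
proof -
  have "(\<lambda>t. if t \<in> free_cycle_mins then (r \<cdot>\<^sub>v u) $ idx t else 0)
      = (\<lambda>t. r * (if t \<in> free_cycle_mins then u $ idx t else 0))"
    using assms idx_less by (auto simp: fun_eq_iff)
  then show ?thesis
    by (simp only: eigen_coset_def eigvec_of_smult refl_rep_smult[OF eigvec_of_carrier])
qed

lemma eigen_coset_in_eigenspace: "eigen_coset u \<in> refl_eigenspace a w z"
  unfolding eigen_coset_def refl_eigenspace_eq using eigvec_eigvec_of by blast

lemma inj_on_eigen_coset: "inj_on eigen_coset (carrier_vec n)"
proof (rule inj_onI)
  fix u v assume uv: "u \<in> carrier_vec n" "v \<in> carrier_vec n" and eq: "eigen_coset u = eigen_coset v"
  define g where "g u t = (if t \<in> free_cycle_mins then u $ idx t else 0)" for u :: "complex vec" and t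
  have "eigvec_of (g u) = eigvec_of (g v)"
  proof (rule eigvec_coset_normalised_unique[OF eigvec_eigvec_of eigvec_eigvec_of])
    show "diag_coset a (eigvec_of (g u)) = diag_coset a (eigvec_of (g v))"
      using eq by (simp only: eigen_coset_def g_def[abs_def])
    assume z: "z = 1"
    have "1 \<notin> free_cycle_mins" unfolding free_cycle_mins_def using z by simp
    then show "eigvec_of (g u) $ 0 = eigvec_of (g v) $ 0"
      using eigvec_of_at_min[OF one_divisible_cycle_min[OF z], of "g u"]
        eigvec_of_at_min[OF one_divisible_cycle_min[OF z], of "g v"] by (simp add: g_def)
  qed
  then have "g u t = g v t" if "t \<in> free_cycle_mins" for t
    using eigvec_of_at_min[of t "g u"] eigvec_of_at_min[of t "g v"] that
    by (simp add: free_cycle_mins_def)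
  then have "u $ idx t = v $ idx t" if "t \<in> free_cycle_mins" for t using that by (simp add: g_def)
  moreover have "\<exists>t\<in>free_cycle_mins. i = idx t" if "i < n" for i
    using bij_betw_imp_surj_on[OF idx] that by (metis imageE lessThan_iff)
  ultimately show "u = v" using uv by (intro eq_vecI) auto
qed

lemma eigen_coset_image: "eigen_coset ` carrier_vec n = refl_eigenspace a w z"
proof (intro subset_antisym subsetI)
  fix X assume "X \<in> refl_eigenspace a w z"
  then obtain x where x: "eigvec x" "X = diag_coset a x" unfolding refl_eigenspace_eq by blast
  obtain y where y: "eigvec y" "diag_coset a y = diag_coset a x" "z = 1 \<Longrightarrow> y $ 0 = 0"
    using eigvec_coset_normalise[OF x(1)] by blast
  define u where "u = vec n (\<lambda>i. y $ (inv_into free_cycle_mins idx i - 1))"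
  have "y = eigvec_of (\<lambda>t. if t \<in> free_cycle_mins then u $ idx t else 0)"
  proof (rule eigvec_eqI[OF y(1) eigvec_eigvec_of])
    fix t assume t: "t \<in> divisible_cycle_mins w {1..a} q"
    show "y $ (t - 1) = eigvec_of (\<lambda>t. if t \<in> free_cycle_mins then u $ idx t else 0) $ (t - 1)"
    proof (cases "t \<in> free_cycle_mins")
      case True
      then have "inv_into free_cycle_mins idx (idx t) = t"
        using idx by (simp add: bij_betw_def inv_into_f_f)
      then show ?thesis using True idx_less[OF True] eigvec_of_at_min[OF t] by (simp add: u_def)
    next
      case False
      then have "z = 1 \<and> t = 1" using t by (auto simp: free_cycle_mins_def split: if_splits)
      then show ?thesis unfolding eigvec_of_at_min[OF t] using False y(3) by simp
    qed
  qed
  then have "X = eigen_coset u" using x(2) y(2) by (simp add: eigen_coset_def)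
  then show "X \<in> eigen_coset ` carrier_vec n" by (simp add: u_def)
qed (use eigen_coset_in_eigenspace in auto)

lemma refl_mult_eq_index_count: "refl_mult a w z = n"
proof -
  interpret W: vectorspace class_ring eigenspace_module by (rule vectorspace_eigenspace)
  interpret V: vec_space "TYPE(complex)" n .
  have "eigen_coset \<in> module_hom class_ring (module_vec TYPE(complex) n) eigenspace_module"
    unfolding module_hom_def
    using eigen_coset_in_eigenspace eigen_coset_add eigen_coset_smult by (auto simp: module_vec_simps)
  then interpret linear_map class_ring "module_vec TYPE(complex) n" eigenspace_module eigen_coset
    by (intro linear_map.intro mod_hom.intro mod_hom_axioms.intro vec_vs vectorspace_eigenspace
        V.module_axioms W.module_axioms)
  have "vectorspace.dim class_ring (module_vec TYPE(complex) n)
      = vectorspace.dim class_ring eigenspace_module"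
    by (rule dim_eq) (simp_all add: inj_on_eigen_coset eigen_coset_image module_vec_simps)
  then show ?thesis unfolding refl_mult_def using V.dim_is_n by simp
qed

end

lemma finite_divisible_cycle_mins: "finite (divisible_cycle_mins w {1..a} q)"
proof (rule finite_subset)
  show "divisible_cycle_mins w {1..a} q \<subseteq> {1..a}" using divisible_cycle_min_in_range by blast
qed simp

lemma refl_mult_eq_card_free_cycle_mins: "refl_mult a w z = card free_cycle_mins"
proof -
  have "finite free_cycle_mins"
    unfolding free_cycle_mins_def by (rule finite_Diff[OF finite_divisible_cycle_mins])
  then obtain idx where "bij_betw idx free_cycle_mins {..<card free_cycle_mins}"
    using ex_bij_betw_finite_nat unfolding lessThan_atLeast0 by blast
  then show ?thesis by (rule refl_mult_eq_index_count)
qed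

lemma refl_mult_eq:
  assumes "z \<noteq> 1"
  shows "refl_mult a w z = card (divisible_cycle_mins w {1..a} q)"
  using assms by (simp add: refl_mult_eq_card_free_cycle_mins free_cycle_mins_def)

lemma Suc_refl_mult_eq:
  assumes "z = 1"
  shows "Suc (refl_mult a w z) = card (divisible_cycle_mins w {1..a} q)"
proof -
  have "free_cycle_mins = divisible_cycle_mins w {1..a} q - {1}"
    unfolding free_cycle_mins_def using assms by simp
  then show ?thesis
    unfolding refl_mult_eq_card_free_cycle_mins
    using card_Suc_Diff1[OF finite_divisible_cycle_mins one_divisible_cycle_min[OF assms]] by simp
qed

end

subsection \<open>The permutation character\<close>

lemma exp_root_of_unity_power_eq_1_iff:
  assumes N: "0 < N"
  shows "(exp (2 * complex_of_real pi * \<i> / of_nat N) ^ d) ^ l = 1 \<longleftrightarrow> N div gcd d N dvd l"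
proof -
  have "(exp (2 * complex_of_real pi * \<i> / of_nat N) ^ d) ^ l
      = exp (2 * complex_of_real pi * \<i> / of_nat N) ^ (d * l)"
    by (simp add: power_mult)
  also have "\<dots> = exp (2 * of_real pi * \<i> * of_nat (d * l) / of_nat N)"
    by (simp only: exp_of_nat_mult[symmetric]) (simp add: mult_ac)
  also have "\<dots> = 1 \<longleftrightarrow> N dvd d * l" using complex_root_unity_eq_1[of N "d * l"] N by simp
  also have "\<dots> \<longleftrightarrow> N div gcd d N dvd l" by (rule dvd_mult_iff_div_gcd[OF N])
  finally show ?thesis .
qed

context rational_slope
begin

lemma park_char_nontrivial_rotation:
  assumes w: "w permutes {1..a}" and d: "\<not> N dvd d"
  shows "park_char a b w d = b ^ card (divisible_cycle_mins w {1..a} (N div gcd d N))"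
  by (simp only: park_char_eq[OF w] card_fixed_parking_eq_card_fixed_labelling[OF w d refl]
      card_fixed_labellings[OF w])

lemma park_char_trivial_rotation:
  assumes w: "w permutes {1..a}" and d: "N dvd d"
  shows "b * park_char a b w d = b ^ card (divisible_cycle_mins w {1..a} 1)"
proof -
  have "{x \<in> parking. (rotate_parking ^^ d) x = x \<circ> w} = {x \<in> parking. x \<circ> w = x}"
    using funpow_rotate_parking_N[OF _ d] by auto
  then show ?thesis
    by (simp only: park_char_eq[OF w] card_fixed_parking[OF w] card_invariant_functions[OF w])
qed

end

theorem theorem6p3:
  fixes a b d :: nat and w :: "nat \<Rightarrow> nat"
  assumes "0 < a" and "a < b" and "coprime a b" and "w permutes {1..a}"
  shows "park_char a b w d =
    b ^ refl_mult a w (exp (2 * complex_of_real pi * \<i> / of_nat (b - 1)) ^ d)"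
proof -
  interpret rational_slope a b "b - 1"
    by unfold_locales (use assms in auto)
  define z where "z = exp (2 * complex_of_real pi * \<i> / of_nat (b - 1)) ^ d"
  define q where "q = (b - 1) div gcd d (b - 1)"
  have z_order: "z ^ l = 1 \<longleftrightarrow> q dvd l" for l
    unfolding z_def q_def by (rule exp_root_of_unity_power_eq_1_iff[OF N_pos])
  have q_pos: "0 < q" using N_pos by (simp add: q_def div_greater_zero_iff gcd_le2_nat)
  have q_eq_1_iff: "q = 1 \<longleftrightarrow> b - 1 dvd d" unfolding q_def by (rule div_gcd_eq_1_iff[OF N_pos])
  then have z_eq_1_iff: "z = 1 \<longleftrightarrow> b - 1 dvd d" using z_order[of 1] by simp
  show ?thesis unfolding z_def[symmetric]
  proof (cases "b - 1 dvd d")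
    case True
    then have "b * park_char a b w d = b ^ Suc (refl_mult a w z)"
      using park_char_trivial_rotation[OF assms(4)] Suc_refl_mult_eq[OF assms(1,4) z_order q_pos]
        q_eq_1_iff z_eq_1_iff by simp
    then show "park_char a b w d = b ^ refl_mult a w z" using b_pos by simp
  next
    case False
    then show "park_char a b w d = b ^ refl_mult a w z"
      using park_char_nontrivial_rotation[OF assms(4)] refl_mult_eq[OF assms(1,4) z_order q_pos]
        z_eq_1_iff by (simp only: q_def not_False_eq_True)
  qed
qed

end
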